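(* Let $\Gamma=\mathrm{WH}_n(a,b,c,d)$ be a Woolly Hat graph. Then $\Gamma$ is vertex-transitive if and only if $n$ is even and there exist an ordering $(b',c',d')$ of the three elements $b,c,d$, a sign $\epsilon\in\{1,-1\}$ and an element $q\in\mathbb{Z}_n$ coprime to $n$ such that, setting $\alpha=q\epsilon a$, $\beta=qb'$, $\gamma=qc'$, $\delta=qd'$, we have $\delta=2\alpha+\beta$ in $\mathbb{Z}_n$ and one of the following holds: (1) $(n,\alpha,\beta,\gamma,\delta)\in\{(8,2,1,0,5),(8,2,1,4,5)\}$; (2) $\alpha,\beta,\delta$ are odd, $\gamma$ is even, and $2\gamma=3\alpha+3\beta$ in $\mathbb{Z}_n$; (3) $n=4m$ with $m>1$ odd and $(\alpha,\beta,\gamma,\delta)=(2,m-2,0,m+2)$. (Note that $\mathrm{WH}_n(a,b,c,d)\cong \mathrm{WH}_n(\alpha,\beta,\gamma,\delta)$ for such data, since the definition is symmetric in $b,c,d$, invariant under $a\mapsto -a$, and multiplying all parameters by a unit gives an isomorphic graph.)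
   Context: For an integer $n\ge 3$ and $a,b,c,d\in\mathbb{Z}_n$ with $2a\neq 0$, $b,c,d$ pairwise distinct, and such that no prime divides $n$ together with (integer representatives of) all of $a,b,c,d$, the Woolly Hat graph $\mathrm{WH}_n(a,b,c,d)$ is the graph with vertex set $\{A_i,B_i,C_i : i\in\mathbb{Z}_n\}$ with adjacencies, for each $i\in\mathbb{Z}_n$ (subscripts mod $n$): $A_i\sim A_{i-a},A_{i+a},B_i,C_i$; $B_i\sim A_i,C_{i+b},C_{i+c},C_{i+d}$; $C_i\sim A_i,B_{i-b},B_{i-c},B_{i-d}$. Parity of an element of $\mathbb{Z}_n$ for $n$ even is the parity of any integer representative. *)

theory Defs
  imports
    "HOL-Computational_Algebra.Primes"
    "HOL-Number_Theory.Cong"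
    "HOL-Library.Multiset"
    "Graph_Theory.Graph_Theory"
begin

definition (in pre_digraph) automorphism :: "('a, 'b, 'a, 'b) digraph_isomorphism \<Rightarrow> bool" where
  "automorphism hom \<longleftrightarrow> digraph_isomorphism hom \<and> app_iso hom G = G"

definition (in pre_digraph) vertex_transitive :: bool where
  "vertex_transitive \<longleftrightarrow>
     (\<forall>u \<in> verts G. \<forall>v \<in> verts G. \<exists>hom. automorphism hom \<and> iso_verts hom u = v)"

text \<open>In a graph without parallel arcs an automorphism is determined by a permutation of the
  vertices preserving adjacency and non-adjacency.\<close>

lemma (in pair_wf_digraph) vertex_transitive_iff_bij_betw:
  "vertex_transitive \<longleftrightarrow>
     (\<forall>u \<in> pverts G. \<forall>v \<in> pverts G. \<exists>f. bij_betw f (pverts G) (pverts G) \<and>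
        (\<forall>x \<in> pverts G. \<forall>y \<in> pverts G. (f x, f y) \<in> parcs G \<longleftrightarrow> (x, y) \<in> parcs G) \<and> f u = v)"
  (is "?L \<longleftrightarrow> ?R")
proof
  assume L: ?L
  show ?R
  proof (intro ballI)
    fix u v assume "u \<in> pverts G" "v \<in> pverts G"
    with L obtain hom where h: "digraph_isomorphism hom" "app_iso hom (with_proj G) = with_proj G"
      and uv: "iso_verts hom u = v"
      by (auto simp: vertex_transitive_def automorphism_def)
    let ?f = "iso_verts hom"
    have V: "?f ` pverts G = pverts G" and E: "iso_arcs hom ` parcs G = parcs G"
      and tl: "iso_tail hom = fst" and hd: "iso_head hom = snd"
      using h(2) by (auto simp: app_iso_def with_proj_def)
    have inj: "inj_on ?f (pverts G)"
      using h(1) by (auto simp: digraph_isomorphism_def)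
    have arc: "iso_arcs hom e = (?f (fst e), ?f (snd e))" if "e \<in> parcs G" for e
      using h(1) that tl hd by (auto simp: digraph_isomorphism_def prod_eq_iff)
    have "(?f x, ?f y) \<in> parcs G \<longleftrightarrow> (x, y) \<in> parcs G" if "x \<in> pverts G" "y \<in> pverts G" for x y
    proof
      assume "(x, y) \<in> parcs G"
      then show "(?f x, ?f y) \<in> parcs G" using E arc by force
    next
      assume "(?f x, ?f y) \<in> parcs G"
      then obtain e where e: "e \<in> parcs G" "iso_arcs hom e = (?f x, ?f y)" using E by force
      then have "?f (fst e) = ?f x" "?f (snd e) = ?f y" using arc by auto
      moreover have "fst e \<in> pverts G" "snd e \<in> pverts G"
        using e(1) arc_fst_in_verts arc_snd_in_verts by auto
      ultimately have "e = (x, y)" using inj that by (auto simp: inj_on_def prod_eq_iff)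
      then show "(x, y) \<in> parcs G" using e by simp
    qed
    then show "\<exists>f. bij_betw f (pverts G) (pverts G) \<and>
        (\<forall>x \<in> pverts G. \<forall>y \<in> pverts G. (f x, f y) \<in> parcs G \<longleftrightarrow> (x, y) \<in> parcs G) \<and> f u = v"
      using V inj uv by (intro exI[of _ ?f]) (auto simp: bij_betw_def)
  qed
next
  assume R: ?R
  show ?L
    unfolding vertex_transitive_def with_proj_simps
  proof (intro ballI)
    fix u v assume "u \<in> pverts G" "v \<in> pverts G"
    with R obtain f where bij: "bij_betw f (pverts G) (pverts G)" and uv: "f u = v"
      and adj: "\<And>x y. x \<in> pverts G \<Longrightarrow> y \<in> pverts G \<Longrightarrow> (f x, f y) \<in> parcs G \<longleftrightarrow> (x, y) \<in> parcs G"
      by metis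
    define hom where "hom = \<lparr>iso_verts = f, iso_arcs = map_prod f f,
        iso_head = (snd :: 'a \<times> 'a \<Rightarrow> 'a), iso_tail = (fst :: 'a \<times> 'a \<Rightarrow> 'a)\<rparr>"
    have inj: "inj_on f (pverts G)" and V: "f ` pverts G = pverts G"
      using bij by (auto simp: bij_betw_def)
    have sub: "fst e \<in> pverts G" "snd e \<in> pverts G" if "e \<in> parcs G" for e
      using that arc_fst_in_verts arc_snd_in_verts by auto
    have "inj_on (map_prod f f) (parcs G)"
    proof (rule inj_onI)
      fix e e' assume *: "e \<in> parcs G" "e' \<in> parcs G" "map_prod f f e = map_prod f f e'"
      then have "f (fst e) = f (fst e')" "f (snd e) = f (snd e')"
        by (auto simp: map_prod_def split_def)
      then show "e = e'" using inj sub * by (auto simp: inj_on_def prod_eq_iff)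
    qed
    then have "digraph_isomorphism hom"
      using inj wf_digraph by (auto simp: digraph_isomorphism_def hom_def)
    moreover have "map_prod f f ` parcs G = parcs G"
    proof (intro equalityI subsetI)
      fix e assume "e \<in> map_prod f f ` parcs G"
      then obtain x y where "(x, y) \<in> parcs G" "e = (f x, f y)" by auto
      then show "e \<in> parcs G" using adj sub[of "(x, y)"] by simp
    next
      fix e assume e: "e \<in> parcs G"
      with sub V obtain x y where "x \<in> pverts G" "y \<in> pverts G" "e = (f x, f y)"
        by (metis imageE prod.collapse)
      then show "e \<in> map_prod f f ` parcs G" using adj e by force
    qed
    then have "app_iso hom (with_proj G) = with_proj G"
      using V by (simp add: app_iso_def with_proj_def hom_def)
    ultimately show "\<exists>hom. automorphism hom \<and> iso_verts hom u = v"
      using uv by (intro exI[of _ hom]) (simp add: automorphism_def hom_def)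
  qed
qed

text \<open>The ring of integers modulo \<open>n\<close> is represented by the residues \<open>{0..<n}\<close>.\<close>

datatype wh_vertex = VA int | VB int | VC int

definition WH :: "int \<Rightarrow> int \<Rightarrow> int \<Rightarrow> int \<Rightarrow> int \<Rightarrow> wh_vertex pair_pre_digraph" where
  "WH n a b c d =
    \<lparr> pverts = (\<Union>i \<in> {0..<n}. {VA i, VB i, VC i}),
      parcs = (\<Union>i \<in> {0..<n}.
         {VA i} \<times> {VA ((i - a) mod n), VA ((i + a) mod n), VB i, VC i} \<union>
         {VB i} \<times> {VA i, VC ((i + b) mod n), VC ((i + c) mod n), VC ((i + d) mod n)} \<union>
         {VC i} \<times> {VA i, VB ((i - b) mod n), VB ((i - c) mod n), VB ((i - d) mod n)}) \<rparr>"

definition woolly_hat_params :: "int \<Rightarrow> int \<Rightarrow> int \<Rightarrow> int \<Rightarrow> int \<Rightarrow> bool" where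
  "woolly_hat_params n a b c d \<longleftrightarrow>
     3 \<le> n \<and> {a, b, c, d} \<subseteq> {0..<n} \<and>
     \<not> [2 * a = 0] (mod n) \<and> distinct [b, c, d] \<and>
     (\<nexists>p. prime p \<and> p dvd n \<and> p dvd a \<and> p dvd b \<and> p dvd c \<and> p dvd d)"

lemma WH_verts:
  "VA i \<in> pverts (WH n a b c d) \<longleftrightarrow> 0 \<le> i \<and> i < n"
  "VB i \<in> pverts (WH n a b c d) \<longleftrightarrow> 0 \<le> i \<and> i < n"
  "VC i \<in> pverts (WH n a b c d) \<longleftrightarrow> 0 \<le> i \<and> i < n"
  by (auto simp: WH_def)

lemma WH_arcs:
  "(VA i, VA j) \<in> parcs (WH n a b c d) \<longleftrightarrow> 0 \<le> i \<and> i < n \<and> (j = (i - a) mod n \<or> j = (i + a) mod n)"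
  "(VA i, VB j) \<in> parcs (WH n a b c d) \<longleftrightarrow> 0 \<le> i \<and> i < n \<and> j = i"
  "(VA i, VC j) \<in> parcs (WH n a b c d) \<longleftrightarrow> 0 \<le> i \<and> i < n \<and> j = i"
  "(VB i, VA j) \<in> parcs (WH n a b c d) \<longleftrightarrow> 0 \<le> i \<and> i < n \<and> j = i"
  "(VC i, VA j) \<in> parcs (WH n a b c d) \<longleftrightarrow> 0 \<le> i \<and> i < n \<and> j = i"
  "(VB i, VB j) \<in> parcs (WH n a b c d) \<longleftrightarrow> False"
  "(VC i, VC j) \<in> parcs (WH n a b c d) \<longleftrightarrow> False"
  "(VB i, VC j) \<in> parcs (WH n a b c d) \<longleftrightarrow> 0 \<le> i \<and> i < n \<and>
     (j = (i + b) mod n \<or> j = (i + c) mod n \<or> j = (i + d) mod n)"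
  "(VC i, VB j) \<in> parcs (WH n a b c d) \<longleftrightarrow> 0 \<le> i \<and> i < n \<and>
     (j = (i - b) mod n \<or> j = (i - c) mod n \<or> j = (i - d) mod n)"
  by (auto simp: WH_def)

lemma pair_graph_WH:
  assumes "woolly_hat_params n a b c d"
  shows "pair_graph (WH n a b c d)"
proof -
  have n: "3 \<le> n" and a: "\<not> [2 * a = 0] (mod n)"
    using assms by (auto simp: woolly_hat_params_def)
  have "\<not> n dvd a" using a by (auto simp: cong_0_iff)
  then have loop: "(i + a) mod n \<noteq> i" "(i - a) mod n \<noteq> i" for i
    using mod_eq_dvd_iff[of "i + a" n i] mod_eq_dvd_iff[of "i - a" n i]
    by (auto dest: arg_cong[where f = "\<lambda>k. k mod n"])
  have cancel: "((i + x) mod n - x) mod n = i" "((i - x) mod n + x) mod n = i"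
    if "0 \<le> i" "i < n" for i x
    using that by (simp_all add: mod_simps)
  have range: "0 \<le> i mod n" "i mod n < n" for i
    using n by simp_all
  have symm: "(v, u) \<in> parcs (WH n a b c d)" if uv: "(u, v) \<in> parcs (WH n a b c d)" for u v
  proof (cases u; cases v)
    fix i j assume "u = VA i" "v = VA j"
    with uv show ?thesis
      by (auto simp: WH_arcs range cancel)
  next
    fix i j assume "u = VB i" "v = VC j"
    with uv show ?thesis
      by (auto simp: WH_arcs range cancel)
  next
    fix i j assume "u = VC i" "v = VB j"
    with uv show ?thesis
      by (auto simp: WH_arcs range cancel)
  qed (use uv in \<open>auto simp: WH_arcs\<close>)
  show ?thesis
  proof unfold_locales
    fix e assume e: "e \<in> parcs (WH n a b c d)"
    then have "fst e \<in> pverts (WH n a b c d) \<and> snd e \<in> pverts (WH n a b c d) \<and> fst e \<noteq> snd e"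
      by (cases e; cases "fst e"; cases "snd e")
        (auto simp: WH_arcs WH_verts range loop loop[symmetric])
    then show "fst e \<in> pverts (WH n a b c d)" "snd e \<in> pverts (WH n a b c d)" "fst e \<noteq> snd e"
      by simp_all
  next
    show "finite (parcs (WH n a b c d))" "finite (pverts (WH n a b c d))"
      by (auto simp: WH_def)
  next
    show "symmetric (with_proj (WH n a b c d))"
      using symm by (simp add: symmetric_def sym_def)
  qed
qed

end

theory Submission
  imports Defs
begin

text \<open>
  Rotation by the cyclic group together with the reflection \<open>A i \<mapsto> A (- i)\<close>, \<open>B i \<leftrightarrow> C (- i)\<close> has two vertex orbits, so the
  graph is vertex-transitive iff some automorphism sends \<open>A 0\<close> to \<open>B 0\<close>. For the listed parameters such an automorphism
  is given by an explicit formula.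

  Conversely, if the graph is vertex-transitive but not arc-transitive, the orbit of the edge from \<open>A 0\<close> to \<open>A a\<close> is a
  2-factor. It consists of horizontal lines \<open>\<dots>, A i, A (i + a), \<dots>\<close> and \<open>\<dots>, B i, C (i + d), B (i + d - b), \<dots>\<close>
  and the remaining edges form vertical lines \<open>\<dots>, A i, C i, B (i - c), A (i - c), \<dots>\<close>, for a suitable ordering of \<open>b, c, d\<close>.
  Every automorphism permutes both families of lines, and following the image of the
  lines through \<open>A 0\<close> yields the congruences between \<open>a, b, c, d\<close>.

  If the graph is arc-transitive, all arcs lie on the same number of 6-cycles. Each 6-cycle corresponds to a linear
  relation between \<open>a, b, c, d\<close>, and comparing the counts for the arc types forces \<open>3a = \<plusminus>z\<close> or \<open>2a = x - y\<close> for
  some \<open>x, y, z\<close> among \<open>b, c, d\<close>. In the first case some 2-path at \<open>A 0\<close>, but none at \<open>B 0\<close>, avoids all 6-cycles. In the second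
  case the vertical line through \<open>A 0\<close> closes after 12 steps and has no 3-arc on a 6-cycle; arc-transitivity transports
  this property to the horizontal line, so \<open>12a = 0\<close> and \<open>n\<close> divides 12.
\<close>

section \<open>Woolly Hat graphs and their automorphisms\<close>

text \<open>The reflection swaps \<open>A a\<close> with \<open>A (- a)\<close> and
  \<open>B 0\<close> with \<open>C 0\<close>, so a vertex-transitive graph is arc-transitive exactly
  when some automorphism fixes \<open>A 0\<close> and sends \<open>A a\<close> to
  \<open>B 0\<close>. If there is none, every vertex meets exactly two edges of the orbit of
  A-edges. The difficulty in that case is orientation: an automorphism may reverse one line and not
  the next. Horizontal orientations spread along vertical lines unless \<open>4 * a = 0\<close>,
  when horizontal lines are 4-cycles. Outside family (2), vertical orientations differ at
  \<open>A 0\<close> and \<open>A a\<close>, which leads to (1) and (3). In the arc-transitive case,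
  the walk with steps b, -c, d, -b, c, -d closes in every Woolly Hat graph. These generic 6-cycles
  meet only B-C edges, so edges at A-vertices must be compensated by special relations. Adding the
  counts for \<open>b\<close>, \<open>c\<close>, \<open>d\<close> and the A-edges cancels all
  relations with a single \<open>a\<close> and leaves \<open>6 * X + 3 * Y = 6 + r + 2 * e\<close>
  with \<open>X\<close> and \<open>Y\<close> at most 1. The number 12 is 3 times 4: three vertical
  steps shift the index by \<open>c\<close> up to sign, and \<open>4 * c = 0\<close> in the second
  case.\<close>

definition vA :: "int \<Rightarrow> int \<Rightarrow> wh_vertex" where "vA n i = VA (i mod n)"
definition vB :: "int \<Rightarrow> int \<Rightarrow> wh_vertex" where "vB n i = VB (i mod n)"
definition vC :: "int \<Rightarrow> int \<Rightarrow> wh_vertex" where "vC n i = VC (i mod n)"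

lemmas v_defs = vA_def vB_def vC_def

lemma v_distinct [simp]:
  "vA n i \<noteq> vB n j" "vA n i \<noteq> vC n j" "vB n i \<noteq> vC n j"
  "vB n i \<noteq> vA n j" "vC n i \<noteq> vA n j" "vC n i \<noteq> vB n j"
  by (simp_all add: v_defs)

text \<open>Indices are arbitrary integers, so equalities of vertices turn into divisibilities by
  \<open>n\<close>, the form in which \<open>algebra\<close> can combine them.\<close>

lemma v_eq_iff:
  "vA n i = vA n j \<longleftrightarrow> n dvd i - j" "vB n i = vB n j \<longleftrightarrow> n dvd i - j" "vC n i = vC n j \<longleftrightarrow> n dvd i - j"
  by (simp_all add: v_defs mod_eq_dvd_iff)

definition vmap :: "(int \<Rightarrow> wh_vertex) \<Rightarrow> (int \<Rightarrow> wh_vertex) \<Rightarrow> (int \<Rightarrow> wh_vertex) \<Rightarrow> wh_vertex \<Rightarrow> wh_vertex"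
  where "vmap f g h v = (case v of VA i \<Rightarrow> f i | VB i \<Rightarrow> g i | VC i \<Rightarrow> h i)"

lemma vmap_simps:
  "vmap f g h (vA n i) = f (i mod n)" "vmap f g h (vB n i) = g (i mod n)" "vmap f g h (vC n i) = h (i mod n)"
  by (simp_all add: vmap_def v_defs)

text \<open>The parameters are arbitrary integers and not residues: later instances use
  \<open>- a\<close>, \<open>q * b\<close> and \<open>2 * \<mu> - \<alpha>\<close>. For this reason
  distinctness is expressed by divisibility.\<close>

locale woolly_hat =
  fixes n a b c d :: int
  assumes n_ge: "3 \<le> n" and a2: "\<not> n dvd 2 * a"
    and bc: "\<not> n dvd b - c" and bd: "\<not> n dvd b - d" and cd: "\<not> n dvd c - d"
begin

abbreviation "A \<equiv> vA n"
abbreviation "B \<equiv> vB n"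
abbreviation "C \<equiv> vC n"

definition V where "V = pverts (WH n a b c d)"
definition E where "E = parcs (WH n a b c d)"
definition N where "N v = {w. (v, w) \<in> E}"

lemma mod_range [simp]: "0 \<le> i mod n" "i mod n < n"
  using n_ge by simp_all

lemma in_V [simp]: "A i \<in> V" "B i \<in> V" "C i \<in> V"
  by (simp_all add: V_def v_defs WH_verts)

lemma V_cases [consumes 1, case_names A B C]:
  assumes "v \<in> V"
  obtains i where "v = A i" | i where "v = B i" | i where "v = C i"
  using assms unfolding V_def v_defs
  by (cases v) (auto simp: WH_verts intro: mod_pos_pos_trivial[symmetric])

lemma finite_V: "finite V" and finite_E: "finite E"
  by (auto simp: V_def E_def WH_def)

lemma E_VA: "(VA i, w) \<in> E \<longleftrightarrow> 0 \<le> i \<and> i < n \<and> w \<in> {A (i + a), A (i - a), B i, C i}"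
  and E_VB: "(VB i, w) \<in> E \<longleftrightarrow> 0 \<le> i \<and> i < n \<and> w \<in> {A i, C (i + b), C (i + c), C (i + d)}"
  and E_VC: "(VC i, w) \<in> E \<longleftrightarrow> 0 \<le> i \<and> i < n \<and> w \<in> {A i, B (i - b), B (i - c), B (i - d)}"
  unfolding E_def by (cases w; auto simp: WH_arcs v_defs)+

lemma N_A: "N (A i) = {A (i + a), A (i - a), B i, C i}"
  and N_B: "N (B i) = {A i, C (i + b), C (i + c), C (i + d)}"
  and N_C: "N (C i) = {A i, B (i - b), B (i - c), B (i - d)}"
  unfolding N_def vA_def[of n i] vB_def[of n i] vC_def[of n i] E_VA E_VB E_VC
  by (auto simp: v_defs mod_simps)

lemma E_iff: "(v, w) \<in> E \<longleftrightarrow> w \<in> N v"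
  by (simp add: N_def)

lemma E_in_V: "(v, w) \<in> E \<Longrightarrow> v \<in> V \<and> w \<in> V"
  by (cases v) (auto simp: E_VA E_VB E_VC V_def WH_verts v_defs)

lemma N_subset: "v \<in> V \<Longrightarrow> N v \<subseteq> V"
  by (auto simp: N_def dest: E_in_V)

lemma N_sym: "w \<in> N v \<Longrightarrow> v \<in> N w"
proof -
  assume w: "w \<in> N v"
  then have "v \<in> V" using E_in_V by (auto simp: N_def)
  then show ?thesis using w
    by (cases rule: V_cases) (auto simp: N_A N_B N_C v_eq_iff)
qed

definition aut :: "(wh_vertex \<Rightarrow> wh_vertex) \<Rightarrow> bool" where
  "aut f \<longleftrightarrow> bij_betw f V V \<and> (\<forall>x\<in>V. \<forall>y\<in>V. f y \<in> N (f x) \<longleftrightarrow> y \<in> N x)"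

text \<open>An injective map of the finite arc set \<open>E\<close> into itself is onto, so a map
  that preserves adjacency also reflects it.\<close>

lemma autI:
  assumes inj: "inj_on f V" and V: "\<And>v. v \<in> V \<Longrightarrow> f v \<in> V"
    and adj: "\<And>v w. v \<in> V \<Longrightarrow> w \<in> N v \<Longrightarrow> f w \<in> N (f v)"
  shows "aut f"
proof -
  have bij: "bij_betw f V V"
    using inj V endo_inj_surj[OF finite_V _ inj] by (auto simp: bij_betw_def)
  let ?g = "map_prod f f"
  have "inj_on ?g (V \<times> V)" using inj by (simp add: map_prod_inj_on)
  moreover have EV: "E \<subseteq> V \<times> V" using E_in_V by auto
  ultimately have "inj_on ?g E" by (rule inj_on_subset)
  moreover have "?g ` E \<subseteq> E" using adj E_in_V by (force simp: E_iff)
  ultimately have "?g ` E = E" using finite_E endo_inj_surj by blast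
  then have "y \<in> N x" if "x \<in> V" "y \<in> V" "f y \<in> N (f x)" for x y
  proof -
    have "(f x, f y) \<in> ?g ` E" using that \<open>?g ` E = E\<close> by (simp add: E_iff)
    then obtain u v where uv: "(u, v) \<in> E" "f x = f u" "f y = f v" by auto
    then have "u = x" "v = y" using inj that EV by (auto simp: inj_on_def)
    then show ?thesis using uv by (simp add: E_iff)
  qed
  then show ?thesis using bij adj by (auto simp: aut_def)
qed

lemma aut_V: "aut f \<Longrightarrow> v \<in> V \<Longrightarrow> f v \<in> V"
  by (auto simp: aut_def bij_betw_def)

lemma aut_inj: "aut f \<Longrightarrow> u \<in> V \<Longrightarrow> v \<in> V \<Longrightarrow> f u = f v \<longleftrightarrow> u = v"
  by (auto simp: aut_def bij_betw_def inj_on_def)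

lemma aut_adj: "aut f \<Longrightarrow> u \<in> V \<Longrightarrow> v \<in> V \<Longrightarrow> f u \<in> N (f v) \<longleftrightarrow> u \<in> N v"
  by (auto simp: aut_def)

lemma aut_N: assumes "aut f" "v \<in> V" shows "N (f v) = f ` N v"
proof
  show "f ` N v \<subseteq> N (f v)" using assms N_subset[of v] by (auto simp: aut_adj)
  show "N (f v) \<subseteq> f ` N v"
  proof
    fix w assume w: "w \<in> N (f v)"
    then have "w \<in> V" using assms aut_V N_subset by blast
    moreover have "f ` V = V" using assms by (simp add: aut_def bij_betw_def)
    ultimately obtain u where "u \<in> V" "w = f u" by blast
    then show "w \<in> f ` N v" using w assms by (auto simp: aut_adj)
  qed
qed

lemma aut_comp: assumes "aut f" "aut g" shows "aut (f \<circ> g)"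
proof -
  have "bij_betw (f \<circ> g) V V" using assms by (auto simp: aut_def intro: bij_betw_trans)
  then show ?thesis using assms aut_V[OF assms(2)] aut_adj[OF assms(1)] aut_adj[OF assms(2)]
    by (simp add: aut_def[of "f \<circ> g"])
qed

lemma aut_inv: assumes "aut f" obtains g where "aut g" "\<And>v. v \<in> V \<Longrightarrow> g (f v) = v" "\<And>v. v \<in> V \<Longrightarrow> f (g v) = v"
proof
  let ?g = "inv_into V f"
  have bij: "bij_betw f V V" using assms by (simp add: aut_def)
  show 1: "?g (f v) = v" if "v \<in> V" for v using bij that by (simp add: bij_betw_def)
  show 2: "f (?g v) = v" if "v \<in> V" for v using bij that by (simp add: bij_betw_def f_inv_into_f)
  have "bij_betw ?g V V" using bij by (rule bij_betw_inv_into)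
  moreover have "?g v \<in> V" if "v \<in> V" for v using calculation that by (auto simp: bij_betw_def)
  ultimately show "aut ?g" using aut_adj[OF assms] 2 by (metis aut_def)
qed

section \<open>Rotations and the reflection\<close>

definition rot :: "int \<Rightarrow> wh_vertex \<Rightarrow> wh_vertex" where
  "rot k = vmap (\<lambda>i. A (i + k)) (\<lambda>i. B (i + k)) (\<lambda>i. C (i + k))"

definition reflection :: "wh_vertex \<Rightarrow> wh_vertex" where
  "reflection = vmap (\<lambda>i. A (- i)) (\<lambda>i. C (- i)) (\<lambda>i. B (- i))"

lemma rot [simp]: "rot k (A i) = A (i + k)" "rot k (B i) = B (i + k)" "rot k (C i) = C (i + k)"
  by (simp_all add: rot_def vmap_def v_defs mod_simps)

lemma reflection [simp]: "reflection (A i) = A (- i)" "reflection (B i) = C (- i)" "reflection (C i) = B (- i)"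
  by (simp_all add: reflection_def vmap_def v_defs mod_simps)

lemma aut_rot: "aut (rot k)"
proof (rule autI)
  show "inj_on (rot k) V"
    by (rule inj_onI, elim V_cases) (auto simp: v_eq_iff)
next
  fix v assume v: "v \<in> V"
  then show "rot k v \<in> V" by (cases rule: V_cases) auto
  show "rot k w \<in> N (rot k v)" if "w \<in> N v" for w
    using v that by (cases rule: V_cases) (auto simp: N_A N_B N_C v_eq_iff)
qed

lemma aut_reflection: "aut reflection"
proof (rule autI)
  show "inj_on reflection V"
    by (rule inj_onI, elim V_cases) (auto simp: v_eq_iff dvd_diff_commute)
next
  fix v assume v: "v \<in> V"
  then show "reflection v \<in> V" by (cases rule: V_cases) auto
  show "reflection w \<in> N (reflection v)" if "w \<in> N v" for w
    using v that by (cases rule: V_cases) (auto simp: N_A N_B N_C v_eq_iff)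
qed

lemma transitive_iff:
  "(\<forall>u\<in>V. \<forall>v\<in>V. \<exists>f. aut f \<and> f u = v) \<longleftrightarrow> (\<exists>f. aut f \<and> f (A 0) = B 0)"
proof
  assume "\<exists>f. aut f \<and> f (A 0) = B 0"
  then obtain f where f: "aut f" "f (A 0) = B 0" by blast
  have from_A: "\<exists>g. aut g \<and> g (A 0) = v" if "v \<in> V" for v
    using that
  proof (cases rule: V_cases)
    case (A i)
    then show ?thesis using aut_rot[of i] by (intro exI[of _ "rot i"]) simp
  next
    case (B i)
    then show ?thesis using aut_rot[of i] f
      by (intro exI[of _ "rot i \<circ> f"]) (simp add: aut_comp)
  next
    case (C i)
    then show ?thesis using aut_rot[of i] f
      by (intro exI[of _ "rot i \<circ> (reflection \<circ> f)"]) (simp add: aut_comp aut_reflection)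
  qed
  show "\<forall>u\<in>V. \<forall>v\<in>V. \<exists>f. aut f \<and> f u = v"
  proof (intro ballI)
    fix u v assume "u \<in> V" "v \<in> V"
    then obtain g h where g: "aut g" "g (A 0) = u" and h: "aut h" "h (A 0) = v"
      using from_A by meson
    obtain g' where g': "aut g'" "\<And>v. v \<in> V \<Longrightarrow> g' (g v) = v" using aut_inv[OF g(1)] by metis
    then show "\<exists>f. aut f \<and> f u = v"
      using g h by (intro exI[of _ "h \<circ> g'"]) (auto simp: aut_comp)
  qed
qed auto

end

lemma woolly_hat_of_params: "woolly_hat_params n a b c d \<Longrightarrow> woolly_hat n a b c d"
proof
  assume wh: "woolly_hat_params n a b c d"
  then show "3 \<le> n" "\<not> n dvd 2 * a" by (auto simp: woolly_hat_params_def cong_0_iff)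
  have "\<not> n dvd x - y" if "x \<in> {b, c, d}" "y \<in> {b, c, d}" "x \<noteq> y" for x y
  proof -
    have "x mod n = x" "y mod n = y" using that wh by (auto simp: woolly_hat_params_def)
    then show ?thesis using that(3) by (simp flip: mod_eq_dvd_iff)
  qed
  then show "\<not> n dvd b - c" "\<not> n dvd b - d" "\<not> n dvd c - d"
    using wh by (auto simp: woolly_hat_params_def)
qed

lemma vertex_transitive_iff:
  assumes "woolly_hat_params n a b c d"
  shows "pre_digraph.vertex_transitive (with_proj (WH n a b c d)) \<longleftrightarrow>
    (\<exists>f. woolly_hat.aut n a b c d f \<and> f (vA n 0) = vB n 0)"
proof -
  interpret pair_graph "WH n a b c d" using assms by (rule pair_graph_WH)
  interpret woolly_hat n a b c d using assms by (rule woolly_hat_of_params)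
  show ?thesis
    unfolding transitive_iff[symmetric]
    unfolding vertex_transitive_iff_bij_betw aut_def E_iff[symmetric] E_def V_def conj_assoc ..
qed

section \<open>Automorphisms for the listed parameters\<close>

lemma dvd_combine: "n dvd x \<Longrightarrow> n dvd y \<Longrightarrow> z = k * x + l * y \<Longrightarrow> n dvd z" for n :: int
  by simp

lemma v_mod:
  "vA n (i mod n) = vA n i" "vA n (i mod n + k) = vA n (i + k)" "vA n (i mod n - k) = vA n (i - k)"
  "vB n (i mod n) = vB n i" "vB n (i mod n + k) = vB n (i + k)" "vB n (i mod n - k) = vB n (i - k)"
  "vC n (i mod n) = vC n i" "vC n (i mod n + k) = vC n (i + k)" "vC n (i mod n - k) = vC n (i - k)"
  by (simp_all add: v_defs mod_simps)

text \<open>Periodicity makes \<open>f ^^ k\<close> an inverse of \<open>f\<close>, which gives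
  injectivity; symmetry of \<open>N\<close> reduces adjacency to one direction of each kind of
  edge.\<close>

lemma (in woolly_hat) aut_if_periodic:
  assumes dom: "\<And>i. f (A i) \<in> V" "\<And>i. f (B i) \<in> V" "\<And>i. f (C i) \<in> V"
    and per: "\<And>i. (f ^^ Suc k) (A i) = A i" "\<And>i. (f ^^ Suc k) (B i) = B i" "\<And>i. (f ^^ Suc k) (C i) = C i"
    and AA: "\<And>i. f (A (i + a)) \<in> N (f (A i))"
    and AB: "\<And>i. f (B i) \<in> N (f (A i))" and AC: "\<And>i. f (C i) \<in> N (f (A i))"
    and BC: "\<And>i. f (C (i + b)) \<in> N (f (B i))" "\<And>i. f (C (i + c)) \<in> N (f (B i))"
      "\<And>i. f (C (i + d)) \<in> N (f (B i))"
  shows "aut f"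
proof (rule autI)
  have "(f ^^ k) (f v) = v" if "v \<in> V" for v
    using that per by (cases rule: V_cases) (simp_all add: funpow_swap1)
  then show "inj_on f V" by (rule inj_on_inverseI)
  fix v assume v: "v \<in> V"
  then show "f v \<in> V" by (cases rule: V_cases) (auto simp: dom)
  have AA': "f (A (i - a)) \<in> N (f (A i))" for i
    using N_sym[OF AA[of "i - a"]] by simp
  have CB: "f (B (i - b)) \<in> N (f (C i))" "f (B (i - c)) \<in> N (f (C i))" "f (B (i - d)) \<in> N (f (C i))" for i
    using N_sym[OF BC(1)[of "i - b"]] N_sym[OF BC(2)[of "i - c"]] N_sym[OF BC(3)[of "i - d"]] by simp_all
  show "f w \<in> N (f v)" if "w \<in> N v" for w
    using v that by (cases rule: V_cases) (auto simp: N_A N_B N_C AA AA' AB AC BC CB N_sym[OF AB] N_sym[OF AC])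
qed

text \<open>Family (2), parametrised by \<open>\<mu>\<close>. The automorphism has order 3: on even
  indices it runs through A, B, C with shifts \<open>- \<mu>\<close>, \<open>2 * \<mu>\<close>,
  \<open>- \<mu>\<close>, on odd indices through A, C, B with the opposite shifts. As
  \<open>\<mu>\<close> and \<open>n\<close> are even, the two parity classes stay apart.\<close>

lemma (in woolly_hat) aut_parity:
  assumes n: "even n" and a: "odd a" and \<mu>: "even \<mu>" and par: "b = 2 * \<mu> - a" "c = 3 * \<mu>" "d = 2 * \<mu> + a"
  shows "\<exists>f. aut f \<and> f (A 0) = B (- \<mu>)"
proof -
  define f where "f = vmap
    (\<lambda>i. if even i then B (i - \<mu>) else C (i + \<mu>))
    (\<lambda>i. if even i then C (i + 2 * \<mu>) else A (i + \<mu>))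
    (\<lambda>i. if even i then A (i - \<mu>) else B (i - 2 * \<mu>))"
  have fA: "f (A i) = (if even i then B (i - \<mu>) else C (i + \<mu>))"
   and fB: "f (B i) = (if even i then C (i + 2 * \<mu>) else A (i + \<mu>))"
   and fC: "f (C i) = (if even i then A (i - \<mu>) else B (i - 2 * \<mu>))" for i
    using n by (simp_all add: f_def vmap_simps v_mod dvd_mod_iff)
  have "odd b" "even c" "odd d" using a \<mu> par by simp_all
  note par' = a \<mu> this
  have "aut f"
  proof (rule aut_if_periodic)
    show "f (A i) \<in> V" "f (B i) \<in> V" "f (C i) \<in> V" for i by (simp_all add: fA fB fC)
    show "(f ^^ Suc 2) (A i) = A i" "(f ^^ Suc 2) (B i) = B i" "(f ^^ Suc 2) (C i) = C i" for i
      using \<mu> by (simp_all add: fA fB fC numeral_2_eq_2 algebra_simps)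
    show "f (A (i + a)) \<in> N (f (A i))" "f (B i) \<in> N (f (A i))" "f (C i) \<in> N (f (A i))"
      "f (C (i + b)) \<in> N (f (B i))" "f (C (i + c)) \<in> N (f (B i))" "f (C (i + d)) \<in> N (f (B i))" for i
      by (cases "even i"; use par' in \<open>simp add: fA fB fC N_A N_B N_C v_eq_iff\<close>; simp add: par algebra_simps)+
  qed
  then show ?thesis using fA[of 0] by auto
qed

text \<open>Families (1) and (3) together: for \<open>n = 8\<close> the choice \<open>m = 3\<close>
  gives \<open>b = 1\<close> and \<open>d = 5\<close>. The map is an involution that preserves the
  index classes of 0 and \<open>m\<close> modulo 4 and exchanges those of 2 and
  \<open>m + 2\<close>; the shifts by \<open>c\<close> cancel because
  \<open>n dvd 2 * c\<close>.\<close>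

lemma (in woolly_hat) aut_mod_four:
  assumes n: "n = 4 * m \<and> c = 0 \<or> n = 8 \<and> m = 3 \<and> c \<in> {0, 4}" and m: "odd m"
    and par: "a = 2" "b = m - 2" "d = m + 2"
  shows "\<exists>f. aut f \<and> f (A 0) = B 0"
proof -
  define f where "f = vmap
    (\<lambda>i. if 4 dvd i then B i else if 4 dvd i - m then C (i + c) else if even i then C (i + m) else B (i - m))
    (\<lambda>i. if 4 dvd i then A i else if 4 dvd i - m then B i else if even i then A (i + m) else C (i + (c - m)))
    (\<lambda>i. if 4 dvd i then C (i + c) else if 4 dvd i - m then A (i + c) else if even i then B (i + (m + c)) else A (i - m))"
  have c: "4 dvd c" "n dvd 2 * c" using n by auto
  have n4: "4 dvd n" using n by auto
  then have n2: "even n" by presburger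
  have d4: "4 dvd i mod n \<longleftrightarrow> 4 dvd i" "4 dvd i mod n - m \<longleftrightarrow> 4 dvd i - m" for i
    using n4 by (simp_all add: dvd_mod_iff mod_mod_cancel flip: mod_eq_dvd_iff)
  have d2: "even (i mod n) \<longleftrightarrow> even i" for i using n2 by (simp add: dvd_mod_iff)
  have fA: "f (A i) = (if 4 dvd i then B i else if 4 dvd i - m then C (i + c) else if even i then C (i + m) else B (i - m))"
   and fB: "f (B i) = (if 4 dvd i then A i else if 4 dvd i - m then B i else if even i then A (i + m) else C (i + (c - m)))"
   and fC: "f (C i) = (if 4 dvd i then C (i + c) else if 4 dvd i - m then A (i + c) else if even i then B (i + (m + c)) else A (i - m))" for i
    by (simp_all add: f_def vmap_simps v_mod d4 d2)
  have cases: "(4 dvd i) \<and> even i \<and> \<not> 4 dvd i - m \<or> \<not> (4 dvd i) \<and> 4 dvd i - m \<and> odd i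
    \<or> \<not> (4 dvd i) \<and> \<not> 4 dvd i - m \<and> even i \<or> \<not> (4 dvd i) \<and> \<not> 4 dvd i - m \<and> odd i" for i
    using m by presburger
  have "aut f"
  proof (rule aut_if_periodic)
    show "f (A i) \<in> V" "f (B i) \<in> V" "f (C i) \<in> V" for i by (simp_all add: fA fB fC)
    have c2: "n dvd c + c" using c by simp
    have s: "4 dvd i + m \<longleftrightarrow> \<not> 4 dvd i - m \<and> odd i" "4 dvd i - 2 * m \<longleftrightarrow> \<not> 4 dvd i \<and> even i" 
      "4 dvd i + c \<longleftrightarrow> 4 dvd i" "4 dvd i + (c - m) \<longleftrightarrow> 4 dvd i - m" "4 dvd i + c - m \<longleftrightarrow> 4 dvd i - m" "even c"
      "4 dvd i + (m + c) \<longleftrightarrow> \<not> 4 dvd i - m \<and> odd i" for i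
      using m c(1) by presburger+
    show "(f ^^ Suc 1) (A i) = A i" "(f ^^ Suc 1) (B i) = B i" "(f ^^ Suc 1) (C i) = C i" for i
      using cases[of i] m c2 by (elim disjE; simp add: fA fB fC s v_eq_iff)+
    show "f (A (i + a)) \<in> N (f (A i))" "f (B i) \<in> N (f (A i))" "f (C i) \<in> N (f (A i))"
      "f (C (i + b)) \<in> N (f (B i))" "f (C (i + c)) \<in> N (f (B i))" "f (C (i + d)) \<in> N (f (B i))" for i
    proof -
      have t: "4 dvd i + a \<longleftrightarrow> \<not> 4 dvd i \<and> even i" "4 dvd i + a - m \<longleftrightarrow> \<not> 4 dvd i - m \<and> odd i"
        "4 dvd i + b \<longleftrightarrow> 4 dvd i - m" "4 dvd i + d \<longleftrightarrow> 4 dvd i - m" "4 dvd i + c \<longleftrightarrow> 4 dvd i" 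
        "4 dvd i + c - m \<longleftrightarrow> 4 dvd i - m"
        "4 dvd i + b - m \<longleftrightarrow> \<not> 4 dvd i \<and> even i" "4 dvd i + d - m \<longleftrightarrow> \<not> 4 dvd i \<and> even i"
        "even a" "even c" "odd b" "odd d"
        using m c(1) unfolding par by presburger+
      show "f (A (i + a)) \<in> N (f (A i))" "f (B i) \<in> N (f (A i))" "f (C i) \<in> N (f (A i))"
      "f (C (i + b)) \<in> N (f (B i))" "f (C (i + c)) \<in> N (f (B i))" "f (C (i + d)) \<in> N (f (B i))"
        by (use cases[of i] m in \<open>elim disjE\<close>; simp add: fA fB fC N_A N_B N_C v_eq_iff t; use n in \<open>auto simp: par c2 algebra_simps\<close>)+
    qed
  qed
  then show ?thesis using fA[of 0] by auto
qed



section \<open>Changing the parameters by units, signs and permutations\<close>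

definition scale :: "int \<Rightarrow> int \<Rightarrow> wh_vertex \<Rightarrow> wh_vertex" where
  "scale n q = vmap (\<lambda>i. vA n (q * i)) (\<lambda>i. vB n (q * i)) (\<lambda>i. vC n (q * i))"

lemma scale [simp]:
  "scale n q (vA n i) = vA n (q * i)" "scale n q (vB n i) = vB n (q * i)" "scale n q (vC n i) = vC n (q * i)"
  by (simp_all add: scale_def vmap_simps) (simp_all add: v_defs mod_simps)

lemma scale_N:
  assumes wh: "woolly_hat n a b c d" "woolly_hat n a' b' c' d'" and e: "\<epsilon> \<in> {1, -1}"
    and par: "n dvd a' - q * \<epsilon> * a" "n dvd b' - q * b" "n dvd c' - q * c" "n dvd d' - q * d"
    and v: "v \<in> woolly_hat.V n a b c d" "w \<in> woolly_hat.N n a b c d v"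
  shows "scale n q w \<in> woolly_hat.N n a' b' c' d' (scale n q v)"
proof -
  interpret W: woolly_hat n a b c d by fact
  interpret W': woolly_hat n a' b' c' d' by fact
  have *: "n dvd q * (i + x) - (q * i + x')" "n dvd q * (i - x) - (q * i - x')" if "n dvd x' - q * x" for i x x'
    using that by algebra+
  \<comment> \<open>The sign \<open>\<epsilon>\<close> can only interchange the two A-neighbours of
    an A-vertex.\<close>
  have "n dvd a' - q * a \<or> n dvd a' - q * (- a)" using e par(1) by auto
  then have "vA n (q * (i + a)) \<in> {vA n (q * i + a'), vA n (q * i - a')}"
    "vA n (q * (i - a)) \<in> {vA n (q * i + a'), vA n (q * i - a')}" for i
    using *[of a' a i] *[of a' "- a" i] *[of "-a'" "- a" i] *[of "-a'" "a" i]
    by (auto simp: v_eq_iff)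
  note a_facts = this and facts = *[OF par(2)] *[OF par(3)] *[OF par(4)]
  from v(1) show ?thesis
  proof (cases rule: W.V_cases)
    case (A i)
    then show ?thesis using v(2) a_facts[of i] by (auto simp: W.N_A W'.N_A)
  qed (use v(2) facts in \<open>auto simp: W.N_B W.N_C W'.N_B W'.N_C v_eq_iff\<close>)
qed

text \<open>Conjugation by \<open>scale n q\<close>, whose inverse on vertices is scaling by an
  inverse \<open>r\<close> of \<open>q\<close> modulo \<open>n\<close>, carries \<open>f\<close>
  back. A rotation then moves the image of \<open>A 0\<close> to \<open>B 0\<close>, so the given
  \<open>f\<close> may send \<open>A 0\<close> to any \<open>B i\<close>.\<close>

lemma automorphism_transfer:
  assumes wh: "woolly_hat n a b c d" "woolly_hat n a' b' c' d'"
    and q: "coprime q n" and e: "\<epsilon> \<in> {1, -1}"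
    and par: "n dvd a' - q * \<epsilon> * a" "n dvd b' - q * b" "n dvd c' - q * c" "n dvd d' - q * d"
    and f: "woolly_hat.aut n a' b' c' d' f" "f (vA n 0) = vB n i"
  shows "\<exists>f. woolly_hat.aut n a b c d f \<and> f (vA n 0) = vB n 0"
proof -
  interpret W: woolly_hat n a b c d by fact
  interpret W': woolly_hat n a' b' c' d' by fact
  obtain r where r: "[q * r = 1] (mod n)" using q cong_solve_coprime_int by blast
  then have qr: "n dvd q * r - 1" by (simp add: cong_iff_dvd_diff)
  let ?g = "scale n q" and ?h = "scale n r"
  have V: "W.V = W'.V" by (simp add: W.V_def W'.V_def WH_def)
  have inv: "n dvd q * (r * i) - i" "n dvd r * (q * i) - i" for i using qr by algebra+
  have hg: "?h (?g v) = v" "?g (?h v) = v" and gh_V: "?g v \<in> W.V" "?h v \<in> W.V" if "v \<in> W.V" for v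
    by (rule W.V_cases[OF that]; simp add: v_eq_iff inv)+
  have gN: "?g w \<in> W'.N (?g v)" if "v \<in> W.V" "w \<in> W.N v" for v w
    using that by (rule scale_N[OF wh e par])
  have "\<epsilon> * \<epsilon> = 1" using e by auto
  then have "n dvd a - r * \<epsilon> * a'" "n dvd b - r * b'" "n dvd c - r * c'" "n dvd d - r * d'"
    using par qr by algebra+
  from scale_N[OF wh(2,1) e this]
  have hN: "?h w \<in> W.N (?h v)" if "v \<in> W.V" "w \<in> W'.N v" for v w
    using that V by simp
  have "W.aut (?h \<circ> f \<circ> ?g)"
  proof (rule W.autI)
    show "inj_on (?h \<circ> f \<circ> ?g) W.V"
    proof (rule inj_onI)
      fix x y assume xy: "x \<in> W.V" "y \<in> W.V" "(?h \<circ> f \<circ> ?g) x = (?h \<circ> f \<circ> ?g) y"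
      then have "f (?g x) \<in> W.V" "f (?g y) \<in> W.V" using gh_V W'.aut_V[OF f(1)] V by auto
      then have "f (?g x) = f (?g y)" using xy hg by (metis comp_apply)
      then have "?g x = ?g y" using xy gh_V W'.aut_inj[OF f(1)] V by auto
      then show "x = y" using xy hg by metis
    qed
  next
    fix v w assume v: "v \<in> W.V"
    then show "(?h \<circ> f \<circ> ?g) v \<in> W.V" using gh_V W'.aut_V[OF f(1)] V by auto
    assume w: "w \<in> W.N v"
    then have "?g w \<in> W'.N (?g v)" "w \<in> W.V" using v gN W.N_subset by auto
    then have "f (?g w) \<in> W'.N (f (?g v))" using v gh_V W'.aut_adj[OF f(1)] V by auto
    then show "(?h \<circ> f \<circ> ?g) w \<in> W.N ((?h \<circ> f \<circ> ?g) v)"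
      using hN v gh_V W'.aut_V[OF f(1)] V by auto
  qed
  then have "W.aut (W.rot (- (r * i)) \<circ> (?h \<circ> f \<circ> ?g))" by (simp add: W.aut_comp W.aut_rot)
  moreover have "(W.rot (- (r * i)) \<circ> (?h \<circ> f \<circ> ?g)) (vA n 0) = vB n 0"
    using f(2) by simp
  ultimately show ?thesis by blast
qed

lemma woolly_hat_cong:
  assumes "woolly_hat n a b c d" "n dvd a - a'" "n dvd b - b'" "n dvd c - c'" "n dvd d - d'"
  shows "woolly_hat n a' b' c' d'"
proof -
  interpret woolly_hat n a b c d by fact
  show ?thesis
  proof
    show "3 \<le> n" by (rule n_ge)
    have "n dvd 2 * a" if "n dvd 2 * a'" using that assms(2) by algebra
    then show "\<not> n dvd 2 * a'" using a2 by blast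
    have "n dvd x - y" if "n dvd x - x'" "n dvd y - y'" "n dvd x' - y'" for x y x' y'
      using that by algebra
    from this[OF assms(3,4)] this[OF assms(3,5)] this[OF assms(4,5)]
    show "\<not> n dvd b' - c'" "\<not> n dvd b' - d'" "\<not> n dvd c' - d'" using bc bd cd by blast+
  qed
qed

lemma woolly_hat_scale:
  assumes "woolly_hat n a b c d" "coprime q n" "\<epsilon> \<in> {1, -1}"
  shows "woolly_hat n (q * \<epsilon> * a) (q * b) (q * c) (q * d)"
proof -
  interpret woolly_hat n a b c d by fact
  have *: "n dvd x" if "n dvd q * x" for x using that assms(2) coprime_commute coprime_dvd_mult_right_iff by blast
  show ?thesis
  proof
    show "3 \<le> n" by (rule n_ge)
    show "\<not> n dvd 2 * (q * \<epsilon> * a)" using a2 *[of "2 * a"] assms(3) by (auto simp: algebra_simps)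
    show "\<not> n dvd q * b - q * c" "\<not> n dvd q * b - q * d" "\<not> n dvd q * c - q * d"
      using bc bd cd *[of "b - c"] *[of "b - d"] *[of "c - d"] by (auto simp: right_diff_distrib)
  qed
qed

lemma woolly_hat_perm:
  assumes "woolly_hat n a b c d" "mset [b', c', d'] = mset [b, c, d]"
  shows "woolly_hat n a b' c' d'" "woolly_hat.N n a b' c' d' = woolly_hat.N n a b c d"
    "woolly_hat.V n a b' c' d' = woolly_hat.V n a b c d"
    "woolly_hat.aut n a b' c' d' = woolly_hat.aut n a b c d"
proof -
  interpret woolly_hat n a b c d by fact
  have p: "(b', c', d') \<in> {(b, c, d), (b, d, c), (c, b, d), (c, d, b), (d, b, c), (d, c, b)}"
  proof -
    have "{b', c', d'} = {b, c, d}" using mset_eq_setD[OF assms(2)] by simp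
    then have "b' \<in> {b, c, d}" "c' \<in> {b, c, d}" "d' \<in> {b, c, d}" by blast+
    moreover have "distinct [b, c, d]" using bc bd cd by auto
    then have "distinct [b', c', d']" using mset_eq_imp_distinct_iff[OF assms(2)] by simp
    ultimately show ?thesis by (elim insertE emptyE; simp)
  qed
  moreover have "\<not> n dvd c - b" "\<not> n dvd d - b" "\<not> n dvd d - c"
    using bc bd cd dvd_diff_commute by blast+
  ultimately show wh: "woolly_hat n a b' c' d'"
    using n_ge a2 bc bd cd by unfold_locales auto
  interpret W: woolly_hat n a b' c' d' by fact
  have "WH n a b' c' d' = WH n a b c d"
  proof -
    have *: "{f b', f c', f d'} = {f b, f c, f d}" for f :: "int \<Rightarrow> wh_vertex"
      using p by auto
    have "{VC ((i + b') mod n), VC ((i + c') mod n), VC ((i + d') mod n)} =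
        {VC ((i + b) mod n), VC ((i + c) mod n), VC ((i + d) mod n)}"
      "{VB ((i - b') mod n), VB ((i - c') mod n), VB ((i - d') mod n)} =
        {VB ((i - b) mod n), VB ((i - c) mod n), VB ((i - d) mod n)}" for i
      using *[of "\<lambda>x. VC ((i + x) mod n)"] *[of "\<lambda>x. VB ((i - x) mod n)"] by simp_all
    then show ?thesis unfolding WH_def by (simp only:)
  qed
  then show "W.N = N" "W.V = V" "W.aut = aut"
    by (simp_all add: W.V_def V_def W.N_def N_def W.E_def E_def W.aut_def aut_def fun_eq_iff)
qed

theorem transitive_if_conditions:
  assumes wh: "woolly_hat_params n a b c d" and n: "even n"
    and p: "mset [b', c', d'] = mset [b, c, d]" and e: "\<epsilon> \<in> {1, -1}" and q: "coprime q n"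
    and \<alpha>: "\<alpha> = (q * \<epsilon> * a) mod n" and \<beta>: "\<beta> = (q * b') mod n" and \<gamma>: "\<gamma> = (q * c') mod n"
    and \<delta>: "\<delta> = (q * d') mod n"
    and rel: "[\<delta> = 2 * \<alpha> + \<beta>] (mod n)"
    and cases: "(n, \<alpha>, \<beta>, \<gamma>, \<delta>) \<in> {(8, 2, 1, 0, 5), (8, 2, 1, 4, 5)} \<or>
      odd \<alpha> \<and> odd \<beta> \<and> odd \<delta> \<and> even \<gamma> \<and> [2 * \<gamma> = 3 * \<alpha> + 3 * \<beta>] (mod n) \<or>
      (\<exists>m. n = 4 * m \<and> m > 1 \<and> odd m \<and> (\<alpha>, \<beta>, \<gamma>, \<delta>) = (2, m - 2, 0, m + 2))"
  shows "\<exists>f. woolly_hat.aut n a b c d f \<and> f (vA n 0) = vB n 0"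
proof -
  have wh0: "woolly_hat n a b c d" using wh by (rule woolly_hat_of_params)
  note perm = woolly_hat_perm[OF wh0 p]
  have wh1: "woolly_hat n (q * \<epsilon> * a) (q * b') (q * c') (q * d')"
    using perm(1) q e by (rule woolly_hat_scale)
  have par: "n dvd q * \<epsilon> * a - \<alpha>" "n dvd q * b' - \<beta>" "n dvd q * c' - \<gamma>" "n dvd q * d' - \<delta>"
    by (simp_all add: \<alpha> \<beta> \<gamma> \<delta> dvd_minus_mod)
  have wh2: "woolly_hat n \<alpha> \<beta> \<gamma> \<delta>" using wh1 par by (rule woolly_hat_cong)
  interpret W: woolly_hat n \<alpha> \<beta> \<gamma> \<delta> by fact
  have transfer: ?thesis
    if "woolly_hat n a1 b1 c1 d1" "n dvd \<alpha> - a1" "n dvd \<beta> - b1" "n dvd \<gamma> - c1" "n dvd \<delta> - d1"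
      "woolly_hat.aut n a1 b1 c1 d1 f" "f (vA n 0) = vB n i" for a1 b1 c1 d1 f i
  proof -
    have "n dvd a1 - q * \<epsilon> * a" "n dvd b1 - q * b'" "n dvd c1 - q * c'" "n dvd d1 - q * d'"
      using par that(2-5) by algebra+
    from automorphism_transfer[OF perm(1) that(1) q e this that(6,7)]
    show ?thesis using perm(4) by simp
  qed
  from cases consider (8) "(n, \<alpha>, \<beta>, \<gamma>, \<delta>) \<in> {(8, 2, 1, 0, 5), (8, 2, 1, 4, 5)}"
    | (2) "odd \<alpha> \<and> odd \<beta> \<and> odd \<delta> \<and> even \<gamma> \<and> [2 * \<gamma> = 3 * \<alpha> + 3 * \<beta>] (mod n)"
    | (4) "\<exists>m. n = 4 * m \<and> m > 1 \<and> odd m \<and> (\<alpha>, \<beta>, \<gamma>, \<delta>) = (2, m - 2, 0, m + 2)"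
    by (elim disjE)
  then show ?thesis
  proof cases
    case 8
    then have "\<exists>f. W.aut f \<and> f (vA n 0) = vB n 0" by (intro W.aut_mod_four[of 3]) auto
    then show ?thesis using transfer[OF wh2] by auto
  next
    case 2
    \<comment> \<open>With this value, \<open>\<gamma> = 3 * \<mu>\<close> modulo \<open>n\<close>
      is the same congruence as \<open>2 * \<gamma> = 3 * \<alpha> + 3 * \<beta>\<close>. The shape
      required by \<open>aut_parity\<close> holds only modulo \<open>n\<close>, hence the passage to
      congruent parameters.\<close>
    define \<mu> where "\<mu> = \<gamma> - \<alpha> - \<beta>"
    have r: "n dvd \<delta> - (2 * \<alpha> + \<beta>)" "n dvd 2 * \<gamma> - (3 * \<alpha> + 3 * \<beta>)"
      using 2 rel unfolding cong_iff_dvd_diff by blast+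
    have d: "n dvd \<alpha> - \<alpha>" "n dvd \<beta> - (2 * \<mu> - \<alpha>)" "n dvd \<gamma> - 3 * \<mu>" "n dvd \<delta> - (2 * \<mu> + \<alpha>)"
      subgoal by simp
      subgoal by (rule dvd_combine[OF r(2,2), of _ "-1" 0]) (simp add: \<mu>_def)
      subgoal by (rule dvd_combine[OF r(2,2), of _ "-1" 0]) (simp add: \<mu>_def)
      subgoal by (rule dvd_combine[OF r, of _ 1 "-1"]) (simp add: \<mu>_def)
      done
    have wh3: "woolly_hat n \<alpha> (2 * \<mu> - \<alpha>) (3 * \<mu>) (2 * \<mu> + \<alpha>)" using wh2 d by (rule woolly_hat_cong)
    have odd: "odd \<alpha>" "odd \<beta>" "even \<gamma>" using 2 by blast+
    then have "even \<mu>" by (simp add: \<mu>_def)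
    then have "\<exists>f. woolly_hat.aut n \<alpha> (2 * \<mu> - \<alpha>) (3 * \<mu>) (2 * \<mu> + \<alpha>) f \<and> f (vA n 0) = vB n (- \<mu>)"
      using odd by (intro woolly_hat.aut_parity[OF wh3 n]) auto
    then show ?thesis using transfer[OF wh3 d] by blast
  next
    case 4
    then obtain m where "n = 4 * m" "odd m" "\<alpha> = 2" "\<beta> = m - 2" "\<gamma> = 0" "\<delta> = m + 2"
      by (elim exE conjE Pair_inject)
    then have "\<exists>f. W.aut f \<and> f (vA n 0) = vB n 0" by (intro W.aut_mod_four[of m]) auto
    then show ?thesis using transfer[OF wh2] by auto
  qed
qed

section \<open>Automorphisms preserving straight lines\<close>

text \<open>Separates the three orbits of the rotations. The two vertical neighbours of a vertex lie
  in different layers, so the layer of an image tells them apart.\<close>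

fun layer :: "wh_vertex \<Rightarrow> nat" where
  "layer (VA _) = 0" | "layer (VB _) = 1" | "layer (VC _) = 2"

lemma layer [simp]: "layer (vA n i) = 0" "layer (vB n i) = 1" "layer (vC n i) = 2"
  by (simp_all add: v_defs)

lemma int_shift_invariant:
  fixes F :: "int \<Rightarrow> 'a"
  assumes "\<And>i. F (i + x) = F i"
  shows "F (i + x * k) = F i"
proof (induction k rule: int_induct[where k = 0])
  case (step1 k)
  then show ?case using assms[of "i + x * k"] by (simp add: algebra_simps)
next
  case (step2 k)
  then show ?case using assms[of "i + x * (k - 1)"] by (simp add: algebra_simps)
qed simp

context woolly_hat
begin

text \<open>Next and previous vertex on the horizontal and vertical lines, for an orientation of all
  lines that the rotations preserve. On horizontal lines through B- and C-vertices the parameters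
  \<open>b\<close> and \<open>d\<close> alternate; \<open>c\<close> is vertical.\<close>

definition hn :: "wh_vertex \<Rightarrow> wh_vertex" where
  "hn = vmap (\<lambda>i. A (i + a)) (\<lambda>i. C (i + d)) (\<lambda>i. B (i - b))"
definition hp :: "wh_vertex \<Rightarrow> wh_vertex" where
  "hp = vmap (\<lambda>i. A (i - a)) (\<lambda>i. C (i + b)) (\<lambda>i. B (i - d))"
definition vn :: "wh_vertex \<Rightarrow> wh_vertex" where
  "vn = vmap (\<lambda>i. B i) (\<lambda>i. C (i + c)) (\<lambda>i. A i)"
definition vp :: "wh_vertex \<Rightarrow> wh_vertex" where
  "vp = vmap (\<lambda>i. C i) (\<lambda>i. A i) (\<lambda>i. B (i - c))"

lemma hn [simp]: "hn (A i) = A (i + a)" "hn (B i) = C (i + d)" "hn (C i) = B (i - b)"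
  and hp [simp]: "hp (A i) = A (i - a)" "hp (B i) = C (i + b)" "hp (C i) = B (i - d)"
  and vn [simp]: "vn (A i) = B i" "vn (B i) = C (i + c)" "vn (C i) = A i"
  and vp [simp]: "vp (A i) = C i" "vp (B i) = A i" "vp (C i) = B (i - c)"
  by (simp_all add: hn_def hp_def vn_def vp_def vmap_simps v_mod)

lemma step_V [simp]: "v \<in> V \<Longrightarrow> hn v \<in> V" "v \<in> V \<Longrightarrow> hp v \<in> V" "v \<in> V \<Longrightarrow> vn v \<in> V" "v \<in> V \<Longrightarrow> vp v \<in> V"
  "v \<in> V \<Longrightarrow> rot k v \<in> V"
  by (erule V_cases; simp)+

lemma step_inverse [simp]:
  "v \<in> V \<Longrightarrow> hn (hp v) = v" "v \<in> V \<Longrightarrow> hp (hn v) = v" "v \<in> V \<Longrightarrow> vn (vp v) = v" "v \<in> V \<Longrightarrow> vp (vn v) = v"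
  by (erule V_cases; simp)+

lemma rot_step: "v \<in> V \<Longrightarrow> hn (rot k v) = rot k (hn v)" "v \<in> V \<Longrightarrow> vn (rot k v) = rot k (vn v)"
  "v \<in> V \<Longrightarrow> vp (rot k v) = rot k (vp v)"
  by (erule V_cases; simp add: algebra_simps)+

lemma rot_eq_iff: "v \<in> V \<Longrightarrow> rot k v = rot l v \<longleftrightarrow> n dvd k - l"
  by (erule V_cases; simp add: v_eq_iff)

lemma vn_cube: "v \<in> V \<Longrightarrow> vn (vn (vn v)) = rot c v" "v \<in> V \<Longrightarrow> vp (vp (vp v)) = rot (- c) v"
  by (erule V_cases; simp)+

lemma layer_rot [simp]: "v \<in> V \<Longrightarrow> layer (rot k v) = layer v"
  by (erule V_cases; simp)

lemma layer_vn_vp: "v \<in> V \<Longrightarrow> layer (vn v) \<noteq> layer (vp v)"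
  by (erule V_cases; simp)

lemma hn_neq_hp: assumes "v \<in> V" shows "hn v \<noteq> hp v"
proof -
  have db: "\<not> n dvd d - b" using bd by (metis dvd_diff_commute)
  from assms show ?thesis
  proof (cases rule: V_cases)
    case (A i)
    then show ?thesis using a2 by (simp add: v_eq_iff)
  next
    case (B i)
    then show ?thesis using db by (simp add: v_eq_iff)
  next
    case (C i)
    then show ?thesis using db by (simp add: v_eq_iff)
  qed
qed

lemma N_step: "v \<in> V \<Longrightarrow> N v = {hn v, hp v, vn v, vp v}"
  by (erule V_cases; auto simp: N_A N_B N_C)

definition straight :: "(wh_vertex \<Rightarrow> wh_vertex) \<Rightarrow> bool" where
  "straight f \<longleftrightarrow> aut f \<and> (\<forall>v\<in>V. f ` {hn v, hp v} = {hn (f v), hp (f v)} \<and> f ` {vn v, vp v} = {vn (f v), vp (f v)})"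

lemma straight_h: assumes "straight f" "v \<in> V"
  shows "f (hn v) = hn (f v) \<and> f (hp v) = hp (f v) \<or> f (hn v) = hp (f v) \<and> f (hp v) = hn (f v)"
proof -
  have "f ` {hn v, hp v} = {hn (f v), hp (f v)}" using assms by (simp add: straight_def)
  then show ?thesis by (auto simp: doubleton_eq_iff)
qed

lemma straight_v: assumes "straight f" "v \<in> V"
  shows "f (vn v) = vn (f v) \<and> f (vp v) = vp (f v) \<or> f (vn v) = vp (f v) \<and> f (vp v) = vn (f v)"
proof -
  have "f ` {vn v, vp v} = {vn (f v), vp (f v)}" using assms by (simp add: straight_def)
  then show ?thesis by (auto simp: doubleton_eq_iff)
qed

lemma straight_V: "straight f \<Longrightarrow> v \<in> V \<Longrightarrow> f v \<in> V"
  by (simp add: straight_def aut_V)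

lemma straight_inv: assumes "straight f" "aut g" "\<And>v. v \<in> V \<Longrightarrow> g (f v) = v" "\<And>v. v \<in> V \<Longrightarrow> f (g v) = v"
  shows "straight g"
proof -
  have "g ` {hn v, hp v} = {hn (g v), hp (g v)} \<and> g ` {vn v, vp v} = {vn (g v), vp (g v)}" if "v \<in> V" for v
  proof -
    have gv: "g v \<in> V" using aut_V[OF assms(2) that] .
    show ?thesis using straight_h[OF assms(1) gv] straight_v[OF assms(1) gv] assms(3)[of "hn (g v)"]
        assms(3)[of "hp (g v)"] assms(3)[of "vn (g v)"] assms(3)[of "vp (g v)"] assms(4)[OF that] gv
      by auto
  qed
  then show ?thesis using assms(2) by (simp add: straight_def)
qed

text \<open>One of the two horizontal neighbours of \<open>hn v\<close> is \<open>v\<close>, whose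
  image is already known. So \<open>f\<close> continues in the direction of its first step.\<close>

lemma hn_hn_cases:
  assumes "straight f" "v \<in> V"
  shows "f (hn v) = hn (f v) \<Longrightarrow> f (hn (hn v)) = hn (hn (f v))"
    and "f (hn v) = hp (f v) \<Longrightarrow> f (hn (hn v)) = hp (hp (f v))"
proof -
  note fv = straight_V[OF assms]
  from straight_h[OF assms(1), of "hn v"] hn_neq_hp[of "f (hn v)"] assms fv straight_V[OF assms(1), of "hn v"]
  show "f (hn v) = hn (f v) \<Longrightarrow> f (hn (hn v)) = hn (hn (f v))"
    and "f (hn v) = hp (f v) \<Longrightarrow> f (hn (hn v)) = hp (hp (f v))"
    using hn_neq_hp[of "hn (f v)"] hn_neq_hp[of "hp (f v)"] by (auto simp: step_V)
qed

lemma vn_vn_cases: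
  assumes "straight f" "v \<in> V"
  shows "f (vn v) = vn (f v) \<Longrightarrow> f (vn (vn v)) = vn (vn (f v))"
    and "f (vn v) = vp (f v) \<Longrightarrow> f (vn (vn v)) = vp (vp (f v))"
proof -
  note fv = straight_V[OF assms]
  have ne: "vn u \<noteq> vp u" if "u \<in> V" for u using layer_vn_vp[OF that] by auto
  from straight_v[OF assms(1), of "vn v"] assms fv straight_V[OF assms(1), of "vn v"]
  show "f (vn v) = vn (f v) \<Longrightarrow> f (vn (vn v)) = vn (vn (f v))"
    and "f (vn v) = vp (f v) \<Longrightarrow> f (vn (vn v)) = vp (vp (f v))"
    using ne[of "vn (f v)"] ne[of "vp (f v)"] by auto
qed

text \<open>Three vertical steps amount to a rotation by \<open>c\<close>; a reversed vertical
  orientation at \<open>v\<close> therefore reverses this rotation.\<close>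

lemma vn_cube_cases:
  assumes "straight f" "v \<in> V"
  shows "f (vn v) = vn (f v) \<Longrightarrow> f (rot c v) = rot c (f v)"
    and "f (vn v) = vp (f v) \<Longrightarrow> f (rot c v) = rot (- c) (f v)"
proof -
  note fv = straight_V[OF assms]
  note 1 = vn_vn_cases[OF assms]
  have "f (vn (vn (vn v))) = vn (f (vn (vn v)))" if "f (vn (vn v)) = vn (f (vn v))"
    using vn_vn_cases(1)[OF assms(1), of "vn v"] that assms by simp
  moreover have "f (vn (vn (vn v))) = vp (f (vn (vn v)))" if "f (vn (vn v)) = vp (f (vn v))"
    using vn_vn_cases(2)[OF assms(1), of "vn v"] that assms by simp
  ultimately show "f (vn v) = vn (f v) \<Longrightarrow> f (rot c v) = rot c (f v)"
    and "f (vn v) = vp (f v) \<Longrightarrow> f (rot c v) = rot (- c) (f v)"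
    using 1 vn_cube[OF assms(2)] vn_cube[OF fv] by auto
qed

lemma layer_rot_c: assumes "straight f" "v \<in> V" shows "layer (f (rot c v)) = layer (f v)"
  using vn_cube_cases[OF assms] straight_v[OF assms] straight_V[OF assms] by auto

text \<open>Two horizontal steps from \<open>B 0\<close> lead to \<open>B (d - b)\<close>, which the
  inverse \<open>g\<close> maps to \<open>A (2 * a)\<close>. The vertical neighbour
  \<open>C c\<close> of \<open>B 0\<close> has image \<open>B 0\<close> or \<open>C 0\<close>, so
  after the same two steps its image has index \<open>d - b\<close> up to sign. It must also be a
  vertical neighbour of \<open>A (2 * a)\<close>, which fixes the index as
  \<open>2 * a\<close>.\<close>

lemma horizontal_shift:
  assumes f: "straight f" and f0: "f (A 0) = B 0" and fa: "f (A a) = C d"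
  shows "n dvd d - b - 2 * a \<or> n dvd d - b + 2 * a"
proof -
  have autf: "aut f" using f by (simp add: straight_def)
  then obtain g where g: "aut g" "\<And>v. v \<in> V \<Longrightarrow> g (f v) = v" "\<And>v. v \<in> V \<Longrightarrow> f (g v) = v"
    using aut_inv by metis
  have sg: "straight g" using f g by (rule straight_inv)
  have g0: "g (B 0) = A 0" using g(2)[of "A 0"] f0 by simp
  have gd: "g (C d) = A a" using g(2)[of "A a"] fa by simp
  have ge: "g (B (d - b)) = A (2 * a)"
    using hn_hn_cases(1)[OF sg, of "B 0"] g0 gd by simp
  have gv: "g (C c) = B 0 \<or> g (C c) = C 0"
    using straight_v[OF sg, of "B 0"] g0 by auto
  have idx: "d - b + c = c - b + d" by simp
  have gv': "g (C (c - b + d)) = B (2 * a) \<or> g (C (c - b + d)) = C (2 * a)"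
    using straight_v[OF sg, of "B (d - b)"] ge by (auto simp: idx)
  have "g (hn (hn (C c))) = hn (hn (g (C c))) \<or> g (hn (hn (C c))) = hp (hp (g (C c)))"
    using hn_hn_cases[OF sg, of "C c"] straight_h[OF sg, of "C c"] by auto
  moreover have "hn (hn (C c)) = C (c - b + d)" by simp
  moreover have "n dvd d - b - 2 * a" if "n dvd d - b - 2 * a \<or> n dvd 2 * a - (d - b)"
    using that by (metis dvd_diff_commute)
  moreover have "n dvd d - b + 2 * a" if "n dvd b - d - 2 * a \<or> n dvd 2 * a - (b - d)"
    using that by (elim disjE; algebra)
  ultimately show ?thesis
    using gv gv' by (elim disjE; simp add: v_eq_iff)
qed

end

text \<open>The normalised situation: \<open>fa\<close> fixes the horizontal orientation at
  \<open>A 0\<close> and \<open>db\<close> settles the sign left open by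
  \<open>horizontal_shift\<close>. Exchanging \<open>b\<close> with \<open>d\<close> and composing
  \<open>f\<close> with the reflection reduce everything to it.\<close>

locale straight_map = woolly_hat +
  fixes f
  assumes f: "straight f" and f0: "f (A 0) = B 0" and fa: "f (A a) = C d" and db: "n dvd d - b - 2 * a"
begin

lemma hn_hn_hp_hp:
  assumes "v \<in> V"
  shows "hn (hn v) = rot (2 * a) v \<and> hp (hp v) = rot (- 2 * a) v"
  using assms
proof (cases rule: V_cases)
  case (B i)
  have "n dvd i + d - b - (i + 2 * a)" "n dvd i + b - d - (i + - 2 * a)" using db by algebra+
  then show ?thesis by (simp add: B v_eq_iff)
next
  case (C i)
  have "n dvd i - b + d - (i + 2 * a)" "n dvd i - d + b - (i + - 2 * a)" using db by algebra+
  then show ?thesis by (simp add: C v_eq_iff)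
qed (simp add: v_eq_iff)

lemmas hn_hn = conjunct1[OF hn_hn_hp_hp] and hp_hp = conjunct2[OF hn_hn_hp_hp]

lemma layer_rot_2a: assumes "v \<in> V" shows "layer (f (rot (2 * a) v)) = layer (f v)"
  using hn_hn_cases[OF f assms] straight_h[OF f assms] straight_V[OF f assms] assms
  by (auto simp: hn_hn hp_hp)

lemma layer_invariant:
  "layer (f (A (i + 2 * a * j + c * k))) = layer (f (A i))"
  "layer (f (C (i + 2 * a * j + c * k))) = layer (f (C i))"
proof -
  have "layer (f (A (i + 2 * a))) = layer (f (A i))" "layer (f (C (i + 2 * a))) = layer (f (C i))"
    "layer (f (A (i + c))) = layer (f (A i))" "layer (f (C (i + c))) = layer (f (C i))" for i
    using layer_rot_2a[of "A i"] layer_rot_2a[of "C i"] layer_rot_c[OF f, of "A i"] layer_rot_c[OF f, of "C i"]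
    by simp_all
  then show "layer (f (A (i + 2 * a * j + c * k))) = layer (f (A i))"
    "layer (f (C (i + 2 * a * j + c * k))) = layer (f (C i))"
    using int_shift_invariant[of "\<lambda>i. layer (f (A i))"] int_shift_invariant[of "\<lambda>i. layer (f (C i))"] by simp_all
qed

text \<open>The layer of \<open>f (A i)\<close> depends only on the coset of \<open>i\<close> modulo
  the subgroup generated by \<open>2 * a\<close> and \<open>c\<close>, but it differs at 0 and
  \<open>a\<close>. All later information on powers of two comes from here.\<close>

lemma a_not_generated: "\<not> n dvd a - (2 * a * j + c * k)"
proof
  assume "n dvd a - (2 * a * j + c * k)"
  then have "A a = A (0 + 2 * a * j + c * k)" by (simp add: v_eq_iff)
  then have "layer (f (A a)) = layer (f (A 0))" using layer_invariant(1) by metis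
  then show False using f0 fa by simp
qed

text \<open>The error caused by reversing a horizontal step. It vanishes unless
  \<open>4 * a = 0\<close>; in that case horizontal lines are 4-cycles, on which a step forwards and
  a step backwards differ by \<open>2 * a\<close>.\<close>

definition slack :: "int \<Rightarrow> bool" where
  "slack x \<longleftrightarrow> (\<exists>k. x = 2 * a * k \<and> (k = 0 \<or> n dvd 4 * a))"

lemma slack_add: "slack x \<Longrightarrow> slack y \<Longrightarrow> slack (x + y)"
  and slack_minus: "slack x \<Longrightarrow> slack (- x)"
  and slack_0: "slack 0"
proof -
  show "slack (- x)" if x: "slack x"
  proof -
    obtain k where "x = 2 * a * k" "k = 0 \<or> n dvd 4 * a" using x unfolding slack_def by blast
    then show ?thesis unfolding slack_def by (intro exI[of _ "- k"]) auto
  qed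
  show "slack (x + y)" if x: "slack x" and y: "slack y"
  proof -
    obtain k l where "x = 2 * a * k" "k = 0 \<or> n dvd 4 * a" "y = 2 * a * l" "l = 0 \<or> n dvd 4 * a"
      using x y unfolding slack_def by blast
    then show ?thesis unfolding slack_def by (intro exI[of _ "k + l"]) (auto simp: algebra_simps)
  qed
qed (auto simp: slack_def)

text \<open>The second alternative keeps the case \<open>4 * a = 0\<close> in the same argument:
  there a reversal changes the image only by a slack.\<close>

definition good :: "wh_vertex \<Rightarrow> bool" where
  "good v \<longleftrightarrow> v \<in> V \<and> (f (hn v) = hn (f v) \<or> n dvd 4 * a)"

lemma rot_0 [simp]: "v \<in> V \<Longrightarrow> rot 0 v = v"
  by (erule V_cases; simp)

lemma fV [simp]: "v \<in> V \<Longrightarrow> f v \<in> V"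
  using f by (rule straight_V)

lemma good_step: assumes "good v" obtains x where "slack x" "f (hn v) = rot x (hn (f v))"
proof (cases "f (hn v) = hn (f v)")
  case True
  then show ?thesis using that[of 0] assms slack_0 by (simp add: good_def)
next
  case False
  then have v: "v \<in> V" "n dvd 4 * a" using assms by (auto simp: good_def)
  have "f (hn v) = hp (f v)" using False straight_h[OF f v(1)] by blast
  also have "\<dots> = hp (hp (hn (f v)))" using v by simp
  also have "\<dots> = rot (- 2 * a) (hn (f v))" using v by (subst hp_hp) simp_all
  finally have "f (hn v) = rot (- 2 * a) (hn (f v))" .
  moreover have "slack (- 2 * a)" unfolding slack_def using v(2) by (intro exI[of _ "-1"]) simp
  ultimately show ?thesis using that by blast
qed

lemma good_hn: "good v \<Longrightarrow> good (hn v)"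
  using hn_hn_cases(1)[OF f] by (auto simp: good_def)

text \<open>If the horizontal orientations at \<open>v\<close> and \<open>w\<close> were treated
  differently, two horizontal steps would rotate \<open>f v\<close> by \<open>2 * a\<close> and
  \<open>f w\<close> by \<open>- 2 * a\<close>, while the images stay vertically adjacent. The layer
  identifies the vertical neighbour, so both rotations agree on \<open>f w\<close> and
  \<open>4 * a = 0\<close>.\<close>

lemma good_vertical: assumes "good v" "w \<in> {vn v, vp v}" shows "good w"
proof (cases "n dvd 4 * a")
  case True
  then show ?thesis using assms by (auto simp: good_def)
next
  case False
  then have v: "v \<in> V" "f (hn v) = hn (f v)" using assms(1) by (auto simp: good_def)
  then have w: "w \<in> V" using assms(2) by auto
  show ?thesis
  proof (rule ccontr)
    assume "\<not> good w"
    then have "f (hn w) = hp (f w)" using straight_h[OF f w] w by (auto simp: good_def)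
    then have "f (rot (2 * a) w) = rot (- 2 * a) (f w)"
      using hn_hn_cases(2)[OF f w] w by (simp add: hn_hn hp_hp)
    moreover have "f (rot (2 * a) v) = rot (2 * a) (f v)"
      using hn_hn_cases(1)[OF f v(1)] v by (simp add: hn_hn)
    then have "f (rot (2 * a) w) \<in> {rot (2 * a) (vn (f v)), rot (2 * a) (vp (f v))}"
      using assms(2) v straight_v[OF f, of "rot (2 * a) v"]
      by (auto simp: rot_step)
    moreover have "f w \<in> {vn (f v), vp (f v)}"
      using assms(2) straight_v[OF f v(1)] by auto
    ultimately have "rot (- 2 * a) (f w) = rot (2 * a) (f w)"
      using layer_vn_vp[of "f v"] v by (metis insertE empty_iff layer_rot fV step_V(3,4))
    then have "n dvd - 2 * a - 2 * a" using w by (simp add: rot_eq_iff)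
    then show False using False by simp
  qed
qed

lemma good_A0: "good (A 0)"
  using f0 fa by (simp add: good_def)

lemma good_vertices: "good (B 0)" "good (C 0)" "good (A a)" "good (B a)" "good (C a)" "good (C d)" "good (A d)"
  "good (B (- b))" "good (A (- b))" "good (A c)"
proof -
  show 0: "good (B 0)" "good (C 0)" using good_vertical[OF good_A0] by auto
  show a: "good (A a)" using good_hn[OF good_A0] by simp
  show "good (B a)" "good (C a)" using good_vertical[OF a] by auto
  show d: "good (C d)" using good_hn[OF 0(1)] by simp
  show "good (A d)" using good_vertical[OF d] by auto
  show b: "good (B (- b))" using good_hn[OF 0(2)] by simp
  show "good (A (- b))" using good_vertical[OF b] by auto
  have "good (C c)" using good_vertical[OF 0(1)] by auto
  then show "good (A c)" using good_vertical[of "C c"] by auto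
qed

text \<open>The relation of family (2), up to the ambiguity of horizontal orientation.\<close>

definition regular :: bool where
  "regular \<longleftrightarrow> (\<exists>x. slack x \<and> n dvd 2 * c - 3 * a - 3 * b + x)"

lemma vertical_0: "f (B 0) = C c \<and> f (C 0) = A 0 \<or> f (B 0) = A 0 \<and> f (C 0) = C c"
  using straight_v[OF f, of "A 0"] f0 by auto

lemma vertical_a: "f (B a) = A d \<and> f (C a) = B (d - c) \<or> f (B a) = B (d - c) \<and> f (C a) = A d"
  using straight_v[OF f, of "A a"] fa by auto

text \<open>The vertex \<open>A (d + a)\<close> is reached from \<open>A 0\<close> through
  \<open>B 0\<close>, \<open>C d\<close>, \<open>A d\<close> and through \<open>A a\<close>,
  \<open>B a\<close>, \<open>C (d + a)\<close>. The two computations of its image force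
  \<open>regular\<close> if the vertical orientations at \<open>A 0\<close> and \<open>A a\<close>
  are both kept or both reversed. So exactly one is reversed, and then the indices yield the second
  claim.\<close>

lemma exceptional:
  assumes irr: "\<not> regular"
  shows "f (B 0) = C c \<and> f (B a) = B (d - c) \<or> f (B 0) = A 0 \<and> f (B a) = A d" (is ?one)
    and "\<exists>x. slack x \<and> n dvd 4 * c - 4 * a - 4 * b + x" (is ?two)
proof -
  obtain x1 where x1: "slack x1" "f (C d) = rot x1 (hn (f (B 0)))"
    using good_step[OF good_vertices(1)] by auto
  obtain x2 where x2: "slack x2" "f (A (d + a)) = rot x2 (hn (f (A d)))"
    using good_step[OF good_vertices(7)] by auto
  obtain x3 where x3: "slack x3" "f (C (d + a)) = rot x3 (hn (f (B a)))"
    using good_step[OF good_vertices(4)] by (auto simp: add_ac)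
  have v1: "f (A d) \<in> {vn (f (C d)), vp (f (C d))}"
    using straight_v[OF f, of "C d"] by auto
  have v2: "f (A (d + a)) \<in> {vn (f (C (d + a))), vp (f (C (d + a)))}"
    using straight_v[OF f, of "C (d + a)"] by auto
  have irr': "\<not> n dvd 2 * c - 3 * a - 3 * b + (x + y - z)" if "slack x" "slack y" "slack z" for x y z
    using irr slack_add[OF slack_add[OF that(1,2)] slack_minus[OF that(3)]] unfolding regular_def by auto
  have exc: ?two if "n dvd 4 * c - 4 * a - 4 * b + (x + y - z)" "slack x" "slack y" "slack z" for x y z
    using that(1) slack_add[OF slack_add[OF that(2,3)] slack_minus[OF that(4)]] by auto
  have ca: "f (A (d + a)) \<in> {B (2 * c - 2 * b + x1 + x2), A (c - b + a + x1 + x2)}" if "f (B 0) = C c"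
    using v1 x1(2) x2(2) that by (auto simp: algebra_simps)
  have cb: "f (A (d + a)) \<in> {C (d + a + x1 + x2), B (a - b + x1 + x2)}" if "f (B 0) = A 0"
    using v1 x1(2) x2(2) that by (auto simp: algebra_simps)
  have cc: "f (A (d + a)) \<in> {B (d + a + x3), C (d + a + x3)}" if "f (B a) = A d"
    using v2 x3(2) that by (auto simp: algebra_simps)
  have cd: "f (A (d + a)) \<in> {A (2 * d - c + x3), B (2 * d - 2 * c + x3)}" if "f (B a) = B (d - c)"
    using v2 x3(2) that by (auto simp: algebra_simps)
  have r1: False if "B (2 * c - 2 * b + x1 + x2) = B (d + a + x3)"
  proof -
    have "n dvd 2 * c - 2 * b + x1 + x2 - (d + a + x3)" using that by (simp only: v_eq_iff)
    then have "n dvd 2 * c - 3 * a - 3 * b + (x1 + x2 - x3)" using db by algebra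
    then show False using irr' x1 x2 x3 by blast
  qed
  have r2: False if "A (c - b + a + x1 + x2) = A (2 * d - c + x3)"
  proof -
    have "n dvd c - b + a + x1 + x2 - (2 * d - c + x3)" using that by (simp only: v_eq_iff)
    then have "n dvd 2 * c - 3 * a - 3 * b + (x1 + x2 - x3)" using db by algebra
    then show False using irr' x1 x2 x3 by blast
  qed
  have r3: False if "B (a - b + x1 + x2) = B (2 * d - 2 * c + x3)"
  proof -
    have "n dvd a - b + x1 + x2 - (2 * d - 2 * c + x3)" using that by (simp only: v_eq_iff)
    then have "n dvd 2 * c - 3 * a - 3 * b + (x1 + x2 - x3)" using db by algebra
    then show False using irr' x1 x2 x3 by blast
  qed
  show exceptions: ?one
    using vertical_0 vertical_a
  proof (elim disjE conjE)
    assume *: "f (B 0) = C c" "f (B a) = A d"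
    have "B (2 * c - 2 * b + x1 + x2) = B (d + a + x3)"
      using ca[OF *(1)] cc[OF *(2)] by (elim insertE emptyE; simp only: v_distinct)
    then show ?thesis using r1 by blast
  next
    assume *: "f (B 0) = A 0" "f (B a) = B (d - c)"
    have "B (a - b + x1 + x2) = B (2 * d - 2 * c + x3)"
      using cb[OF *(1)] cd[OF *(2)] by (elim insertE emptyE; simp only: v_distinct)
    then show ?thesis using r3 by blast
  qed simp_all
  from exceptions show ?two
  proof (elim disjE conjE)
    assume *: "f (B 0) = C c" "f (B a) = B (d - c)"
    have "B (2 * c - 2 * b + x1 + x2) = B (2 * d - 2 * c + x3) \<or> A (c - b + a + x1 + x2) = A (2 * d - c + x3)"
      using ca[OF *(1)] cd[OF *(2)] by (elim insertE emptyE; simp only: v_distinct simp_thms)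
    then have "n dvd 2 * c - 2 * b + x1 + x2 - (2 * d - 2 * c + x3)"
      using r2 by (auto simp only: v_eq_iff)
    then have "n dvd 4 * c - 4 * a - 4 * b + (x1 + x2 - x3)" using db by algebra
    then show ?two using exc x1 x2 x3 by blast
  next
    \<comment> \<open>The comparison at \<open>A (d + a)\<close> is inconclusive here, since both
      routes allow the image \<open>C (d + a)\<close> up to slack. The routes to
      \<open>A (a - b)\<close> through \<open>C 0\<close> and \<open>C a\<close> take its
      place.\<close>
    assume *: "f (B 0) = A 0" "f (B a) = A d"
    then have c0: "f (C 0) = C c" and ca: "f (C a) = B (d - c)"
      using vertical_0 vertical_a by auto
    obtain y1 where y1: "slack y1" "f (B (- b)) = rot y1 (hn (f (C 0)))"
      using good_step[OF good_vertices(2)] by auto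
    obtain y2 where y2: "slack y2" "f (A (a - b)) = rot y2 (hn (f (A (- b))))"
      using good_step[OF good_vertices(9)] by auto
    obtain y3 where y3: "slack y3" "f (B (a - b)) = rot y3 (hn (f (C a)))"
      using good_step[OF good_vertices(5)] by auto
    have w1: "f (A (- b)) \<in> {vn (f (B (- b))), vp (f (B (- b)))}"
      using straight_v[OF f, of "B (- b)"] by auto
    have w2: "f (A (a - b)) \<in> {vn (f (B (a - b))), vp (f (B (a - b)))}"
      using straight_v[OF f, of "B (a - b)"] by auto
    have "f (A (a - b)) \<in> {B (2 * c - 2 * b + y1 + y2), A (c - b + a + y1 + y2)}"
      using w1 y1(2) y2(2) c0 by (auto simp: algebra_simps)
    moreover have "f (A (a - b)) \<in> {A (2 * d - c + y3), B (2 * d - 2 * c + y3)}"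
      using w2 y3(2) ca by (auto simp: algebra_simps)
    ultimately have "B (2 * c - 2 * b + y1 + y2) = B (2 * d - 2 * c + y3) \<or>
        A (c - b + a + y1 + y2) = A (2 * d - c + y3)"
      by (elim insertE emptyE; simp only: v_distinct simp_thms)
    moreover have False if "A (c - b + a + y1 + y2) = A (2 * d - c + y3)"
    proof -
      have "n dvd c - b + a + y1 + y2 - (2 * d - c + y3)" using that by (simp only: v_eq_iff)
      then have "n dvd 2 * c - 3 * a - 3 * b + (y1 + y2 - y3)" using db by algebra
      then show False using irr' y1 y2 y3 by blast
    qed
    ultimately have "n dvd 2 * c - 2 * b + y1 + y2 - (2 * d - 2 * c + y3)"
      by (auto simp only: v_eq_iff)
    then have "n dvd 4 * c - 4 * a - 4 * b + (y1 + y2 - y3)" using db by algebra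
    then show ?two using exc y1 y2 y3 by blast
  qed
qed

text \<open>With opposite vertical orientations, \<open>f\<close> turns the rotation by
  \<open>c\<close> into opposite rotations at \<open>A 0\<close> and at \<open>A a\<close>. As
  \<open>A c\<close> and \<open>A (c + a)\<close> are still horizontally adjacent, \<open>c\<close>
  and \<open>- c\<close> agree up to slack.\<close>

lemma exceptional_c: assumes "\<not> regular" shows "\<exists>x. slack x \<and> n dvd 2 * c + x"
proof -
  obtain x where x: "slack x" "f (A (c + a)) = rot x (hn (f (A c)))"
    using good_step[OF good_vertices(10)] by auto
  from exceptional(1)[OF assms] show ?thesis
  proof (elim disjE conjE)
    assume *: "f (B 0) = C c" "f (B a) = B (d - c)"
    have "f (A c) = B c" using vn_cube_cases(1)[OF f, of "A 0"] *(1) f0 by simp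
    moreover have "f (A (c + a)) = C (d - c)" using vn_cube_cases(2)[OF f, of "A a"] *(2) fa
      by (simp add: add.commute)
    ultimately have "C (d - c) = C (c + d + x)" using x(2) by simp
    then have "n dvd d - c - (c + d + x)" by (simp only: v_eq_iff)
    then have "n dvd 2 * c + x" by algebra
    then show ?thesis using x by blast
  next
    assume *: "f (B 0) = A 0" "f (B a) = A d"
    have "f (A c) = B (- c)" using vn_cube_cases(2)[OF f, of "A 0"] *(1) f0 by simp
    moreover have "f (A (c + a)) = C (d + c)" using vn_cube_cases(1)[OF f, of "A a"] *(2) fa
      by (simp add: add.commute)
    ultimately have "C (d + c) = C (- c + d + x)" using x(2) by simp
    then have "n dvd d + c - (- c + d + x)" by (simp only: v_eq_iff)
    then have "n dvd 2 * c + (- x)" by algebra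
    then show ?thesis using x slack_minus by blast
  qed
qed

text \<open>Otherwise layer invariance would put the image of \<open>C d\<close> into the same layer
  as that of \<open>C 0\<close> or \<open>C a\<close>. The horizontal step from \<open>B 0\<close>
  to \<open>C d\<close> determines this layer, and it is a different one for both possible
  orientations.\<close>

lemma exceptional_d: assumes "\<not> regular" shows "\<not> n dvd d - (a * j + c * k)"
proof
  assume d: "n dvd d - (a * j + c * k)"
  obtain l where "j = 2 * l \<or> j = 2 * l + 1" by (metis evenE oddE)
  then have "C d = C (0 + 2 * a * l + c * k) \<or> C d = C (a + 2 * a * l + c * k)"
    using d by (auto simp: v_eq_iff algebra_simps)
  then have l: "layer (f (C d)) = layer (f (C 0)) \<or> layer (f (C d)) = layer (f (C a))"
    using layer_invariant(2) by metis
  obtain x where x: "f (C d) = rot x (hn (f (B 0)))"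
    using good_step[OF good_vertices(1)] by auto
  from exceptional(1)[OF assms] show False
  proof (elim disjE conjE)
    assume *: "f (B 0) = C c" "f (B a) = B (d - c)"
    then have "f (C 0) = A 0" "f (C a) = A d" using vertical_0 vertical_a by auto
    then show False using l x * by auto
  next
    assume *: "f (B 0) = A 0" "f (B a) = A d"
    then have "f (C 0) = C c" "f (C a) = B (d - c)" using vertical_0 vertical_a by auto
    then show False using l x * by auto
  qed
qed

end

section \<open>Normalising the parameters by units\<close>

definition transitive_params :: "int \<Rightarrow> int \<Rightarrow> int \<Rightarrow> int \<Rightarrow> int \<Rightarrow> bool" where
  "transitive_params n \<alpha> \<beta> \<gamma> \<delta> \<longleftrightarrow> [\<delta> = 2 * \<alpha> + \<beta>] (mod n) \<and>
    ((n, \<alpha>, \<beta>, \<gamma>, \<delta>) \<in> {(8, 2, 1, 0, 5), (8, 2, 1, 4, 5)} \<or>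
     (odd \<alpha> \<and> odd \<beta> \<and> odd \<delta> \<and> even \<gamma> \<and> [2 * \<gamma> = 3 * \<alpha> + 3 * \<beta>] (mod n)) \<or>
     (\<exists>m. n = 4 * m \<and> m > 1 \<and> odd m \<and> (\<alpha>, \<beta>, \<gamma>, \<delta>) = (2, m - 2, 0, m + 2)))"

lemma two_prime: "prime (2 :: int)"
  by simp

text \<open>By Bezout, the multiples of the gcd are exactly the integers generated by
  \<open>x\<close>, \<open>c\<close> and \<open>n\<close>.\<close>

lemma gcd_not_dvd:
  fixes a x c n :: int
  assumes "\<And>j k. \<not> n dvd a - (x * j + c * k)"
  shows "\<not> gcd x (gcd c n) dvd a"
proof
  assume "gcd x (gcd c n) dvd a"
  then obtain t where t: "a = gcd x (gcd c n) * t" by blast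
  obtain u v where uv: "u * x + v * gcd c n = gcd x (gcd c n)" using bezout_int by blast
  obtain w z where wz: "w * c + z * n = gcd c n" using bezout_int by blast
  have "a = (u * x + v * (w * c + z * n)) * t" using t uv wz by simp
  then have "a - (x * (u * t) + c * (v * w * t)) = n * (v * z * t)" by (simp add: algebra_simps)
  then show False using assms[of "u * t" "v * w * t"] by (metis dvd_triv_left)
qed

text \<open>The gcd \<open>g\<close> of \<open>2 * a\<close>, \<open>c\<close> and \<open>n\<close>
  divides \<open>2 * a\<close> but not \<open>a\<close>. So the cofactor \<open>t\<close> is odd,
  and \<open>g\<close> contains the full power of two of \<open>2 * a\<close>, which passes on to
  \<open>c\<close> and \<open>n\<close>.\<close>

lemma not_generated_parity:
  fixes n a c :: int
  assumes "\<And>j k. \<not> n dvd a - (2 * a * j + c * k)"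
  shows "even n" "even c" "2 ^ e dvd a \<Longrightarrow> 2 ^ Suc e dvd n" "2 ^ e dvd a \<Longrightarrow> 2 ^ Suc e dvd c"
proof -
  define g where "g = gcd (2 * a) (gcd c n)"
  have ga: "\<not> g dvd a" unfolding g_def using assms by (rule gcd_not_dvd)
  have g: "g dvd 2 * a" "g dvd c" "g dvd n" by (auto simp: g_def intro: dvd_trans[OF gcd_dvd2])
  obtain t where t: "2 * a = g * t" using g(1) by blast
  have "odd t"
  proof
    assume "even t"
    then obtain s where "t = 2 * s" by blast
    then have "a = g * s" using t by simp
    then show False using ga by simp
  qed
  then have "2 ^ e dvd g" if "2 ^ e dvd 2 * a" for e :: nat
    using that unfolding t by (simp add: coprime_dvd_mult_left_iff)
  note pow = this
  show "even n" "even c" using pow[of 1] g by (auto intro: dvd_trans)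
  show "2 ^ Suc e dvd n" "2 ^ Suc e dvd c" if "2 ^ e dvd a"
    using pow[of "Suc e"] that g by (auto intro: dvd_trans)
qed

text \<open>An even \<open>a\<close> would make \<open>n\<close> and \<open>c\<close> multiples of
  4, and the relation read modulo 4 would then make \<open>b\<close> even too, against
  \<open>gcd\<close>.\<close>

lemma parity_of_regular:
  fixes n a b c k :: int
  assumes R: "\<And>j k. \<not> n dvd a - (2 * a * j + c * k)"
    and rel: "n dvd 2 * c - 3 * a - 3 * b + 2 * a * k"
    and gcd: "\<not> (even n \<and> even a \<and> even b \<and> even c)"
  shows "even n \<and> odd a \<and> odd b \<and> even c"
proof -
  note par = not_generated_parity[OF R]
  have rel2: "even (2 * c - 3 * a - 3 * b + 2 * a * k)" using par(1) rel by (rule dvd_trans)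
  have a: "odd a"
  proof
    assume a: "even a"
    then have "4 dvd n" "4 dvd c" using par(3)[of 1] par(4)[of 1] by simp_all
    then have 4: "4 dvd 2 * c - 3 * a - 3 * b + 2 * a * k" using rel by (auto intro: dvd_trans)
    have "4 dvd 2 * a" using a by presburger
    then have "4 dvd 2 * a * k" by simp
    with 4 have "4 dvd 2 * c - 3 * a - 3 * b" by (simp add: dvd_add_left_iff)
    then have "even b" using a \<open>4 dvd c\<close> by presburger
    then show False using gcd par(1,2) a by blast
  qed
  have "odd b" using rel2 a by simp
  then show ?thesis using par(1,2) a by blast
qed

lemma transitive_params_regular:
  fixes n a b c d k :: int
  assumes n: "3 \<le> n" and R: "\<And>j k. \<not> n dvd a - (2 * a * j + c * k)"
    and db: "n dvd d - b - 2 * a"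
    and rel: "n dvd 2 * c - 3 * a - 3 * b + 2 * a * k" and k: "k = 0 \<or> n dvd 4 * a"
    and gcd: "\<not> (even n \<and> even a \<and> even b \<and> even c)"
  shows "even n \<and> (\<exists>\<epsilon> q. \<epsilon> \<in> {1, -1} \<and> q \<in> {0..<n} \<and> coprime q n \<and>
    transitive_params n ((q * \<epsilon> * a) mod n) ((q * b) mod n) ((q * c) mod n) ((q * d) mod n))"
proof -
  have par: "even n" "odd a" "odd b" "even c" using parity_of_regular[OF R rel gcd] by auto
  have "even (d - b - 2 * a)" using par(1) db by (rule dvd_trans)
  then have d: "odd d" using par by simp
  have "\<exists>\<epsilon>\<in>{1, -1}. n dvd 2 * c - 3 * (\<epsilon> * a) - 3 * b \<and> n dvd d - b - 2 * (\<epsilon> * a)"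
  proof (cases "even k")
    case True
    then obtain l where "k = 2 * l" by blast
    then have "n dvd 2 * a * k" using k by (auto simp: mult.assoc intro: dvd_trans[of n "4 * a"])
    then have "n dvd 2 * c - 3 * a - 3 * b" using rel by (simp add: dvd_add_left_iff)
    then show ?thesis using db by auto
  next
    case False
    \<comment> \<open>An odd multiple of the slack is absorbed by the sign: \<open>2 * a\<close> and
      \<open>6 * a\<close> agree when \<open>4 * a = 0\<close>, so \<open>- a\<close> satisfies both
      relations exactly.\<close>
    then obtain l where l: "k = 2 * l + 1" by (blast elim: oddE)
    then have "k \<noteq> 0" by presburger
    then have 4: "n dvd 4 * a" using k by blast
    have "n dvd 2 * c - 3 * (- a) - 3 * b" using rel 4 unfolding l by algebra
    moreover have "n dvd d - b - 2 * (- a)" using db 4 by algebra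
    ultimately show ?thesis by auto
  qed
  then obtain \<epsilon> where e: "\<epsilon> \<in> {1, -1}" "n dvd 2 * c - 3 * (\<epsilon> * a) - 3 * b" "n dvd d - b - 2 * (\<epsilon> * a)"
    by blast
  have oe: "odd (\<epsilon> * a)" using e par by auto
  have ev: "even (x mod n) \<longleftrightarrow> even x" for x using par(1) by (simp add: dvd_mod_iff)
  have cong: "[x mod n = x] (mod n)" for x by simp
  have 1: "[d mod n = 2 * ((\<epsilon> * a) mod n) + b mod n] (mod n)"
  proof -
    have "[2 * ((\<epsilon> * a) mod n) + b mod n = 2 * (\<epsilon> * a) + b] (mod n)"
      by (intro cong_add cong_mult cong cong_refl)
    moreover have "[d = 2 * (\<epsilon> * a) + b] (mod n)" using e(3) unfolding cong_iff_dvd_diff by algebra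
    ultimately show ?thesis using cong cong_sym cong_trans by meson
  qed
  have 2: "[2 * (c mod n) = 3 * ((\<epsilon> * a) mod n) + 3 * (b mod n)] (mod n)"
  proof -
    have "[3 * ((\<epsilon> * a) mod n) + 3 * (b mod n) = 3 * (\<epsilon> * a) + 3 * b] (mod n)"
      by (intro cong_add cong_mult cong cong_refl)
    moreover have "[2 * (c mod n) = 2 * c] (mod n)" by (intro cong_mult cong cong_refl)
    moreover have "[2 * c = 3 * (\<epsilon> * a) + 3 * b] (mod n)" using e(2) unfolding cong_iff_dvd_diff by algebra
    ultimately show ?thesis using cong_sym cong_trans by meson
  qed
  have "odd ((\<epsilon> * a) mod n)" "odd (b mod n)" "odd (d mod n)" "even (c mod n)" using ev oe par d by simp_all
  then have "transitive_params n ((1 * \<epsilon> * a) mod n) ((1 * b) mod n) ((1 * c) mod n) ((1 * d) mod n)"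
    unfolding transitive_params_def mult_1 using 1 2 by blast
  then show ?thesis using e(1) par(1) n by (intro conjI exI[of _ \<epsilon>] exI[of _ 1]) auto
qed

text \<open>The Bezout form of coprimality turns annihilation of each of \<open>a\<close>,
  \<open>b\<close>, \<open>c\<close> by 8 or by 12 into \<open>n dvd 8\<close> or
  \<open>n dvd 12\<close>.\<close>

lemma common_prime:
  fixes n a b c :: int
  assumes gcd: "\<nexists>p. prime p \<and> p dvd n \<and> p dvd a \<and> p dvd b \<and> p dvd c"
  obtains u v w z where "u * a + v * b + w * c + z * n = 1"
proof -
  let ?g = "gcd a (gcd b (gcd c n))"
  have "?g dvd a" "?g dvd b" "?g dvd c" "?g dvd n" by (auto intro: dvd_trans[OF gcd_dvd2])
  have "\<bar>?g\<bar> = 1"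
  proof (rule ccontr)
    assume "\<bar>?g\<bar> \<noteq> 1"
    then obtain p where "prime p" "p dvd ?g" using prime_factor_int by blast
    then show False using gcd by auto
  qed
  then have "?g = 1" by simp
  moreover obtain u v where "u * a + v * gcd b (gcd c n) = ?g" using bezout_int by blast
  moreover obtain v' w where "v' * b + w * gcd c n = gcd b (gcd c n)" using bezout_int by blast
  moreover obtain w' z where "w' * c + z * n = gcd c n" using bezout_int by blast
  ultimately have *: "u * a + v * (v' * b + w * (w' * c + z * n)) = 1" by metis
  show ?thesis by (rule that[of u "v * v'" "v * w * w'" "v * w * z"]) (use * in \<open>simp add: algebra_simps\<close>)
qed

text \<open>From \<open>4 * a = 0\<close> the relations give that 8 annihilates all parameters, so
  \<open>n\<close> is 4 or 8. For \<open>n = 4\<close> the odd \<open>a\<close> is a unit and would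
  generate \<open>d\<close>, against \<open>D\<close>; for \<open>n = 8\<close> family (1)
  results.\<close>

lemma transitive_params_eight:
  fixes n a b c d :: int
  assumes n: "3 \<le> n" and a2: "\<not> n dvd 2 * a" and a4: "n dvd 4 * a"
    and db: "n dvd d - b - 2 * a"
    and R: "\<And>j k. \<not> n dvd a - (2 * a * j + c * k)" and D: "\<And>j k. \<not> n dvd d - (a * j + c * k)"
    and r1: "n dvd 4 * c - 4 * a - 4 * b + 2 * a * k" and r2: "n dvd 2 * c + 2 * a * l"
    and gcd: "\<nexists>p. prime p \<and> p dvd n \<and> p dvd a \<and> p dvd b \<and> p dvd c"
  shows "even n \<and> (\<exists>\<epsilon> q. \<epsilon> \<in> {1, -1} \<and> q \<in> {0..<n} \<and> coprime q n \<and>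
    transitive_params n ((q * \<epsilon> * a) mod n) ((q * b) mod n) ((q * c) mod n) ((q * d) mod n))"
proof -
  obtain u v w z where 1: "u * a + v * b + w * c + z * n = 1" using gcd by (rule common_prime)
  have c4: "n dvd 4 * c" by (rule dvd_combine[OF r2 a4, of _ 2 "- l"]) (simp add: algebra_simps)
  have "n dvd 8 * a + 8 * b - 4 * a * k"
    by (rule dvd_combine[OF r1 c4, of _ "- 2" 2]) (simp add: algebra_simps)
  then have b8: "n dvd 8 * b"
    by (rule dvd_combine[OF _ a4, of _ _ 1 "k - 2"]) (simp add: algebra_simps)
  have "8 = 8 * (u * a + v * b + w * c + z * n)" using 1 by simp
  also have "\<dots> = u * (8 * a) + v * (8 * b) + w * (8 * c) + z * (8 * n)" by (simp add: algebra_simps)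
  finally have "8 = u * (8 * a) + v * (8 * b) + w * (8 * c) + z * (8 * n)" .
  moreover have "n dvd 8 * a" by (rule dvd_combine[OF a4 a4, of _ 1 1]) simp
  moreover have "n dvd 8 * c" by (rule dvd_combine[OF c4 c4, of _ 1 1]) simp
  ultimately have "n dvd 8" using b8 by (metis dvd_add dvd_mult dvd_triv_right)
  then have "n \<le> 8" by (rule zdvd_imp_le) simp
  then have "n \<in> {3, 4, 5, 6, 7, 8}" using n by auto
  then have n48: "n = 4 \<or> n = 8" using \<open>n dvd 8\<close> by auto
  show ?thesis
  proof (cases "n = 4")
    case True
    then have "odd a" using a2 by presburger
    then have "4 dvd a * a - 1" by (auto elim!: oddE simp: algebra_simps)
    then have "n dvd a * a - 1" using True by simp
    then have "n dvd d - (a * (a * d) + c * 0)"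
      by (rule dvd_combine[OF _ \<open>n dvd a * a - 1\<close>, of _ _ "- d" 0]) (simp add: algebra_simps)
    then show ?thesis using D by blast
  next
    case False
    then have n8: "n = 8" using n48 by simp
    have a: "a mod 8 = 2 \<or> a mod 8 = 6" using a2 a4 unfolding n8 by presburger
    have c: "even c"
    proof -
      define y where "y = c + a * l"
      have "8 dvd 2 * y" using r2 n8 by (simp add: y_def algebra_simps)
      then have "even y" by presburger
      moreover have "even a" using a by presburger
      ultimately show ?thesis by (simp add: y_def)
    qed
    have "4 dvd c"
    proof (rule ccontr)
      assume "\<not> 4 dvd c"
      \<comment> \<open>Modulo 8 both \<open>a\<close> and \<open>c\<close> would be 2 or 6 and
        \<open>2 * a\<close> would be 4, which puts \<open>a\<close> into the subgroup generated by
        \<open>2 * a\<close> and \<open>c\<close>.\<close>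
      then have "8 dvd a - c \<or> 8 dvd a - c - 4" using c a by presburger
      moreover have "8 dvd 2 * a - 4" using a by presburger
      ultimately have "8 dvd a - (2 * a * 0 + c * 1) \<or> 8 dvd a - (2 * a * 1 + c * 1)" by presburger
      then show False using R[of 0 1] R[of 1 1] unfolding n8 by auto
    qed
    then have c': "c mod 8 = 0 \<or> c mod 8 = 4" by presburger
    have "even a" using a by presburger
    have b: "odd b"
    proof
      assume "even b"
      then show False using gcd \<open>even a\<close> c n8 two_prime by auto
    qed
    then have b': "b mod 8 = 1 \<or> b mod 8 = 3 \<or> b mod 8 = 5 \<or> b mod 8 = 7" by presburger
    \<comment> \<open>Odd residues are their own inverses modulo 8, so this scaling takes
      \<open>b\<close> to 1.\<close>
    define q where "q = b mod 8"
    have "coprime b (2 ^ 3)" using b unfolding coprime_power_right_iff by simp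
    then have "coprime b 8" by simp
    then have q: "q \<in> {0..<n}" "coprime q n" by (simp_all add: q_def n8 coprime_mod_left_iff)
    obtain \<epsilon> where e: "\<epsilon> \<in> {1, -1}" "(q * \<epsilon> * a) mod 8 = 2"
    proof -
      have "(q * 1 * a) mod 8 = (q * (a mod 8)) mod 8" "(q * (-1) * a) mod 8 = (q * (-1) * (a mod 8)) mod 8"
        by (simp_all only: mod_mult_right_eq mult_1_right)
      then show ?thesis using that[of 1] that[of "-1"] a b' by (auto simp: q_def)
    qed
    have q4: "q = 1 \<or> q = 3 \<or> q = 5 \<or> q = 7" using b' by (simp add: q_def)
    have "(q * b) mod 8 = (q * q) mod 8" unfolding q_def by (simp only: mod_mult_right_eq)
    also have "\<dots> = 1" using q4 by auto
    finally have vb: "(q * b) mod 8 = 1" .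
    have "8 dvd 2 * a - 4" using a by presburger
    moreover have "8 dvd d - b - 2 * a" using db n8 by simp
    ultimately have "8 dvd (d - b - 2 * a) + (2 * a - 4)" by (intro dvd_add)
    then have "d mod 8 = (b + 4) mod 8" by (simp add: mod_eq_dvd_iff algebra_simps)
    then have "d mod 8 = (q + 4) mod 8" unfolding q_def by (simp only: mod_add_left_eq)
    then have "(q * d) mod 8 = (q * ((q + 4) mod 8)) mod 8" by (metis mod_mult_right_eq)
    also have "\<dots> = 5" using q4 by auto
    finally have vd: "(q * d) mod 8 = 5" .
    have "(q * x) mod 8 = 0 \<or> (q * x) mod 8 = 4" if "x = 0 \<or> x = 4" for x using q4 that by auto
    from this[OF c'] have vc: "(q * c) mod 8 = 0 \<or> (q * c) mod 8 = 4" by (simp only: mod_mult_right_eq)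
    note vals = vb vc vd
    have "[5 = 2 * 2 + 1] (mod (8 :: int))" unfolding cong_iff_dvd_diff by simp
    moreover from vals(2) have "(8, 2, 1, (q * c) mod 8, 5) \<in> {(8, 2, 1, 0, 5), (8, 2, 1, 4, 5 :: int)}" by auto
    ultimately have "transitive_params n ((q * \<epsilon> * a) mod n) ((q * b) mod n) ((q * c) mod n) ((q * d) mod n)"
      unfolding transitive_params_def n8 e(2) vals(1,3) by blast
    then show ?thesis using e(1) q n8 by (intro conjI exI[of _ \<epsilon>] exI[of _ q]) auto
  qed
qed

text \<open>By \<open>D\<close> the numbers \<open>a\<close>, \<open>c\<close> and \<open>n\<close>
  share a prime; it divides \<open>4 * b\<close> but not \<open>b\<close>, so it is 2. The parity
  information then gives \<open>n = 4 * m\<close> with \<open>m\<close> odd, \<open>c = 0\<close>,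
  and \<open>a = 2 * h\<close> with \<open>h\<close> a unit. Scaling by the inverse of
  \<open>h\<close> takes \<open>a\<close> to 2, and it remains to take \<open>a + b\<close>, an odd
  multiple of \<open>m\<close>, to \<open>m\<close>.\<close>

lemma transitive_params_four:
  fixes n a b c d :: int
  assumes n: "3 \<le> n" and a4: "\<not> n dvd 4 * a" and db: "n dvd d - b - 2 * a"
    and R: "\<And>j k. \<not> n dvd a - (2 * a * j + c * k)" and D: "\<And>j k. \<not> n dvd d - (a * j + c * k)"
    and r1: "n dvd 4 * c - 4 * a - 4 * b" and r2: "n dvd 2 * c"
    and gcd: "\<nexists>p. prime p \<and> p dvd n \<and> p dvd a \<and> p dvd b \<and> p dvd c"
  shows "even n \<and> (\<exists>\<epsilon> q. \<epsilon> \<in> {1, -1} \<and> q \<in> {0..<n} \<and> coprime q n \<and>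
    transitive_params n ((q * \<epsilon> * a) mod n) ((q * b) mod n) ((q * c) mod n) ((q * d) mod n))"
proof -
  have ab: "n dvd 4 * (a + b)" using r1 r2 by algebra
  have "\<not> gcd a (gcd c n) dvd d" using D by (rule gcd_not_dvd)
  then have "\<bar>gcd a (gcd c n)\<bar> \<noteq> 1" by auto
  then obtain p where "prime p" "p dvd gcd a (gcd c n)" using prime_factor_int by blast
  then have p: "prime p" "p dvd a" "p dvd c" "p dvd n" "\<not> p dvd b" using gcd by auto
  have "p dvd 4 * (a + b)" using p(4) ab by (rule dvd_trans)
  then have "p dvd 2 * 2" using p by (simp add: prime_dvd_mult_iff dvd_add_right_iff)
  then have "p dvd 2" using p(1) prime_dvd_mult_iff by blast
  then have "p = 2" using p(1) using primes_dvd_imp_eq[OF _ two_prime] by blast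
  then have par: "even a" "even c" "even n" "odd b" using p by auto
  have n4: "4 dvd n" and c4: "4 dvd c" using not_generated_parity(3,4)[OF R, of 1] par by simp_all
  then obtain m where m: "n = 4 * m" by blast
  have ms: "m dvd a + b" using ab unfolding m by (simp only: dvd_mult_cancel_left) simp
  then have "odd m" using par by (metis dvd_trans even_add)
  obtain c' where c': "c = 4 * c'" using c4 by blast
  have "4 * m dvd 4 * (2 * c')" using r2 by (simp add: m c')
  then have "m dvd 2 * c'" by (simp only: dvd_mult_cancel_left) simp
  then have "m dvd c'" using \<open>odd m\<close> by (simp add: coprime_dvd_mult_right_iff)
  then have nc: "n dvd c" by (simp add: m c')
  have a_mod: "\<not> 4 dvd a"
  proof
    assume "4 dvd a"
    then have "8 dvd n" using not_generated_parity(3)[OF R, of 2] by simp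
    then show False using m \<open>odd m\<close> by presburger
  qed
  obtain h where h: "a = 2 * h" using par by blast
  have "odd h" using a_mod h by presburger
  have "coprime h m"
  proof (rule ccontr)
    assume "\<not> coprime h m"
    then have "\<bar>gcd h m\<bar> \<noteq> 1" by (simp add: coprime_iff_gcd_eq_1)
    then obtain p where p: "prime p" "p dvd gcd h m" using prime_factor_int by blast
    then have "p dvd a" "p dvd n" "p dvd a + b" using h m ms by (auto intro: dvd_trans)
    moreover have "p dvd c" using \<open>p dvd n\<close> nc by (rule dvd_trans)
    moreover have "p dvd b" using calculation by (simp add: dvd_add_right_iff)
    ultimately show False using gcd p by blast
  qed
  moreover have "coprime h (2 ^ 2)" using \<open>odd h\<close> unfolding coprime_power_right_iff by simp
  ultimately have "coprime h n" unfolding m by simp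
  then obtain r where r: "[h * r = 1] (mod n)" using cong_solve_coprime_int by blast
  then have hr: "n dvd h * r - 1" unfolding cong_iff_dvd_diff .
  obtain t where t: "a + b = m * t" using ms by blast
  have "odd (m * t)" using t par by (metis even_add)
  then have "odd t" by simp
  have "even (h * r - 1)" using par(3) hr by (rule dvd_trans)
  then have "odd r" by simp
  have rn: "coprime r n"
    using r by (metis cong_imp_coprime coprime_1_left coprime_mult_left_iff cong_sym)
  \<comment> \<open>Multiplication by \<open>r\<close> already takes \<open>a\<close> to 2. The unit
    \<open>1 + 2 * m\<close> fixes 2 modulo \<open>4 * m\<close> and is 3 modulo 4, so it corrects
    \<open>r * t\<close> to 1 modulo 4 when necessary.\<close>
  define q where "q = (if 4 dvd r * t - 1 then r else r * (1 + 2 * m))"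
  have "coprime (1 + 2 * m) n"
  proof -
    have "coprime (1 + 2 * m) m" by (metis coprime_1_left coprime_commute gcd_add_mult coprime_iff_gcd_eq_1 add.commute mult.commute)
    moreover have "coprime (1 + 2 * m) (2 ^ 2)" unfolding coprime_power_right_iff by simp
    ultimately show ?thesis unfolding m by simp
  qed
  then have q: "coprime q n" using rn by (simp add: q_def)
  have qh: "n dvd q * a - 2"
  proof -
    have ra: "n dvd r * a - 2" using hr unfolding h by algebra
    have "n dvd 2 * m * 2" by (simp add: m)
    from ra this have "n dvd r * (1 + 2 * m) * a - 2"
      by (rule dvd_combine[of _ _ _ _ 1 "r * h"]) (simp add: h algebra_simps)
    with ra show ?thesis by (simp add: q_def)
  qed
  have qs: "n dvd q * (a + b) - m"
  proof -
    obtain u where u: "q = r * u" "4 dvd r * t * u - 1"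
    proof (cases "4 dvd r * t - 1")
      case True
      then show ?thesis using that[of 1] by (simp add: q_def)
    next
      case False
      moreover have "odd (r * t)" using \<open>odd r\<close> \<open>odd t\<close> by simp
      moreover have "4 dvd y - 3" if "odd y" "\<not> 4 dvd y - 1" for y :: int using that by presburger
      ultimately have "4 dvd r * t - 3" by blast
      then obtain x where x: "r * t = 4 * x + 3" by (metis add.commute diff_add_cancel dvdE)
      obtain y where y: "m = 2 * y + 1" using \<open>odd m\<close> by (blast elim: oddE)
      have "r * t * (1 + 2 * m) - 1 = 4 * (4 * x * y + 3 * x + 3 * y + 2)"
        unfolding x y by (simp add: algebra_simps)
      then have "4 dvd r * t * (1 + 2 * m) - 1" by simp
      then show ?thesis using that[of "1 + 2 * m"] False by (simp add: q_def)
    qed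
    have "q * (a + b) - m = (r * t * u - 1) * m" unfolding u(1) t by (simp add: algebra_simps)
    then show ?thesis using u(2) unfolding m by simp
  qed
  have m1: "m > 1"
  proof (rule ccontr)
    assume "\<not> m > 1"
    then have "m = 1" using n m by auto
    then show False using a4 m by simp
  qed
  then have m3: "m \<ge> 3" using \<open>odd m\<close> by presburger
  have mod_eqI: "x mod n = y" if "n dvd x - y" "0 \<le> y" "y < n" for x y
    using that by (metis mod_eq_dvd_iff mod_pos_pos_trivial)
  have "n dvd q * b - (m - 2)" using qs qh by algebra
  moreover have "n dvd q * d - (m + 2)" using qs qh db by algebra
  ultimately have abcd: "(q * a) mod n = 2" "(q * b) mod n = m - 2" "(q * d) mod n = m + 2" "(q * c) mod n = 0"
    using qh nc m m3 by (intro mod_eqI; simp)+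
  define q' where "q' = q mod n"
  have q'_mod: "(q' * x) mod n = (q * x) mod n" for x by (simp add: q'_def mod_simps)
  have "q' \<in> {0..<n}" using n by (simp add: q'_def)
  moreover have "coprime q' n" using q n by (simp add: q'_def coprime_mod_left_iff)
  moreover have "m + 2 - (2 * 2 + (m - 2)) = 0" by simp
  then have "[m + 2 = 2 * 2 + (m - 2)] (mod n)" unfolding cong_iff_dvd_diff by simp
  then have "transitive_params n ((q' * 1 * a) mod n) ((q' * b) mod n) ((q' * c) mod n) ((q' * d) mod n)"
    unfolding transitive_params_def mult_1_right q'_mod abcd using m m1 \<open>odd m\<close> by blast
  ultimately show ?thesis using par(3) by blast
qed

section \<open>Graphs that are not arc-transitive\<close>

lemma (in straight_map) transitive_params:
  assumes gcd: "\<nexists>p. prime p \<and> p dvd n \<and> p dvd a \<and> p dvd b \<and> p dvd c"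
  shows "even n \<and> (\<exists>\<epsilon> q. \<epsilon> \<in> {1, -1} \<and> q \<in> {0..<n} \<and> coprime q n \<and>
    transitive_params n ((q * \<epsilon> * a) mod n) ((q * b) mod n) ((q * c) mod n) ((q * d) mod n))"
proof (cases regular)
  case True
  then obtain k where k: "k = 0 \<or> n dvd 4 * a" "n dvd 2 * c - 3 * a - 3 * b + 2 * a * k"
    unfolding regular_def slack_def by blast
  have "\<not> (even n \<and> even a \<and> even b \<and> even c)" using gcd two_prime by blast
  then show ?thesis using transitive_params_regular[OF n_ge a_not_generated db k(2,1)] by blast
next
  case False
  obtain k where k: "k = 0 \<or> n dvd 4 * a" "n dvd 4 * c - 4 * a - 4 * b + 2 * a * k"
    using exceptional(2)[OF False] unfolding slack_def by blast
  obtain l where l: "l = 0 \<or> n dvd 4 * a" "n dvd 2 * c + 2 * a * l"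
    using exceptional_c[OF False] unfolding slack_def by blast
  show ?thesis
  proof (cases "n dvd 4 * a")
    case True
    show ?thesis
      using transitive_params_eight[OF n_ge a2 True db a_not_generated exceptional_d[OF False] k(2) l(2) gcd] .
  next
    case 4: False
    have "n dvd 4 * c - 4 * a - 4 * b" "n dvd 2 * c" using k l 4 by auto
    then show ?thesis
      using transitive_params_four[OF n_ge 4 db a_not_generated exceptional_d[OF False] _ _ gcd] by blast
  qed
qed

text \<open>\<open>hor\<close> is the orbit of the edge from \<open>A 0\<close> to
  \<open>A a\<close>. It contains exactly two edges at \<open>A 0\<close>, hence by \<open>f\<close>
  two at \<open>B 0\<close>, where the edge to \<open>A 0\<close> is excluded. So two of the three
  parameters are horizontal, and the remaining one is taken as \<open>c'\<close>.\<close>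

lemma (in woolly_hat) straight_if_not_arc_transitive:
  assumes f: "aut f" "f (A 0) = B 0" and arc: "\<nexists>g. aut g \<and> g (A 0) = A 0 \<and> g (A a) = B 0"
  shows "\<exists>b' c' d'. mset [b', c', d'] = mset [b, c, d] \<and> (\<forall>g. aut g \<longrightarrow> woolly_hat.straight n a b' c' d' g)"
proof -
  define hor where "hor v w \<longleftrightarrow> (\<exists>g. aut g \<and> {g (A 0), g (A a)} = {v, w})" for v w
  have hor_sym: "hor v w \<longleftrightarrow> hor w v" for v w unfolding hor_def by (simp add: insert_commute)
  have hor_aut: "hor (h v) (h w) \<longleftrightarrow> hor v w" if h: "aut h" and vw: "v \<in> V" "w \<in> V" for h v w
  proof
    have *: "hor (h v) (h w)" if "hor v w" "aut h" for h v w
    proof -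
      from that(1) obtain g where g: "aut g" "{g (A 0), g (A a)} = {v, w}" unfolding hor_def by (elim exE conjE)
      have "{(h \<circ> g) (A 0), (h \<circ> g) (A a)} = {h v, h w}"
        using g(2) unfolding doubleton_eq_iff comp_apply by blast
      then show ?thesis unfolding hor_def by (intro exI[of _ "h \<circ> g"] conjI aut_comp[OF that(2) g(1)])
    qed
    show "hor (h v) (h w)" if "hor v w" using *[OF that h] .
    assume hvw: "hor (h v) (h w)"
    obtain h' where h': "aut h'" "\<And>v. v \<in> V \<Longrightarrow> h' (h v) = v" using aut_inv[OF h] by metis
    show "hor v w" using *[OF hvw h'(1)] h'(2) vw by simp
  qed
  have hor_id: "hor (A 0) (A a)" unfolding hor_def using aut_rot[of 0] by (intro exI[of _ "rot 0"]) simp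
  have hor_A: "hor (A i) (A (i + a))" "hor (A i) (A (i - a))" for i
  proof -
    show *: "hor (A i) (A (i + a))" for i using hor_aut[OF aut_rot[of i], of "A 0" "A a"] hor_id by (simp add: add_ac)
    show "hor (A i) (A (i - a))" using *[of "i - a"] hor_sym by simp
  qed
  have not_B0: "\<not> hor (A 0) (B 0)"
  proof
    assume "hor (A 0) (B 0)"
    then obtain g where g: "aut g" "{g (A 0), g (A a)} = {A 0, B 0}" unfolding hor_def by (elim exE conjE)
    \<comment> \<open>This product of a rotation and the reflection exchanges the ends of the edge,
      so \<open>g\<close> may be taken to fix \<open>A 0\<close>.\<close>
    have "aut (g \<circ> (rot a \<circ> reflection))" using g(1) by (simp add: aut_comp aut_rot aut_reflection)
    moreover have "(g \<circ> (rot a \<circ> reflection)) (A 0) = g (A a)" "(g \<circ> (rot a \<circ> reflection)) (A a) = g (A 0)" by simp_all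
    ultimately show False using arc g by (metis doubleton_eq_iff)
  qed
  have not_AB: "\<not> hor (A i) (B i)" for i using hor_aut[OF aut_rot[of i], of "A 0" "B 0"] not_B0 by simp
  have not_AC: "\<not> hor (A i) (C i)" for i using hor_aut[OF aut_reflection, of "A (- i)" "B (- i)"] not_AB[of "- i"] by simp
  define H where "H v = {w \<in> N v. hor v w}" for v
  have H_aut: "H (h v) = h ` H v" if "aut h" "v \<in> V" for h v
    using aut_N[OF that] N_subset[OF that(2)] hor_aut[OF that(1)] that(2) unfolding H_def by auto
  have HA: "H (A i) = {A (i + a), A (i - a)}" for i
    using hor_A not_AB not_AC by (auto simp: H_def N_A)
  have ne: "A (0 + a) \<noteq> A (0 - a)" using a2 by (simp add: v_eq_iff)
  have "card (H (A 0)) = 2" using HA[of 0] ne by simp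
  moreover have "inj_on f (H (A 0))"
    using f(1) N_subset[of "A 0"] by (auto simp: H_def aut_def bij_betw_def intro: inj_on_subset)
  ultimately have cardB: "card (H (B 0)) = 2" using H_aut[OF f(1), of "A 0"] f(2) by (simp add: card_image)
  have "H (B 0) \<subseteq> {C b, C c, C d}" using not_AB[of 0] hor_sym by (auto simp: H_def N_B)
  moreover have "card {C b, C c, C d} = 3" using bc bd cd by (simp add: v_eq_iff)
  ultimately obtain x where x: "x \<in> {b, c, d}" "H (B 0) = {C b, C c, C d} - {C x}"
  proof -
    assume *: "\<And>x. x \<in> {b, c, d} \<Longrightarrow> H (B 0) = {C b, C c, C d} - {C x} \<Longrightarrow> thesis"
    have "card ({C b, C c, C d} - H (B 0)) = 1"
      using \<open>H (B 0) \<subseteq> _\<close> \<open>card {C b, C c, C d} = 3\<close> cardB by (simp add: card_Diff_subset finite_subset)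
    then obtain y where y: "{C b, C c, C d} - H (B 0) = {y}" by (auto simp: card_1_singleton_iff)
    then have "y \<in> {C b, C c, C d}" "H (B 0) = {C b, C c, C d} - {y}" using \<open>H (B 0) \<subseteq> _\<close> by blast+
    then obtain x where "x \<in> {b, c, d}" "y = C x" by auto
    with \<open>H (B 0) = {C b, C c, C d} - {y}\<close> show thesis using *[of x] by simp
  qed
  have db: "\<not> n dvd d - b" "\<not> n dvd c - b" "\<not> n dvd d - c" using bc bd cd by (metis dvd_diff_commute)+
  have "\<exists>b' c' d'. mset [b', c', d'] = mset [b, c, d] \<and> H (B 0) = {C b', C d'}"
    using x(1)
  proof (elim insertE emptyE)
    assume "x = b"
    moreover have "C c \<noteq> C b" "C d \<noteq> C b" using bc bd cd db by (simp_all add: v_eq_iff)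
    ultimately have "H (B 0) = {C c, C d}" using x(2) by auto
    moreover have "mset [c, b, d] = mset [b, c, d]" by simp
    ultimately show ?thesis by (intro exI conjI)
  next
    assume "x = c"
    moreover have "C b \<noteq> C c" "C d \<noteq> C c" using bc bd cd db by (simp_all add: v_eq_iff)
    ultimately have "H (B 0) = {C b, C d}" using x(2) by auto
    moreover have "mset [b, c, d] = mset [b, c, d]" by simp
    ultimately show ?thesis by (intro exI conjI)
  next
    assume "x = d"
    moreover have "C b \<noteq> C d" "C c \<noteq> C d" using bc bd cd db by (simp_all add: v_eq_iff)
    ultimately have "H (B 0) = {C b, C c}" using x(2) by auto
    moreover have "mset [b, d, c] = mset [b, c, d]" by simp
    ultimately show ?thesis by (intro exI conjI)
  qed
  then obtain b' c' d' where perm: "mset [b', c', d'] = mset [b, c, d]" and HB0: "H (B 0) = {C b', C d'}"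
    by blast
  note wh_perm = woolly_hat_perm[OF woolly_hat_axioms perm]
  interpret W: woolly_hat n a b' c' d' by (rule wh_perm)
  have HB: "H (B i) = {C (i + b'), C (i + d')}" for i
    using H_aut[OF aut_rot[of i], of "B 0"] HB0 by (simp add: add_ac)
  have HC: "H (C i) = {B (i - b'), B (i - d')}" for i
    using H_aut[OF aut_reflection, of "B (- i)"] HB[of "- i"] by (simp add: algebra_simps)
  have H: "H v = {W.hn v, W.hp v}" if "v \<in> V" for v
    using that by (rule V_cases) (auto simp: HA HB HC)
  have NH: "N v - H v = {W.vn v, W.vp v}" if v: "v \<in> V" for v
  proof -
    have "N v = {W.hn v, W.hp v, W.vn v, W.vp v}" using W.N_step[of v] v wh_perm(2,3) by simp
    moreover have "W.vn v \<notin> {W.hn v, W.hp v} \<and> W.vp v \<notin> {W.hn v, W.hp v}"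
    proof -
      have ne: "\<not> n dvd b' - c'" "\<not> n dvd c' - b'" "\<not> n dvd c' - d'" "\<not> n dvd d' - c'"
        using W.bc W.cd by (metis dvd_diff_commute)+
      show ?thesis using v
      proof (cases rule: V_cases)
        case (B i)
        then show ?thesis using ne by (simp add: v_eq_iff)
      next
        case (C i)
        then show ?thesis using ne by (simp add: v_eq_iff)
      qed simp
    qed
    ultimately show ?thesis using H[OF v] by auto
  qed
  have "W.straight g" if g: "aut g" for g
    unfolding W.straight_def
  proof (intro conjI ballI)
    show "W.aut g" using g wh_perm(4) by simp
    fix v assume "v \<in> W.V"
    then have v: "v \<in> V" using wh_perm(3) by simp
    note gv = aut_V[OF g v]
    show "g ` {W.hn v, W.hp v} = {W.hn (g v), W.hp (g v)}"
      using H_aut[OF g v] H[OF v] H[OF gv] by simp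
    have "inj_on g (N v)" using g N_subset[OF v] by (auto simp: aut_def bij_betw_def intro: inj_on_subset)
    then have "g ` (N v - H v) = N (g v) - H (g v)"
      using H_aut[OF g v] aut_N[OF g v] by (simp add: inj_on_image_set_diff H_def)
    then show "g ` {W.vn v, W.vp v} = {W.vn (g v), W.vp (g v)}" using NH[OF v] NH[OF gv] by simp
  qed
  then show ?thesis using perm by blast
qed

text \<open>Two choices are left open: whether \<open>f (A a)\<close> is \<open>C d'\<close> or
  \<open>C b'\<close>, and the sign in \<open>d' - b' = 2 * a\<close>. Exchanging \<open>b'\<close>
  and \<open>d'\<close> settles the first; doing this together with the reflection settles the
  second.\<close>

lemma params_if_not_arc_transitive:
  assumes wh: "woolly_hat n a b c d"
    and f: "woolly_hat.aut n a b c d f" "f (vA n 0) = vB n 0"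
    and arc: "\<nexists>g. woolly_hat.aut n a b c d g \<and> g (vA n 0) = vA n 0 \<and> g (vA n a) = vB n 0"
    and gcd: "\<nexists>p. prime p \<and> p dvd n \<and> p dvd a \<and> p dvd b \<and> p dvd c \<and> p dvd d"
  shows "even n \<and> (\<exists>b' c' d' \<epsilon> q. mset [b', c', d'] = mset [b, c, d] \<and>
    \<epsilon> \<in> {1, -1} \<and> q \<in> {0..<n} \<and> coprime q n \<and>
    transitive_params n ((q * \<epsilon> * a) mod n) ((q * b') mod n) ((q * c') mod n) ((q * d') mod n))"
proof -
  interpret woolly_hat n a b c d by fact
  obtain b1 c1 d1 where 1: "mset [b1, c1, d1] = mset [b, c, d]"
    "\<And>g. aut g \<Longrightarrow> woolly_hat.straight n a b1 c1 d1 g"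
    using straight_if_not_arc_transitive[OF f arc] by blast
  have swap: "mset [d', c', b'] = mset [b', c', d']" for b' c' d' :: int by simp
  have swap_straight: "woolly_hat.straight n a d' c' b' g"
    if "woolly_hat.straight n a b' c' d' g" "woolly_hat n a b' c' d'" for b' c' d' g
  proof -
    interpret W: woolly_hat n a b' c' d' by fact
    note p = woolly_hat_perm[OF that(2) swap]
    interpret W': woolly_hat n a d' c' b' by (rule p)
    have "{W'.hn v, W'.hp v} = {W.hn v, W.hp v}" "W'.vn v = W.vn v" "W'.vp v = W.vp v" if "v \<in> W.V" for v
      by (rule W.V_cases[OF that]; auto)+
    then show ?thesis using that(1) p(3,4) unfolding W.straight_def W'.straight_def
      by (simp add: W.aut_V)
  qed
  have fin: ?thesis if perm: "mset [b', c', d'] = mset [b, c, d]" and "\<And>g. aut g \<Longrightarrow> woolly_hat.straight n a b' c' d' g"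
    "aut g" "g (A 0) = B 0" "g (A a) = C d'" "n dvd d' - b' - 2 * a" for b' c' d' g
  proof -
    note p = woolly_hat_perm[OF wh perm]
    interpret W: woolly_hat n a b' c' d' by (rule p)
    interpret straight_map n a b' c' d' g using that by unfold_locales simp_all
    have "{b', c', d'} = {b, c, d}" using mset_eq_setD[OF perm] by simp
    then have "(\<forall>x\<in>{b, c, d}. p dvd x) \<longleftrightarrow> (\<forall>x\<in>{b', c', d'}. p dvd x)" for p by simp
    then have abcd: "p dvd b \<and> p dvd c \<and> p dvd d \<longleftrightarrow> p dvd b' \<and> p dvd c' \<and> p dvd d'" for p by simp
    have "p dvd d'" if "p dvd n" "p dvd a" "p dvd b'" for p
    proof -
      have "p dvd d' - b' - 2 * a" using that(1) db by (rule dvd_trans)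
      then show ?thesis using that(2,3) by (simp add: dvd_diff_right_iff dvd_diff_left_iff)
    qed
    then have "\<nexists>p. prime p \<and> p dvd n \<and> p dvd a \<and> p dvd b' \<and> p dvd c'" using gcd abcd by blast
    then show ?thesis using transitive_params perm by blast
  qed
  have main: ?thesis if perm: "mset [b', c', d'] = mset [b, c, d]" and st: "\<And>g. aut g \<Longrightarrow> woolly_hat.straight n a b' c' d' g"
    and fa: "f (A a) = C d'" for b' c' d'
  proof -
    note p = woolly_hat_perm[OF wh perm]
    interpret W: woolly_hat n a b' c' d' by (rule p)
    have "n dvd d' - b' - 2 * a \<or> n dvd d' - b' + 2 * a"
      using W.horizontal_shift[OF st[OF f(1)] f(2) fa] .
    then show ?thesis
    proof
      assume "n dvd d' - b' - 2 * a"
      then show ?thesis using fin[OF perm st f fa] by blast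
    next
      assume "n dvd d' - b' + 2 * a"
      then have *: "n dvd b' - d' - 2 * a" by algebra
      have "f (A (- a)) = C b'"
        using W.straight_h[OF st[OF f(1)], of "A 0"] f(2) fa W.hn_neq_hp[of "B 0"] by auto
      then have "(f \<circ> reflection) (A a) = C b'" by simp
      moreover have "aut (f \<circ> reflection)" "(f \<circ> reflection) (A 0) = B 0" using f by (simp_all add: aut_comp aut_reflection)
      moreover have "mset [d', c', b'] = mset [b, c, d]" by (rule trans[OF swap perm])
      ultimately show ?thesis using fin[of d' c' b' "f \<circ> reflection"] swap_straight st p(1) * by blast
    qed
  qed
  note p1 = woolly_hat_perm[OF wh 1(1)]
  interpret W1: woolly_hat n a b1 c1 d1 by (rule p1)
  have "f (A a) = C d1 \<or> f (A a) = C b1" using W1.straight_h[OF 1(2)[OF f(1)], of "A 0"] f(2) by auto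
  then show ?thesis
  proof
    assume "f (A a) = C d1"
    then show ?thesis using main[OF 1] by blast
  next
    assume "f (A a) = C b1"
    moreover have "mset [d1, c1, b1] = mset [b, c, d]" by (rule trans[OF swap 1(1)])
    ultimately show ?thesis using main[of d1 c1 b1] swap_straight 1(2) p1(1) by blast
  qed
qed

section \<open>Counting non-backtracking walks\<close>

lemma sum_list_concat: "sum_list (concat xss) = sum_list (map sum_list xss)" for xss :: "nat list list"
  by (induction xss) simp_all

text \<open>\<open>AP\<close> and \<open>AM\<close> add and subtract \<open>a\<close> on the \<open>A\<close>-vertices, \<open>AB\<close> and the like join vertices with the same index,
  and \<open>Xz\<close> goes from a \<open>B\<close>-vertex to a \<open>C\<close>-vertex along \<open>z\<close>, with reverse \<open>Yz\<close>.\<close>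

datatype step = AP | AM | AB | AC | BA | CA | Xb | Xc | Xd | Yb | Yc | Yd

fun next_steps :: "step \<Rightarrow> step list" where
  "next_steps AP = [AP, AB, AC]" | "next_steps AM = [AM, AB, AC]"
| "next_steps AB = [Xb, Xc, Xd]" | "next_steps AC = [Yb, Yc, Yd]"
| "next_steps BA = [AP, AM, AC]" | "next_steps CA = [AP, AM, AB]"
| "next_steps Xb = [CA, Yc, Yd]" | "next_steps Xc = [CA, Yb, Yd]" | "next_steps Xd = [CA, Yb, Yc]"
| "next_steps Yb = [BA, Xc, Xd]" | "next_steps Yc = [BA, Xb, Xd]" | "next_steps Yd = [BA, Xb, Xc]"

fun previous_steps :: "step \<Rightarrow> step list" where
  "previous_steps AP = [AP, BA, CA]" | "previous_steps AM = [AM, BA, CA]"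
| "previous_steps AB = [AP, AM, CA]" | "previous_steps AC = [AP, AM, BA]"
| "previous_steps BA = [Yb, Yc, Yd]" | "previous_steps CA = [Xb, Xc, Xd]"
| "previous_steps Xb = [AB, Yc, Yd]" | "previous_steps Xc = [AB, Yb, Yd]" | "previous_steps Xd = [AB, Yb, Yc]"
| "previous_steps Yb = [AC, Xc, Xd]" | "previous_steps Yc = [AC, Xb, Xd]" | "previous_steps Yd = [AC, Xb, Xc]"

text \<open>\<open>(p, q, r, s)\<close> stands for the index displacement \<open>p a + q b + r c + s d\<close>.\<close>

type_synonym vec = "int \<times> int \<times> int \<times> int"

fun shift :: "step \<Rightarrow> vec" where
  "shift AP = (1, 0, 0, 0)" | "shift AM = (- 1, 0, 0, 0)"
| "shift AB = (0, 0, 0, 0)" | "shift AC = (0, 0, 0, 0)" | "shift BA = (0, 0, 0, 0)" | "shift CA = (0, 0, 0, 0)"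
| "shift Xb = (0, 1, 0, 0)" | "shift Xc = (0, 0, 1, 0)" | "shift Xd = (0, 0, 0, 1)"
| "shift Yb = (0, - 1, 0, 0)" | "shift Yc = (0, 0, - 1, 0)" | "shift Yd = (0, 0, 0, - 1)"

fun vadd :: "vec \<Rightarrow> vec \<Rightarrow> vec" where
  "vadd (p, q, r, s) (p', q', r', s') = (p + p', q + q', r + r', s + s')"

text \<open>A closed walk and its reverse have opposite displacements.\<close>

fun canon :: "vec \<Rightarrow> vec" where
  "canon (p, q, r, s) = (if p < 0 \<or> p = 0 \<and> (q < 0 \<or> q = 0 \<and> (r < 0 \<or> r = 0 \<and> s < 0))
     then (- p, - q, - r, - s) else (p, q, r, s))"

text \<open>The parameters stay symbolic, so one computed table serves all graphs. The index changes
  along the first and the last arc are both included.\<close>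

fun displacements :: "nat \<Rightarrow> step \<Rightarrow> step \<Rightarrow> vec list" where
  "displacements 0 e e' = (if e = e' then [shift e'] else [])"
| "displacements (Suc k) e e' =
     concat (map (\<lambda>e2. map (vadd (shift e)) (displacements k e2 e')) (next_steps e))"

definition cycle_displacements :: "nat \<Rightarrow> step \<Rightarrow> vec list" where
  "cycle_displacements k e = map canon (concat (map (displacements k e) (previous_steps e)))"

context woolly_hat
begin

text \<open>The number of non-backtracking walks that start with the arc from \<open>u\<close> to \<open>v\<close> and arrive at the arc
  from \<open>w\<close> to \<open>x\<close> after \<open>k\<close> further steps.\<close>

fun npaths :: "nat \<Rightarrow> wh_vertex \<Rightarrow> wh_vertex \<Rightarrow> wh_vertex \<Rightarrow> wh_vertex \<Rightarrow> nat" where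
  "npaths 0 u v w x = of_bool (u = w \<and> v = x)"
| "npaths (Suc k) u v w x = (\<Sum>y\<in>N v - {u}. npaths k v y w x)"

lemma npaths_aut:
  assumes "aut h" "u \<in> V" "v \<in> V" "w \<in> V" "x \<in> V"
  shows "npaths k (h u) (h v) (h w) (h x) = npaths k u v w x"
  using assms(2,3)
proof (induction k arbitrary: u v)
  case 0
  then show ?case using assms by (simp add: aut_inj)
next
  case (Suc k)
  have inj: "inj_on h V" using assms(1) by (simp add: aut_def bij_betw_def)
  have sub: "N v - {u} \<subseteq> V" using N_subset[OF Suc.prems(2)] by blast
  have "N (h v) - {h u} = h ` (N v - {u})"
    using aut_N[OF assms(1) Suc.prems(2)] inj_on_image_set_diff[OF inj sub] Suc.prems
    by simp
  then have "npaths (Suc k) (h u) (h v) (h w) (h x) = (\<Sum>y\<in>N v - {u}. npaths k (h v) (h y) (h w) (h x))"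
    using sum.reindex[OF inj_on_subset[OF inj sub]] by simp
  also have "\<dots> = npaths (Suc k) u v w x"
    using Suc sub by (auto intro!: sum.cong)
  finally show ?case .
qed

fun dval :: "vec \<Rightarrow> int" where
  "dval (p, q, r, s) = p * a + q * b + r * c + s * d"

lemma dval_vadd: "dval (vadd x y) = dval x + dval y"
  by (cases x; cases y) (simp add: algebra_simps)

text \<open>A number rather than a truth value, so that counts of closed walks become linear
  equations in the relations.\<close>

definition R :: "vec \<Rightarrow> nat" where "R x = of_bool (n dvd dval x)"

lemma R_canon: "R (canon x) = R x"
proof -
  have "dval (canon x) = dval x \<or> dval (canon x) = - dval x"
    by (cases x) (auto simp: algebra_simps)
  then show ?thesis by (auto simp: R_def)
qed

fun tail :: "step \<Rightarrow> int \<Rightarrow> wh_vertex" where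
  "tail AP i = A i" | "tail AM i = A i" | "tail AB i = A i" | "tail AC i = A i" | "tail BA i = B i" | "tail CA i = C i"
| "tail Xb i = B i" | "tail Xc i = B i" | "tail Xd i = B i" | "tail Yb i = C i" | "tail Yc i = C i" | "tail Yd i = C i"

fun head :: "step \<Rightarrow> int \<Rightarrow> wh_vertex" where
  "head AP i = A (i + a)" | "head AM i = A (i - a)" | "head AB i = B i" | "head AC i = C i" | "head BA i = A i" | "head CA i = A i"
| "head Xb i = C (i + b)" | "head Xc i = C (i + c)" | "head Xd i = C (i + d)"
| "head Yb i = B (i - b)" | "head Yc i = B (i - c)" | "head Yd i = B (i - d)"

lemma step_arith:
  "\<not> n dvd c - b" "\<not> n dvd d - b" "\<not> n dvd d - c" "\<not> n dvd - a - a" "\<not> n dvd a + a" "\<not> n dvd - (2 * a)"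
  using a2 bc bd cd by (simp_all add: dvd_diff_commute)

lemma tail_next:
  "tail e2 (i + dval (shift e)) = head e i" if "e2 \<in> set (next_steps e)"
  using that by (cases e) auto

lemma N_next:
  "N (head e i) - {tail e i} = (\<lambda>e2. head e2 (i + dval (shift e))) ` set (next_steps e)"
  "inj_on (\<lambda>e2. head e2 (i + dval (shift e))) (set (next_steps e))"
  by (cases e; use a2 bc bd cd step_arith in \<open>auto simp: N_A N_B N_C v_eq_iff inj_on_def\<close>)+

lemma distinct_next: "distinct (next_steps e)"
  by (cases e) auto

lemma head_inj: "tail e i = tail e' i \<Longrightarrow> head e i = head e' i \<longleftrightarrow> e = e'"
  by (cases e; cases e'; use a2 bc bd cd step_arith in \<open>simp add: v_eq_iff\<close>)

lemma tail_head_cong: "n dvd i - j \<Longrightarrow> tail e i = tail e j \<and> head e i = head e j"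
  by (cases e) (simp_all add: v_eq_iff)

lemma tail_dvd: "tail e i = tail e' j \<Longrightarrow> n dvd i - j"
  by (cases e; cases e'; simp add: v_eq_iff)

lemma arc_eq: "tail e i = tail e' j \<and> head e i = head e' j \<longleftrightarrow> e = e' \<and> n dvd i - j"
  using tail_dvd[where e = e and i = i and e' = e' and j = j] tail_head_cong[where i = i and j = j and e = e'] head_inj[where e = e and i = i and e' = e'] by metis

text \<open>A walk that starts at index \<open>i\<close> with displacement \<open>x\<close> ends at
  the head of the last arc, whose index is \<open>j + dval (shift e')\<close>.\<close>

lemma npaths_displacements:
  "npaths k (tail e i) (head e i) (tail e' j) (head e' j) =
    (\<Sum>x\<leftarrow>displacements k e e'. of_bool (n dvd i - j - dval (shift e') + dval x))"
proof (induction k arbitrary: e i)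
  case 0
  show ?case by (simp add: arc_eq)
next
  case (Suc k)
  have "npaths (Suc k) (tail e i) (head e i) (tail e' j) (head e' j)
    = (\<Sum>e2\<in>set (next_steps e). npaths k (head e i) (head e2 (i + dval (shift e))) (tail e' j) (head e' j))"
    using N_next[where e = e and i = i] by (simp add: sum.reindex)
  also have "\<dots> = (\<Sum>e2\<leftarrow>next_steps e. npaths k (head e i) (head e2 (i + dval (shift e))) (tail e' j) (head e' j))"
    using distinct_next by (simp add: sum_list_distinct_conv_sum_set)
  also have "\<dots> = (\<Sum>e2\<leftarrow>next_steps e.
      \<Sum>x\<leftarrow>displacements k e2 e'. of_bool (n dvd (i + dval (shift e)) - j - dval (shift e') + dval x))"
  proof (intro arg_cong[where f = sum_list] map_cong[OF refl])
    fix e2 assume "e2 \<in> set (next_steps e)"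
    from tail_next[OF this, where i = i] Suc.IH[of e2 "i + dval (shift e)"]
    show "npaths k (head e i) (head e2 (i + dval (shift e))) (tail e' j) (head e' j) =
      (\<Sum>x\<leftarrow>displacements k e2 e'. of_bool (n dvd (i + dval (shift e)) - j - dval (shift e') + dval x))"
      by simp
  qed
  also have "\<dots> = (\<Sum>x\<leftarrow>displacements (Suc k) e e'. of_bool (n dvd i - j - dval (shift e') + dval x))"
    by (simp add: sum_list_concat map_concat comp_def dval_vadd algebra_simps)
  finally show ?case .
qed

lemma neighbour_sum_aut:
  fixes F :: "wh_vertex \<Rightarrow> wh_vertex \<Rightarrow> wh_vertex \<Rightarrow> nat"
  assumes "aut h" "v \<in> V" "w \<in> V" and inv: "\<And>u. u \<in> V \<Longrightarrow> F (h u) (h v) (h w) = F u v w"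
  shows "(\<Sum>u\<in>N (h v) - {h w}. F u (h v) (h w)) = (\<Sum>u\<in>N v - {w}. F u v w)"
proof -
  have inj: "inj_on h V" using assms(1) by (simp add: aut_def bij_betw_def)
  have sub: "N v - {w} \<subseteq> V" using N_subset[OF assms(2)] by blast
  have "N (h v) - {h w} = h ` (N v - {w})"
    using aut_N[OF assms(1,2)] inj_on_image_set_diff[OF inj sub] assms by simp
  then have "(\<Sum>u\<in>N (h v) - {h w}. F u (h v) (h w)) = (\<Sum>u\<in>N v - {w}. F (h u) (h v) (h w))"
    using sum.reindex[OF inj_on_subset[OF inj sub]] by simp
  also have "\<dots> = (\<Sum>u\<in>N v - {w}. F u v w)"
    using inv sub by (intro sum.cong) auto
  finally show ?thesis .
qed

text \<open>The last arc runs from \<open>u\<close> to \<open>v\<close>; excluding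
  \<open>u = w\<close> forbids backtracking also where the walk closes.\<close>

definition cycles6 :: "wh_vertex \<Rightarrow> wh_vertex \<Rightarrow> nat" where
  "cycles6 v w = (\<Sum>u\<in>N v - {w}. npaths 5 v w u v)"

lemma cycles6_aut:
  assumes "aut h" "v \<in> V" "w \<in> V"
  shows "cycles6 (h v) (h w) = cycles6 v w"
  unfolding cycles6_def using assms by (intro neighbour_sum_aut) (auto simp: npaths_aut)

lemma cycles6_displacements:
  "cycles6 (tail e 0) (head e 0) = (\<Sum>x\<leftarrow>cycle_displacements 5 e. R x)"
proof -
  have 1: "N (tail e 0) - {head e 0} = (\<lambda>e'. tail e' (- dval (shift e'))) ` set (previous_steps e)"
    "inj_on (\<lambda>e'. tail e' (- dval (shift e'))) (set (previous_steps e))"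
    by (cases e; use a2 bc bd cd step_arith in \<open>auto simp: N_A N_B N_C v_eq_iff inj_on_def\<close>)+
  have 2: "head e' (- dval (shift e')) = tail e 0" if "e' \<in> set (previous_steps e)" for e'
    using that by (cases e) auto
  have dist: "distinct (previous_steps e)" by (cases e) auto
  have "cycles6 (tail e 0) (head e 0) =
      (\<Sum>e'\<leftarrow>previous_steps e. npaths 5 (tail e 0) (head e 0) (tail e' (- dval (shift e'))) (tail e 0))"
    unfolding cycles6_def 1(1) using 1(2) dist by (simp add: sum.reindex sum_list_distinct_conv_sum_set)
  also have "\<dots> = (\<Sum>e'\<leftarrow>previous_steps e. \<Sum>x\<leftarrow>displacements 5 e e'. R x)"
  proof (intro arg_cong[where f = sum_list] map_cong[OF refl])
    fix e' assume "e' \<in> set (previous_steps e)"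
    from 2[OF this] npaths_displacements[of 5 e 0 e' "- dval (shift e')"]
    show "npaths 5 (tail e 0) (head e 0) (tail e' (- dval (shift e'))) (tail e 0) = (\<Sum>x\<leftarrow>displacements 5 e e'. R x)"
      by (simp add: R_def)
  qed
  also have "\<dots> = (\<Sum>x\<leftarrow>cycle_displacements 5 e. R x)"
    by (simp add: cycle_displacements_def sum_list_concat map_concat comp_def R_canon)
  finally show ?thesis .
qed

end

section \<open>Tables of the relations that close walks of length 6\<close>

lemma cycle_displacements_AP: "cycle_displacements 5 AP = [(6, 0, 0, 0), (3, 1, 0, 0), (3, 0, 1, 0),
    (3, 0, 0, 1), (3, - 1, 0, 0), (3, 0, - 1, 0), (3, 0, 0, - 1), (3, 1, 0, 0), (2, 1, - 1, 0), (2, 1, 0, - 1),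
    (3, 0, 1, 0), (2, - 1, 1, 0), (2, 0, 1, - 1), (3, 0, 0, 1), (2, - 1, 0, 1), (2, 0, - 1, 1), (3, - 1, 0, 0),
    (2, - 1, 1, 0), (2, - 1, 0, 1), (3, 0, - 1, 0), (2, 1, - 1, 0), (2, 0, - 1, 1), (3, 0, 0, - 1),
    (2, 1, 0, - 1), (2, 0, 1, - 1), (3, - 1, 0, 0), (3, 0, - 1, 0), (3, 0, 0, - 1), (2, 1, - 1, 0),
    (2, 1, 0, - 1), (2, - 1, 1, 0), (2, 0, 1, - 1), (2, - 1, 0, 1), (2, 0, - 1, 1), (1, - 2, 1, 0),
    (1, - 1, 1, - 1), (1, - 2, 0, 1), (1, - 1, - 1, 1), (1, 1, - 2, 0), (1, 1, - 1, - 1), (1, - 1, - 1, 1),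
    (1, 0, - 2, 1), (1, 1, - 1, - 1), (1, 1, 0, - 2), (1, - 1, 1, - 1), (1, 0, 1, - 2), (3, 1, 0, 0),
    (3, 0, 1, 0), (3, 0, 0, 1), (2, - 1, 1, 0), (2, - 1, 0, 1), (2, 1, - 1, 0), (2, 0, - 1, 1), (2, 1, 0, - 1),
    (2, 0, 1, - 1), (1, 2, - 1, 0), (1, 1, - 1, 1), (1, 2, 0, - 1), (1, 1, 1, - 1), (1, - 1, 2, 0),
    (1, - 1, 1, 1), (1, 1, 1, - 1), (1, 0, 2, - 1), (1, - 1, 1, 1), (1, - 1, 0, 2), (1, 1, - 1, 1), (1, 0, - 1, 2)]"
  by code_simp

lemma cycle_displacements_AB: "cycle_displacements 5 AB = [(3, 1, 0, 0), (2, 1, - 1, 0), (1, 2, - 1, 0),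
    (1, 1, - 1, 1), (2, 1, 0, - 1), (1, 2, 0, - 1), (1, 1, 1, - 1), (3, 0, 1, 0), (2, - 1, 1, 0),
    (1, - 1, 2, 0), (1, - 1, 1, 1), (2, 0, 1, - 1), (1, 1, 1, - 1), (1, 0, 2, - 1), (3, 0, 0, 1),
    (2, - 1, 0, 1), (1, - 1, 1, 1), (1, - 1, 0, 2), (2, 0, - 1, 1), (1, 1, - 1, 1), (1, 0, - 1, 2),
    (3, - 1, 0, 0), (2, - 1, 1, 0), (1, - 2, 1, 0), (1, - 1, 1, - 1), (2, - 1, 0, 1), (1, - 2, 0, 1),
    (1, - 1, - 1, 1), (3, 0, - 1, 0), (2, 1, - 1, 0), (1, 1, - 2, 0), (1, 1, - 1, - 1), (2, 0, - 1, 1),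
    (1, - 1, - 1, 1), (1, 0, - 2, 1), (3, 0, 0, - 1), (2, 1, 0, - 1), (1, 1, - 1, - 1), (1, 1, 0, - 2),
    (2, 0, 1, - 1), (1, - 1, 1, - 1), (1, 0, 1, - 2), (0, 2, 0, 0), (0, 1, 1, 0), (0, 1, 0, 1), (0, 1, 1, 0),
    (0, 0, 2, 0), (0, 0, 1, 1), (0, 1, 0, 1), (0, 0, 1, 1), (0, 0, 0, 2)]"
  by code_simp

lemma cycle_displacements_Xb: "cycle_displacements 5 Xb = [(3, 1, 0, 0), (3, - 1, 0, 0), (0, 2, 0, 0),
    (0, 1, 1, 0), (0, 1, 0, 1), (2, 1, - 1, 0), (2, - 1, 1, 0), (1, 2, - 1, 0), (1, - 2, 1, 0), (1, 1, - 1, 1),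
    (1, - 1, 1, - 1), (2, 1, 0, - 1), (2, - 1, 0, 1), (1, 2, 0, - 1), (1, - 2, 0, 1), (1, 1, 1, - 1),
    (1, - 1, - 1, 1), (2, 1, - 1, 0), (1, 2, - 1, 0), (1, 1, - 1, 1), (2, - 1, 1, 0), (1, - 2, 1, 0),
    (1, - 1, 1, - 1), (1, 1, - 2, 0), (1, - 1, 2, 0), (0, 3, - 3, 0), (0, 2, - 3, 1), (0, 3, - 2, - 1),
    (0, 0, 2, - 2), (0, 2, - 3, 1), (0, 1, - 3, 2), (1, 1, - 1, - 1), (1, - 1, 1, 1), (0, 3, - 2, - 1),
    (0, 2, - 2, 0), (0, 3, - 1, - 2), (0, 0, 0, 0), (0, 2, 0, - 2), (2, 1, 0, - 1), (1, 2, 0, - 1),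
    (1, 1, 1, - 1), (2, - 1, 0, 1), (1, - 2, 0, 1), (1, - 1, - 1, 1), (1, 1, - 1, - 1), (1, - 1, 1, 1),
    (0, 3, - 2, - 1), (0, 3, - 1, - 2), (0, 2, 0, - 2), (0, 0, 0, 0), (0, 2, - 2, 0), (1, 1, 0, - 2),
    (1, - 1, 0, 2), (0, 3, - 1, - 2), (0, 3, 0, - 3), (0, 2, 1, - 3), (0, 0, 2, - 2), (0, 2, 1, - 3), (0, 1, 2, - 3)]"
  by code_simp

lemma cycle_displacements_Xc: "cycle_displacements 5 Xc = [(3, 0, 1, 0), (3, 0, - 1, 0), (0, 1, 1, 0),
    (0, 0, 2, 0), (0, 0, 1, 1), (2, - 1, 1, 0), (2, 1, - 1, 0), (1, - 1, 2, 0), (1, 1, - 2, 0), (1, - 1, 1, 1),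
    (1, 1, - 1, - 1), (2, 0, 1, - 1), (2, 0, - 1, 1), (1, 1, 1, - 1), (1, - 1, - 1, 1), (1, 0, 2, - 1),
    (1, 0, - 2, 1), (2, - 1, 1, 0), (1, - 1, 2, 0), (1, - 1, 1, 1), (2, 1, - 1, 0), (1, 1, - 2, 0),
    (1, 1, - 1, - 1), (1, - 2, 1, 0), (1, 2, - 1, 0), (0, 3, - 3, 0), (0, 3, - 2, - 1), (0, 2, - 3, 1),
    (0, 3, - 2, - 1), (0, 3, - 1, - 2), (0, 2, 0, - 2), (1, - 1, 1, - 1), (1, 1, - 1, 1), (0, 0, 0, 0),
    (0, 0, 2, - 2), (0, 2, - 3, 1), (0, 2, - 2, 0), (0, 1, - 3, 2), (2, 0, 1, - 1), (1, 1, 1, - 1),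
    (1, 0, 2, - 1), (2, 0, - 1, 1), (1, - 1, - 1, 1), (1, 0, - 2, 1), (1, - 1, 1, - 1), (1, 1, - 1, 1),
    (0, 2, - 3, 1), (0, 0, 2, - 2), (0, 1, - 3, 2), (0, 2, - 2, 0), (0, 0, 0, 0), (1, 0, 1, - 2),
    (1, 0, - 1, 2), (0, 2, 0, - 2), (0, 2, 1, - 3), (0, 1, 2, - 3), (0, 1, - 3, 2), (0, 1, 2, - 3), (0, 0, 3, - 3)]"
  by code_simp

lemma cycle_displacements_Xd: "cycle_displacements 5 Xd = [(3, 0, 0, 1), (3, 0, 0, - 1), (0, 1, 0, 1),
    (0, 0, 1, 1), (0, 0, 0, 2), (2, - 1, 0, 1), (2, 1, 0, - 1), (1, - 1, 1, 1), (1, 1, - 1, - 1),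
    (1, - 1, 0, 2), (1, 1, 0, - 2), (2, 0, - 1, 1), (2, 0, 1, - 1), (1, 1, - 1, 1), (1, - 1, 1, - 1),
    (1, 0, - 1, 2), (1, 0, 1, - 2), (2, - 1, 0, 1), (1, - 1, 1, 1), (1, - 1, 0, 2), (2, 1, 0, - 1),
    (1, 1, - 1, - 1), (1, 1, 0, - 2), (1, - 2, 0, 1), (1, 2, 0, - 1), (0, 3, - 2, - 1), (0, 3, - 1, - 2),
    (0, 2, - 2, 0), (0, 3, - 1, - 2), (0, 3, 0, - 3), (0, 2, 1, - 3), (1, - 1, - 1, 1), (1, 1, 1, - 1),
    (0, 0, 2, - 2), (0, 0, 0, 0), (0, 2, 0, - 2), (0, 2, 1, - 3), (0, 1, 2, - 3), (2, 0, - 1, 1),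
    (1, 1, - 1, 1), (1, 0, - 1, 2), (2, 0, 1, - 1), (1, - 1, 1, - 1), (1, 0, 1, - 2), (1, - 1, - 1, 1),
    (1, 1, 1, - 1), (0, 2, 0, - 2), (0, 0, 0, 0), (0, 2, 1, - 3), (0, 0, 2, - 2), (0, 1, 2, - 3),
    (1, 0, - 2, 1), (1, 0, 2, - 1), (0, 2, - 3, 1), (0, 1, - 3, 2), (0, 2, - 2, 0), (0, 1, 2, - 3),
    (0, 1, - 3, 2), (0, 0, 3, - 3)]"
  by code_simp

section \<open>Six-cycles in arc-transitive graphs\<close>

lemma half_unique:
  fixes n x y :: int
  assumes "n dvd 2 * x" "\<not> n dvd x" "n dvd 2 * y" "\<not> n dvd y"
  shows "n dvd x - y"
proof -
  obtain k l where k: "2 * x = n * k" and l: "2 * y = n * l" using assms by (elim dvdE)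
  have "odd j" if "2 * z = n * j" "\<not> n dvd z" for j z
  proof
    assume "even j"
    then obtain i where "j = 2 * i" by blast
    then have "z = n * i" using that(1) by simp
    then show False using that(2) by simp
  qed
  then have "odd k" "odd l" using k l assms by auto
  then have "even (k - l)" by simp
  then obtain m where "k - l = 2 * m" by blast
  then have "n * (k - l) = 2 * (n * m)" by simp
  then have "x - y = n * m" using k l by (simp add: algebra_simps)
  then show ?thesis by simp
qed

text \<open>Extracts one equation from a sum of others: the first premise is a semiring identity
  that \<open>algebra\<close> proves without matching common terms.\<close>

lemma cancel: "a + x = b + y \<Longrightarrow> a = b \<Longrightarrow> x = y" for a b x y :: nat
  by simp

locale arc_transitive_hat = woolly_hat +
  fixes f g
  assumes f: "aut f" "f (A 0) = B 0" and g: "aut g" "g (A 0) = A 0" "g (A a) = B 0"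
begin

text \<open>The reflection pairs the four arcs that leave \<open>A 0\<close>, \<open>g\<close> joins
  the two pairs, and \<open>f\<close> carries them to the arcs that leave
  \<open>B 0\<close>.\<close>

lemma arc_uniform:
  assumes inv: "\<And>h v w. aut h \<Longrightarrow> v \<in> V \<Longrightarrow> w \<in> V \<Longrightarrow> F (h v) (h w) = F v w"
  shows "F (A 0) (B 0) = F (A 0) (A a)" "F (B 0) (C b) = F (A 0) (B 0)" "F (B 0) (C c) = F (A 0) (B 0)"
    "F (B 0) (C d) = F (A 0) (B 0)"
proof -
  have 1: "F (A 0) (B 0) = F (A 0) (A a)" using inv[OF g(1), of "A 0" "A a"] g by simp
  have "F (A 0) (A (- a)) = F (A 0) (A a)" "F (A 0) (C 0) = F (A 0) (B 0)"
    using inv[OF aut_reflection, of "A 0" "A a"] inv[OF aut_reflection, of "A 0" "B 0"] by simp_all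
  then have "F (A 0) w = F (A 0) (B 0)" if "w \<in> N (A 0)" for w using that 1 by (auto simp: N_A)
  then have "F (B 0) (f w) = F (A 0) (B 0)" if "w \<in> N (A 0)" for w
    using inv[OF f(1), of "A 0" w] that f(2) N_subset[of "A 0"] by auto
  then have "F (B 0) w = F (A 0) (B 0)" if "w \<in> N (B 0)" for w
    using that aut_N[OF f(1), of "A 0"] f(2) by auto
  then show "F (A 0) (B 0) = F (A 0) (A a)" "F (B 0) (C b) = F (A 0) (B 0)" "F (B 0) (C c) = F (A 0) (B 0)"
    "F (B 0) (C d) = F (A 0) (B 0)" using 1 by (auto simp: N_B)
qed

text \<open>A triangle on the edge from \<open>B 0\<close> to \<open>C x\<close> needs the common
  neighbour \<open>A 0 = A x\<close>, so \<open>x = 0\<close>. If every edge lay on a triangle, both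
  \<open>b\<close> and \<open>c\<close> would be 0.\<close>

lemma triangle_free: "\<not> n dvd 3 * a" "\<not> n dvd b" "\<not> n dvd c" "\<not> n dvd d"
proof -
  define F where "F v w \<longleftrightarrow> N v \<inter> N w = {}" for v w
  have "F (h v) (h w) = F v w" if h: "aut h" and vw: "v \<in> V" "w \<in> V" for h v w
  proof -
    have "inj_on h V" using h by (simp add: aut_def bij_betw_def)
    then have "h ` (N v \<inter> N w) = N (h v) \<inter> N (h w)"
      using aut_N[OF h] vw inj_on_image_Int[of h V "N v" "N w"] N_subset by simp
    then show ?thesis unfolding F_def by (metis image_is_empty)
  qed
  note u = arc_uniform[of F, OF this]
  have F_BC: "F (B 0) (C x) \<longleftrightarrow> \<not> n dvd x" if "x \<in> {b, c, d}" for x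
    by (auto simp: F_def N_B N_C v_eq_iff)
  have "F (A 0) (B 0)"
  proof (rule ccontr)
    assume "\<not> F (A 0) (B 0)"
    then have "n dvd b" "n dvd c" using u F_BC by auto
    then have "n dvd b - c" by simp
    then show False using bc by blast
  qed
  then show "\<not> n dvd b" "\<not> n dvd c" "\<not> n dvd d" using u F_BC by auto
  have "F (A 0) (A a)" using u \<open>F (A 0) (B 0)\<close> by simp
  moreover have "A (a + a) \<in> N (A a)" "A (- a) \<in> N (A 0)" by (simp_all add: N_A)
  ultimately have "A (a + a) \<noteq> A (- a)" unfolding F_def by auto
  then show "\<not> n dvd 3 * a" by (simp add: v_eq_iff)
qed

lemma R_zero: "R (0, 0, 0, 0) = 1"
  by (simp add: R_def)

lemma R_le: "R x \<le> 1"
  by (simp add: R_def)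

lemma cycle_equations:
  "R (6, 0, 0, 0) + 2 * (R (3, - 1, 0, 0) + R (3, 0, - 1, 0) + R (3, 0, 0, - 1) + R (3, 0, 0, 1) +
      R (3, 0, 1, 0) + R (3, 1, 0, 0)) + 2 * (R (2, - 1, 0, 1) + R (2, - 1, 1, 0) + R (2, 0, - 1, 1) +
      R (2, 0, 1, - 1) + R (2, 1, - 1, 0) + R (2, 1, 0, - 1)) = 2 * (R (0, 1, 1, 0) + R (0, 1, 0, 1) +
      R (0, 0, 1, 1)) + (R (0, 2, 0, 0) + R (0, 0, 2, 0) + R (0, 0, 0, 2))"
  "(\<Sum>x\<leftarrow>cycle_displacements 5 Xb. R x) = (\<Sum>x\<leftarrow>cycle_displacements 5 AB. R x)"
  "(\<Sum>x\<leftarrow>cycle_displacements 5 Xc. R x) = (\<Sum>x\<leftarrow>cycle_displacements 5 AB. R x)"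
  "(\<Sum>x\<leftarrow>cycle_displacements 5 Xd. R x) = (\<Sum>x\<leftarrow>cycle_displacements 5 AB. R x)"
proof -
  note u = arc_uniform[of cycles6, OF cycles6_aut]
  have "(\<Sum>x\<leftarrow>cycle_displacements 5 AB. R x) = (\<Sum>x\<leftarrow>cycle_displacements 5 AP. R x)"
    using u(1) cycles6_displacements[of AB] cycles6_displacements[of AP] by simp
  then show "R (6, 0, 0, 0) + 2 * (R (3, - 1, 0, 0) + R (3, 0, - 1, 0) + R (3, 0, 0, - 1) + R (3, 0, 0, 1) +
      R (3, 0, 1, 0) + R (3, 1, 0, 0)) + 2 * (R (2, - 1, 0, 1) + R (2, - 1, 1, 0) + R (2, 0, - 1, 1) +
      R (2, 0, 1, - 1) + R (2, 1, - 1, 0) + R (2, 1, 0, - 1)) = 2 * (R (0, 1, 1, 0) + R (0, 1, 0, 1) +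
      R (0, 0, 1, 1)) + (R (0, 2, 0, 0) + R (0, 0, 2, 0) + R (0, 0, 0, 2))"
    unfolding cycle_displacements_AB cycle_displacements_AP by simp
  show "(\<Sum>x\<leftarrow>cycle_displacements 5 Xb. R x) = (\<Sum>x\<leftarrow>cycle_displacements 5 AB. R x)"
    "(\<Sum>x\<leftarrow>cycle_displacements 5 Xc. R x) = (\<Sum>x\<leftarrow>cycle_displacements 5 AB. R x)"
    "(\<Sum>x\<leftarrow>cycle_displacements 5 Xd. R x) = (\<Sum>x\<leftarrow>cycle_displacements 5 AB. R x)"
    using u(2-) cycles6_displacements[of AB] cycles6_displacements[of Xb] cycles6_displacements[of Xc]
      cycles6_displacements[of Xd] by simp_all
qed

lemma arc_transitive_equations:
  shows "R (0, 1, 1, 0) + R (0, 1, 0, 1) + R (0, 0, 1, 1) = 1" "R (0, 2, 0, 0) + R (0, 0, 2, 0) +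
      R (0, 0, 0, 2) = 0" "R (6, 0, 0, 0) = 0" "R (3, - 1, 0, 0) + R (3, 0, - 1, 0) + R (3, 0, 0, - 1) +
      R (3, 0, 0, 1) + R (3, 0, 1, 0) + R (3, 1, 0, 0) + (R (2, - 1, 0, 1) + R (2, - 1, 1, 0) +
      R (2, 0, - 1, 1) + R (2, 0, 1, - 1) + R (2, 1, - 1, 0) + R (2, 1, 0, - 1)) = 1"
    "R (0, 0, 2, - 2) = 0"
    "2 + R (1, - 2, 0, 1) + R (1, - 2, 1, 0) + R (1, 2, - 1, 0) + R (1, 2, 0, - 1) = R (0, 0, 0, 2) +
        2 * R (0, 0, 1, 1) + R (0, 0, 2, 0) + R (0, 1, 0, 1) + R (0, 1, 1, 0) + R (1, 0, - 2, 1) +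
        R (1, 0, - 1, 2) + R (1, 0, 1, - 2) + R (1, 0, 2, - 1) + 2 * R (2, 0, - 1, 1) + 2 * R (2, 0, 1, - 1) +
        R (3, 0, - 1, 0) + R (3, 0, 0, - 1) + R (3, 0, 0, 1) + R (3, 0, 1, 0)"
    "2 + R (1, - 1, 2, 0) + R (1, 0, - 2, 1) + R (1, 0, 2, - 1) + R (1, 1, - 2, 0) = R (0, 0, 0, 2) +
        R (0, 0, 1, 1) + 2 * R (0, 1, 0, 1) + R (0, 1, 1, 0) + R (0, 2, 0, 0) + R (1, - 2, 0, 1) +
        R (1, - 1, 0, 2) + R (1, 1, 0, - 2) + R (1, 2, 0, - 1) + 2 * R (2, - 1, 0, 1) + 2 * R (2, 1, 0, - 1) +
        R (3, - 1, 0, 0) + R (3, 0, 0, - 1) + R (3, 0, 0, 1) + R (3, 1, 0, 0)"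
    "2 + R (1, - 1, 0, 2) + R (1, 0, - 1, 2) + R (1, 0, 1, - 2) + R (1, 1, 0, - 2) = R (0, 0, 1, 1) +
        R (0, 0, 2, 0) + R (0, 1, 0, 1) + 2 * R (0, 1, 1, 0) + R (0, 2, 0, 0) + R (1, - 2, 1, 0) +
        R (1, - 1, 2, 0) + R (1, 1, - 2, 0) + R (1, 2, - 1, 0) + 2 * R (2, - 1, 1, 0) + 2 * R (2, 1, - 1, 0) +
        R (3, - 1, 0, 0) + R (3, 0, - 1, 0) + R (3, 0, 1, 0) + R (3, 1, 0, 0)"
proof -
  let ?T1 = "R (3, - 1, 0, 0) + R (3, 0, - 1, 0) + R (3, 0, 0, - 1) + R (3, 0, 0, 1) + R (3, 0, 1, 0) +
      R (3, 1, 0, 0)" and ?T2 = "R (2, - 1, 0, 1) + R (2, - 1, 1, 0) + R (2, 0, - 1, 1) + R (2, 0, 1, - 1) +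
      R (2, 1, - 1, 0) + R (2, 1, 0, - 1)" and ?X = "R (0, 1, 1, 0) + R (0, 1, 0, 1) +
      R (0, 0, 1, 1)" and ?Y = "R (0, 2, 0, 0) + R (0, 0, 2, 0) + R (0, 0, 0, 2)"
  let ?ex = "3 * R (0, 0, 2, - 2) + R (0, 0, 3, - 3) + 3 * R (0, 1, - 3, 2) + 3 * R (0, 1, 2, - 3) +
      3 * R (0, 2, - 3, 1) + 3 * R (0, 2, - 2, 0) + 3 * R (0, 2, 0, - 2) + 3 * R (0, 2, 1, - 3) +
      R (0, 3, - 3, 0) + 3 * R (0, 3, - 2, - 1) + 3 * R (0, 3, - 1, - 2) + R (0, 3, 0, - 3)"
  note eq = cycle_equations[unfolded cycle_displacements_AB cycle_displacements_Xb cycle_displacements_Xc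
      cycle_displacements_Xd, simplified list.map sum_list.Cons sum_list.Nil R_zero]
  have X: "?X \<le> 1"
  proof -
    have "n dvd c - d" if "n dvd b + c" "n dvd b + d" using that by algebra
    moreover have "n dvd b - d" if "n dvd b + c" "n dvd c + d" using that by algebra
    moreover have "n dvd b - c" if "n dvd b + d" "n dvd c + d" using that by algebra
    ultimately show ?thesis using bc bd cd by (auto simp: R_def)
  qed
  have Y: "?Y \<le> 1"
    using half_unique[of n b c] half_unique[of n b d] half_unique[of n c d] triangle_free bc bd cd by (auto simp: R_def)
  \<comment> \<open>The constant 6 comes from displacement 0, the generic 6-cycles, which occurs
    twice in each of the tables for \<open>Xb\<close>, \<open>Xc\<close>, \<open>Xd\<close>. With
    \<open>?X\<close> and \<open>?Y\<close> at most 1 this forces \<open>?X = 1\<close>.\<close>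
  have sum: "6 * ?X + 3 * ?Y = 6 + R (6, 0, 0, 0) + 2 * (?ex)"
    by (rule cancel[OF _ arg_cong2[OF eq(1) arg_cong2[OF arg_cong2[OF eq(2,3), of "(+)"] eq(4), of "(+)"], of "(+)"]]) algebra
  have x1: "x = 1" if "6 * x + 3 * y = 6 + r + 2 * e" "x \<le> 1" "y \<le> 1" for x y r e :: nat
    using that by presburger
  have X1: "?X = 1" by (rule x1[OF sum X Y])
  show "?X = 1" by (rule X1)
  have t0: "2 * (p + q) + r = 2 + y" if "r + 2 * p + 2 * q = 2 * x + y" "x = 1" for p q r x y :: nat
    using that by presburger
  have T: "2 * (?T1 + ?T2) + R (6, 0, 0, 0) = 2 + ?Y" by (rule t0[OF eq(1) X1])
  have r1: "r = y" if "2 * t + r = 2 + y" "y \<le> 1" "r \<le> 1" for t r y :: nat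
    using that by presburger
  have eps: "R (6, 0, 0, 0) = ?Y" by (rule r1[OF T Y R_le])
  have t1: "t \<le> 1" if "2 * t + r = 2 + y" "y \<le> 1" for t r y :: nat
    using that by presburger
  have "R (6, 0, 0, 0) = 0"
  proof (rule ccontr)
    \<comment> \<open>Now \<open>3 * a\<close> and one of \<open>b\<close>, \<open>c\<close>,
      \<open>d\<close> are both the unique element of order 2. This element is its own negative, so
      two relations hold in \<open>?T1\<close>, although \<open>?T1 + ?T2\<close> is at most
      1.\<close>
    assume 6: "R (6, 0, 0, 0) \<noteq> 0"
    then have a6: "n dvd 2 * (3 * a)" by (simp add: R_def split: if_splits)
    have "n dvd 3 * a - x \<and> n dvd 3 * a + x" if "n dvd 2 * x" "\<not> n dvd x" for x
      using half_unique[OF a6 triangle_free(1) that] half_unique[OF a6 triangle_free(1), of "- x"] that by simp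
    note half = this
    have "?Y \<noteq> 0" using 6 eps by metis
    then have "R (0, 2, 0, 0) \<noteq> 0 \<or> R (0, 0, 2, 0) \<noteq> 0 \<or> R (0, 0, 0, 2) \<noteq> 0" by (metis add_0_left)
    then consider "n dvd 2 * b" | "n dvd 2 * c" | "n dvd 2 * d"
      by (auto simp: R_def split: if_splits)
    then have "R (3, - 1, 0, 0) = 1 \<and> R (3, 1, 0, 0) = 1 \<or> R (3, 0, - 1, 0) = 1 \<and> R (3, 0, 1, 0) = 1
      \<or> R (3, 0, 0, - 1) = 1 \<and> R (3, 0, 0, 1) = 1"
    proof cases
      case 1
      from half[OF this triangle_free(2)] show ?thesis by (simp add: R_def)
    next
      case 2
      from half[OF this triangle_free(3)] show ?thesis by (simp add: R_def)
    next
      case 3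
      from half[OF this triangle_free(4)] show ?thesis by (simp add: R_def)
    qed
    moreover have "p + q + r + s + t + u \<ge> 2" if "p = 1 \<and> u = 1 \<or> q = 1 \<and> t = 1 \<or> r = 1 \<and> s = 1"
      for p q r s t u :: nat using that by auto
    ultimately have "?T1 \<ge> 2" by metis
    moreover have "?T1 + ?T2 \<le> 1" by (rule t1[OF T Y])
    moreover have False if "t \<ge> 2" "t + s \<le> 1" for t s :: nat using that by presburger
    ultimately show False by blast
  qed
  have t2: "t = 1" if "2 * t + r = 2 + y" "r = 0" "y = 0" for t r y :: nat
    using that by presburger
  from \<open>R (6, 0, 0, 0) = 0\<close> show "R (6, 0, 0, 0) = 0" "?Y = 0" using eps by simp_all
  then show "?T1 + (?T2) = 1" by (intro t2[OF T])
  have e2: "e = 0" if "6 * x + 3 * y = 6 + r + 2 * e" "x = 1" "y = 0" for x y r e :: nat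
    using that by presburger
  have ex: "?ex = 0" by (rule e2[OF sum X1 \<open>?Y = 0\<close>])
  then have ex0: "R (0, 0, 2, - 2) = 0" "R (0, 0, 3, - 3) = 0" "R (0, 1, - 3, 2) = 0" "R (0, 1, 2, - 3) = 0"
      "R (0, 2, - 3, 1) = 0" "R (0, 2, - 2, 0) = 0" "R (0, 2, 0, - 2) = 0" "R (0, 2, 1, - 3) = 0"
      "R (0, 3, - 3, 0) = 0" "R (0, 3, - 2, - 1) = 0" "R (0, 3, - 1, - 2) = 0" "R (0, 3, 0, - 3) = 0"
    by simp_all
  show "R (0, 0, 2, - 2) = 0" by (rule ex0)
  have "R (0, 0, 0, 2) + 2 * R (0, 0, 1, 1) + R (0, 0, 2, 0) + R (0, 1, 0, 1) + R (0, 1, 1, 0) +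
      R (1, 0, - 2, 1) + R (1, 0, - 1, 2) + R (1, 0, 1, - 2) + R (1, 0, 2, - 1) + 2 * R (2, 0, - 1, 1) +
      2 * R (2, 0, 1, - 1) + R (3, 0, - 1, 0) + R (3, 0, 0, - 1) + R (3, 0, 0, 1) + R (3, 0, 1, 0) = (2 +
      R (1, - 2, 0, 1) + R (1, - 2, 1, 0) + R (1, 2, - 1, 0) + R (1, 2, 0, - 1)) + (2 * R (0, 0, 2, - 2) +
      R (0, 1, - 3, 2) + R (0, 1, 2, - 3) + 2 * R (0, 2, - 3, 1) + 2 * R (0, 2, - 2, 0) +
      2 * R (0, 2, 0, - 2) + 2 * R (0, 2, 1, - 3) + R (0, 3, - 3, 0) + 3 * R (0, 3, - 2, - 1) +
      3 * R (0, 3, - 1, - 2) + R (0, 3, 0, - 3))"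
    by (rule cancel[OF _ eq(2)]) algebra
  then show "2 + R (1, - 2, 0, 1) + R (1, - 2, 1, 0) + R (1, 2, - 1, 0) + R (1, 2, 0, - 1) = R (0, 0, 0, 2) +
      2 * R (0, 0, 1, 1) + R (0, 0, 2, 0) + R (0, 1, 0, 1) + R (0, 1, 1, 0) + R (1, 0, - 2, 1) +
      R (1, 0, - 1, 2) + R (1, 0, 1, - 2) + R (1, 0, 2, - 1) + 2 * R (2, 0, - 1, 1) + 2 * R (2, 0, 1, - 1) +
      R (3, 0, - 1, 0) + R (3, 0, 0, - 1) + R (3, 0, 0, 1) + R (3, 0, 1, 0)"
    by (simp only: ex0 mult_0_right add_0_left add_0_right)
  have "R (0, 0, 0, 2) + R (0, 0, 1, 1) + 2 * R (0, 1, 0, 1) + R (0, 1, 1, 0) + R (0, 2, 0, 0) +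
      R (1, - 2, 0, 1) + R (1, - 1, 0, 2) + R (1, 1, 0, - 2) + R (1, 2, 0, - 1) + 2 * R (2, - 1, 0, 1) +
      2 * R (2, 1, 0, - 1) + R (3, - 1, 0, 0) + R (3, 0, 0, - 1) + R (3, 0, 0, 1) + R (3, 1, 0, 0) = (2 +
      R (1, - 1, 2, 0) + R (1, 0, - 2, 1) + R (1, 0, 2, - 1) + R (1, 1, - 2, 0)) + (2 * R (0, 0, 2, - 2) +
      R (0, 0, 3, - 3) + 3 * R (0, 1, - 3, 2) + 2 * R (0, 1, 2, - 3) + 3 * R (0, 2, - 3, 1) +
      2 * R (0, 2, - 2, 0) + 2 * R (0, 2, 0, - 2) + R (0, 2, 1, - 3) + R (0, 3, - 3, 0) +
      2 * R (0, 3, - 2, - 1) + R (0, 3, - 1, - 2))"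
    by (rule cancel[OF _ eq(3)]) algebra
  then show "2 + R (1, - 1, 2, 0) + R (1, 0, - 2, 1) + R (1, 0, 2, - 1) + R (1, 1, - 2, 0) = R (0, 0, 0, 2) +
      R (0, 0, 1, 1) + 2 * R (0, 1, 0, 1) + R (0, 1, 1, 0) + R (0, 2, 0, 0) + R (1, - 2, 0, 1) +
      R (1, - 1, 0, 2) + R (1, 1, 0, - 2) + R (1, 2, 0, - 1) + 2 * R (2, - 1, 0, 1) + 2 * R (2, 1, 0, - 1) +
      R (3, - 1, 0, 0) + R (3, 0, 0, - 1) + R (3, 0, 0, 1) + R (3, 1, 0, 0)"
    by (simp only: ex0 mult_0_right add_0_left add_0_right)
  have "R (0, 0, 1, 1) + R (0, 0, 2, 0) + R (0, 1, 0, 1) + 2 * R (0, 1, 1, 0) + R (0, 2, 0, 0) +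
      R (1, - 2, 1, 0) + R (1, - 1, 2, 0) + R (1, 1, - 2, 0) + R (1, 2, - 1, 0) + 2 * R (2, - 1, 1, 0) +
      2 * R (2, 1, - 1, 0) + R (3, - 1, 0, 0) + R (3, 0, - 1, 0) + R (3, 0, 1, 0) + R (3, 1, 0, 0) = (2 +
      R (1, - 1, 0, 2) + R (1, 0, - 1, 2) + R (1, 0, 1, - 2) + R (1, 1, 0, - 2)) + (2 * R (0, 0, 2, - 2) +
      R (0, 0, 3, - 3) + 2 * R (0, 1, - 3, 2) + 3 * R (0, 1, 2, - 3) + R (0, 2, - 3, 1) +
      2 * R (0, 2, - 2, 0) + 2 * R (0, 2, 0, - 2) + 3 * R (0, 2, 1, - 3) + R (0, 3, - 2, - 1) +
      2 * R (0, 3, - 1, - 2) + R (0, 3, 0, - 3))"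
    by (rule cancel[OF _ eq(4)]) algebra
  then show "2 + R (1, - 1, 0, 2) + R (1, 0, - 1, 2) + R (1, 0, 1, - 2) + R (1, 1, 0, - 2) = R (0, 0, 1, 1) +
      R (0, 0, 2, 0) + R (0, 1, 0, 1) + 2 * R (0, 1, 1, 0) + R (0, 2, 0, 0) + R (1, - 2, 1, 0) +
      R (1, - 1, 2, 0) + R (1, 1, - 2, 0) + R (1, 2, - 1, 0) + 2 * R (2, - 1, 1, 0) + 2 * R (2, 1, - 1, 0) +
      R (3, - 1, 0, 0) + R (3, 0, - 1, 0) + R (3, 0, 1, 0) + R (3, 1, 0, 0)"
    by (simp only: ex0 mult_0_right add_0_left add_0_right)
qed

end

section \<open>The relation 3a = b\<close>

lemma dvd_cong_iff: "n dvd x - y \<Longrightarrow> n dvd x \<longleftrightarrow> n dvd y" for n x y :: int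
  by (metis diff_add_cancel dvd_add_left_iff dvd_add_right_iff)

lemma (in woolly_hat) path_weight:
  assumes "head e' (- dval (shift e')) = tail e 0"
  shows "npaths k (tail e 0) (head e 0) (tail e' (- dval (shift e'))) (tail e 0) = (\<Sum>x\<leftarrow>displacements k e e'. R x)"
  using npaths_displacements[of k e 0 e' "- dval (shift e')"] assms by (simp add: R_def)

lemma (in woolly_hat) path_weight_pos:
  assumes "head e' (- dval (shift e')) = tail e 0" "x \<in> set (displacements k e e')" "R x = 1"
  shows "0 < npaths k (tail e 0) (head e 0) (tail e' (- dval (shift e'))) (tail e 0)"
  unfolding path_weight[OF assms(1)] using assms(2,3) member_le_sum_list[of 1 "map R (displacements k e e')"] by force

context arc_transitive_hat
begin

lemma arc_transitive_perm:
  assumes "mset [b', c', d'] = mset [b, c, d]"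
  shows "arc_transitive_hat n a b' c' d' f g"
proof -
  note perm = woolly_hat_perm[OF woolly_hat_axioms assms]
  interpret W: woolly_hat n a b' c' d' by (rule perm(1))
  show ?thesis by unfold_locales (use f g perm(4) in simp_all)
qed

text \<open>The graph is the same; only the distinguished neighbour of \<open>A 0\<close> becomes
  \<open>A (- a)\<close>, which the reflection takes to \<open>A a\<close> before \<open>g\<close>
  acts.\<close>

lemma arc_transitive_neg: "arc_transitive_hat n (- a) b c d f (g \<circ> reflection)"
proof -
  interpret W: woolly_hat n "- a" b c d
    using n_ge a2 bc bd cd by unfold_locales simp_all
  have V: "W.V = V" by (simp add: W.V_def V_def WH_def)
  have "W.N v = N v" for v
  proof (cases "v \<in> V")
    case True
    then show ?thesis by (cases rule: V_cases) (auto simp: N_A N_B N_C W.N_A W.N_B W.N_C)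
  next
    case False
    then show ?thesis using E_in_V W.E_in_V V by (auto simp: N_def W.N_def)
  qed
  then have "W.aut = aut" by (simp add: fun_eq_iff W.aut_def aut_def V)
  then show ?thesis
    by unfold_locales (use f g aut_comp[OF g(1) aut_reflection] in simp_all)
qed

lemma displacements_AB_AP: "displacements 5 AB AP =
  [(3, 1, 0, 0), (2, 1, - 1, 0), (1, 2, - 1, 0), (1, 1, - 1, 1), (2, 1, 0, - 1), (1, 2, 0, - 1), (1, 1, 1, - 1),
   (3, 0, 1, 0), (2, - 1, 1, 0), (1, - 1, 2, 0), (1, - 1, 1, 1), (2, 0, 1, - 1), (1, 1, 1, - 1), (1, 0, 2, - 1),
   (3, 0, 0, 1), (2, - 1, 0, 1), (1, - 1, 1, 1), (1, - 1, 0, 2), (2, 0, - 1, 1), (1, 1, - 1, 1), (1, 0, - 1, 2)]"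
  by code_simp

text \<open>The assumed relation is the only one that \<open>arc_transitive_equations(4)\<close>
  permits, and it leaves \<open>c + d = 0\<close>, so every relation reduces to one between
  \<open>a\<close> and \<open>c\<close>. No 6-cycle then contains the 2-path from
  \<open>A (- a)\<close> by \<open>A 0\<close> to \<open>B 0\<close>, whereas every 2-path centred
  at \<open>B 0\<close> lies on one; \<open>f\<close> cannot map the former to the latter.\<close>

lemma no_triple_step_b: "\<not> n dvd 3 * a - b"
proof
  assume ab: "n dvd 3 * a - b"
  then have R1: "R (3, - 1, 0, 0) = 1" by (simp add: R_def)
  have z: "R (3, 0, - 1, 0) = 0" "R (3, 0, 0, - 1) = 0" "R (3, 0, 0, 1) = 0" "R (3, 0, 1, 0) = 0" "R (3, 1, 0, 0) = 0"
    "R (2, - 1, 0, 1) = 0" "R (2, - 1, 1, 0) = 0" "R (2, 0, - 1, 1) = 0" "R (2, 0, 1, - 1) = 0" "R (2, 1, - 1, 0) = 0"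
    "R (2, 1, 0, - 1) = 0"
    using arc_transitive_equations(4)[unfolded R1] by simp_all
  have y: "R (0, 2, 0, 0) = 0" "R (0, 0, 2, 0) = 0" "R (0, 0, 0, 2) = 0"
    using arc_transitive_equations(2) by simp_all
  have "\<not> n dvd b + c"
  proof
    assume "n dvd b + c"
    then have "n dvd 3 * a + c" using ab by algebra
    then show False using z by (simp add: R_def)
  qed
  moreover have "\<not> n dvd b + d"
  proof
    assume "n dvd b + d"
    then have "n dvd 3 * a + d" using ab by algebra
    then show False using z by (simp add: R_def)
  qed
  ultimately have cd': "n dvd c + d"
    using arc_transitive_equations(1) by (cases "n dvd c + d") (simp_all add: R_def)
  define D where "D k l = (of_bool (n dvd k * a + l * c) :: nat)" for k l
  have red: "R (p, q, r, s) = D (p + 3 * q) (r - s)" for p q r s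
  proof -
    have "n dvd (p * a + q * b + r * c + s * d) - ((p + 3 * q) * a + (r - s) * c)"
      using dvd_combine[OF ab cd', of _ "- q" s] by (simp add: algebra_simps)
    from dvd_cong_iff[OF this] show ?thesis by (simp add: R_def D_def)
  qed
  have neg: "D (- k) l = D k (- l)" for k l
  proof -
    have "- k * a + l * c = - (k * a + - l * c)" by simp
    then show ?thesis by (simp only: D_def dvd_minus_iff)
  qed
  have [simp]: "D (- numeral k) l = D (numeral k) (- l)" "D (- 1) l = D 1 (- l)" for k l
    by (simp_all only: neg)
  have D00: "D 0 0 = 1" by (simp add: D_def)
  note zD = z[unfolded red, simplified]
  note yD = y[unfolded red, simplified]
  have D04: "D 0 4 = 0" using arc_transitive_equations(5)[unfolded red] by simp
  have c2: "\<not> n dvd 2 * c" using y by (simp add: R_def)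
  have eqs: "D 7 1 + D 7 (- 1) = 2 * (D 1 3 + D 1 (- 3))"
    "D 1 3 + D 1 (- 3) + D 4 (- 2) = D 4 2 + D 7 1"
    using arc_transitive_equations(6,7)[unfolded red, simplified] zD yD D00 R1[unfolded red, simplified] by simp_all
  have "D 7 1 = 0 \<or> D 7 (- 1) = 0"
  proof (rule ccontr)
    assume "\<not> ?thesis"
    then have "n dvd 7 * a + c" "n dvd 7 * a - c" by (simp_all add: D_def split: if_splits)
    then have "n dvd 2 * c" by algebra
    then show False using c2 by blast
  qed
  moreover have le: "D k l \<le> 1" for k l by (simp add: D_def)
  moreover have "p = 0 \<and> q = 0 \<and> r = 0 \<and> s = 0" if "p = 0 \<or> q = 0" "p \<le> 1" "q \<le> 1" "p + q = 2 * (r + s)"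
    for p q r s :: nat using that by presburger
  ultimately have u: "D 7 1 = 0" "D 7 (- 1) = 0" "D 1 3 = 0" "D 1 (- 3) = 0"
    using eqs(1) by blast+
  have "D 4 2 = 0 \<or> D 4 (- 2) = 0"
  proof (rule ccontr)
    assume "\<not> ?thesis"
    then have "n dvd 4 * a + 2 * c" "n dvd 4 * a - 2 * c" by (simp_all add: D_def split: if_splits)
    then have "n dvd 4 * c" by algebra
    then show False using D04 by (simp add: D_def)
  qed
  then have v: "D 4 2 = 0" "D 4 (- 2) = 0" using eqs(2) u by simp_all
  have "D 6 0 = 0" using arc_transitive_equations(3)[unfolded red] by simp
  moreover have "D 2 0 = 0" using a2 by (simp add: D_def)
  \<comment> \<open>Walks that start with the arc from \<open>A 0\<close> to \<open>B 0\<close> and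
    end with the arc from \<open>A (- a)\<close> to \<open>A 0\<close>: these are the 6-cycles
    through the 2-path.\<close>
  ultimately have "npaths 5 (A 0) (B 0) (A (- a)) (A 0) = 0"
    using path_weight[of AP AB 5] by (simp add: displacements_AB_AP red zD u v)
  then have zero: "npaths 5 (B 0) (f (B 0)) (f (A (- a))) (B 0) = 0"
    using npaths_aut[OF f(1), of "A 0" "B 0" "A (- a)" "A 0" 5] f(2) by simp
  have pos: "0 < npaths 5 (B 0) w u (B 0)" if "u \<in> N (B 0)" "w \<in> N (B 0)" "u \<noteq> w" for u w
  proof -
    \<comment> \<open>Each pair of neighbours of \<open>B 0\<close> has its own witness:
      \<open>3 * a = b\<close> for \<open>A 0\<close> and \<open>C b\<close>,
      \<open>c + d = 0\<close> for \<open>A 0\<close> with \<open>C c\<close> or \<open>C d\<close>,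
      the generic 6-cycle for two C-vertices.\<close>
    have R: "R (3, - 1, 0, 0) = 1" "R (- 3, 1, 0, 0) = 1" "R (0, 0, 1, 1) = 1" "R (0, 0, - 1, - 1) = 1"
        "R (0, 0, 0, 0) = 1"
      using R1 D00 by (simp_all add: red)
    have m: "(3, - 1, 0, 0) \<in> set (displacements 5 BA Yb)" "(0, 0, - 1, - 1) \<in> set (displacements 5 BA Yc)"
      "(0, 0, - 1, - 1) \<in> set (displacements 5 BA Yd)" "(- 3, 1, 0, 0) \<in> set (displacements 5 Xb AB)"
      "(0, 0, 0, 0) \<in> set (displacements 5 Xb Yc)" "(0, 0, 0, 0) \<in> set (displacements 5 Xb Yd)"
      "(0, 0, 1, 1) \<in> set (displacements 5 Xc AB)"
      "(0, 0, 0, 0) \<in> set (displacements 5 Xc Yb)" "(0, 0, 0, 0) \<in> set (displacements 5 Xc Yd)"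
      "(0, 0, 1, 1) \<in> set (displacements 5 Xd AB)"
      "(0, 0, 0, 0) \<in> set (displacements 5 Xd Yb)" "(0, 0, 0, 0) \<in> set (displacements 5 Xd Yc)"
      by code_simp+
    note p = path_weight_pos[OF _ m(1) R(1), simplified] path_weight_pos[OF _ m(2) R(4), simplified]
      path_weight_pos[OF _ m(3) R(4), simplified] path_weight_pos[OF _ m(4) R(2), simplified]
      path_weight_pos[OF _ m(5) R(5), simplified] path_weight_pos[OF _ m(6) R(5), simplified]
      path_weight_pos[OF _ m(7) R(3), simplified] path_weight_pos[OF _ m(8) R(5), simplified]
      path_weight_pos[OF _ m(9) R(5), simplified] path_weight_pos[OF _ m(10) R(3), simplified]
      path_weight_pos[OF _ m(11) R(5), simplified] path_weight_pos[OF _ m(12) R(5), simplified]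
    show ?thesis using that p by (auto simp: N_B)
  qed
  have "f (B 0) \<in> N (B 0)" "f (A (- a)) \<in> N (B 0)" "f (A (- a)) \<noteq> f (B 0)"
    using aut_N[OF f(1), of "A 0"] f by (auto simp: N_A aut_inj)
  from pos[OF this(2,1,3)] zero show False by simp
qed

lemma no_triple_step: "\<not> n dvd 3 * a - b" "\<not> n dvd 3 * a - c" "\<not> n dvd 3 * a - d"
  "\<not> n dvd 3 * a + b" "\<not> n dvd 3 * a + c" "\<not> n dvd 3 * a + d"
proof -
  interpret c: arc_transitive_hat n a c b d f g by (rule arc_transitive_perm) simp
  interpret d: arc_transitive_hat n a d b c f g by (rule arc_transitive_perm) simp
  interpret m: arc_transitive_hat n "- a" b c d f "g \<circ> reflection" by (rule arc_transitive_neg)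
  interpret mc: arc_transitive_hat n "- a" c b d f "g \<circ> reflection" by (rule m.arc_transitive_perm) simp
  interpret md: arc_transitive_hat n "- a" d b c f "g \<circ> reflection" by (rule m.arc_transitive_perm) simp
  show "\<not> n dvd 3 * a - b" "\<not> n dvd 3 * a - c" "\<not> n dvd 3 * a - d"
    by (rule no_triple_step_b c.no_triple_step_b d.no_triple_step_b)+
  have "n dvd 3 * (- a) - x" if "n dvd 3 * a + x" for x using that by algebra
  then show "\<not> n dvd 3 * a + b" "\<not> n dvd 3 * a + c" "\<not> n dvd 3 * a + d"
    using m.no_triple_step_b mc.no_triple_step_b md.no_triple_step_b by blast+
qed

end

section \<open>The relation d = 2a + b\<close>

context arc_transitive_hat
begin

text \<open>Again the assumption exhausts \<open>arc_transitive_equations(4)\<close>. Exactly one of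
  \<open>b + c\<close>, \<open>b + d\<close>, \<open>c + d\<close> vanishes, and the first and last
  choice reduce the equations to two variables, where they conflict. Given \<open>b + d = 0\<close>,
  equation (7) asks for two of four relations; any two that avoid \<open>a + b = 2 * c\<close> imply
  a forbidden one.\<close>

lemma half_turn:
  assumes ab: "n dvd 2 * a + b - d"
  shows "n dvd b + d" "n dvd a + b - 2 * c"
proof -
  have R1: "R (2, 1, 0, - 1) = 1" using ab by (simp add: R_def)
  have t: "R (3, - 1, 0, 0) = 0" "R (3, 0, - 1, 0) = 0" "R (3, 0, 0, - 1) = 0" "R (3, 0, 0, 1) = 0"
    "R (3, 0, 1, 0) = 0" "R (3, 1, 0, 0) = 0"
    using no_triple_step by (simp_all add: R_def)
  have z: "R (2, - 1, 0, 1) = 0" "R (2, - 1, 1, 0) = 0" "R (2, 0, - 1, 1) = 0" "R (2, 0, 1, - 1) = 0"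
      "R (2, 1, - 1, 0) = 0"
    using arc_transitive_equations(4)[unfolded R1] by simp_all
  have y: "R (0, 2, 0, 0) = 0" "R (0, 0, 2, 0) = 0" "R (0, 0, 0, 2) = 0"
    using arc_transitive_equations(2) by simp_all
  have not_bc: "\<not> n dvd b + c"
  proof
    assume bc': "n dvd b + c"
    then have Rbc: "R (0, 1, 1, 0) = 1" by (simp add: R_def)
    have x: "R (0, 1, 0, 1) = 0" "R (0, 0, 1, 1) = 0" using arc_transitive_equations(1)[unfolded Rbc] by simp_all
    define D where "D k l = (of_bool (n dvd k * a + l * b) :: nat)" for k l
    have red: "R (p, q, r, s) = D (p + 2 * s) (q - r + s)" for p q r s
    proof -
      have "n dvd (p * a + q * b + r * c + s * d) - ((p + 2 * s) * a + (q - r + s) * b)"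
        using dvd_combine[OF ab bc', of _ "- s" r] by (simp add: algebra_simps)
      from dvd_cong_iff[OF this] show ?thesis by (simp add: R_def D_def)
    qed
    have neg: "D (- k) l = D k (- l)" for k l
    proof -
      have "- k * a + l * b = - (k * a + - l * b)" by simp
      then show ?thesis by (simp only: D_def dvd_minus_iff)
    qed
    have [simp]: "D (- numeral k) l = D (numeral k) (- l)" "D (- 1) l = D 1 (- l)" for k l
      by (simp_all only: neg)
    have le: "D k l \<le> 1" for k l by (simp add: D_def)
    note D_vals = t[unfolded red, simplified] z[unfolded red, simplified] x[unfolded red, simplified]
      y[unfolded red, simplified] Rbc[unfolded red, simplified] R1[unfolded red, simplified]
    have "2 * D 1 3 + D 1 (- 3) + D 3 3 = 1"
      using arc_transitive_equations(7)[unfolded red, simplified] by (simp add: D_vals)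
    moreover have "2 * D 1 3 + 2 * D 1 (- 3) = D 5 3 + D 3 3"
      using arc_transitive_equations(8)[unfolded red, simplified] by (simp add: D_vals)
    moreover have False if "2 * p + q + r = 1" "2 * p + 2 * q = s + r" "s \<le> 1" for p q r s :: nat
      using that by (cases p; cases q) auto
    ultimately show False using le by blast
  qed
  have not_cd: "\<not> n dvd c + d"
  proof
    assume cd': "n dvd c + d"
    then have Rcd: "R (0, 0, 1, 1) = 1" by (simp add: R_def)
    have x: "R (0, 1, 0, 1) = 0" "R (0, 1, 1, 0) = 0" using arc_transitive_equations(1)[unfolded Rcd] by simp_all
    define D where "D k l = (of_bool (n dvd k * a + l * d) :: nat)" for k l
    have red: "R (p, q, r, s) = D (p - 2 * q) (q - r + s)" for p q r s
    proof -
      have "n dvd (p * a + q * b + r * c + s * d) - ((p - 2 * q) * a + (q - r + s) * d)"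
        using dvd_combine[OF ab cd', of _ q r] by (simp add: algebra_simps)
      from dvd_cong_iff[OF this] show ?thesis by (simp add: R_def D_def)
    qed
    have neg: "D (- k) l = D k (- l)" for k l
    proof -
      have "- k * a + l * d = - (k * a + - l * d)" by simp
      then show ?thesis by (simp only: D_def dvd_minus_iff)
    qed
    have [simp]: "D (- numeral k) l = D (numeral k) (- l)" "D (- 1) l = D 1 (- l)" for k l
      by (simp_all only: neg)
    have le: "D k l \<le> 1" for k l by (simp add: D_def)
    note D_vals = t[unfolded red, simplified] z[unfolded red, simplified] x[unfolded red, simplified]
      y[unfolded red, simplified] Rcd[unfolded red, simplified] R1[unfolded red, simplified]
    have "2 * D 1 (- 3) + D 3 (- 3) + D 1 3 = 1"
      using arc_transitive_equations(7)[unfolded red, simplified] by (simp add: D_vals)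
    moreover have "2 * D 1 3 + 2 * D 1 (- 3) = D 5 (- 3) + D 3 (- 3)"
      using arc_transitive_equations(6)[unfolded red, simplified] by (simp add: D_vals)
    moreover have False if "2 * p + q + r = 1" "2 * r + 2 * p = s + q" "s \<le> 1" for p q r s :: nat
      using that by (cases p; cases r) auto
    ultimately show False using le by blast
  qed
  show bd': "n dvd b + d"
    using arc_transitive_equations(1) not_bc not_cd by (cases "n dvd b + d") (simp_all add: R_def)
  have "n dvd a - 2 * b + d \<Longrightarrow> n dvd 3 * a - b" "n dvd a + 2 * b - d \<Longrightarrow> n dvd 3 * a - d"
    "n dvd a - b + 2 * d \<Longrightarrow> n dvd 3 * a + d" "n dvd a + b - 2 * d \<Longrightarrow> n dvd 3 * a + b"
    using ab by algebra+
  then have s: "R (1, - 2, 0, 1) = 0" "R (1, 2, 0, - 1) = 0" "R (1, - 1, 0, 2) = 0" "R (1, 1, 0, - 2) = 0"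
    using no_triple_step by (auto simp: R_def algebra_simps)
  have x: "R (0, 1, 0, 1) = 1" "R (0, 1, 1, 0) = 0" "R (0, 0, 1, 1) = 0"
    using bd' not_bc not_cd by (simp_all add: R_def)
  have eq: "R (1, - 1, 2, 0) + R (1, 0, - 2, 1) + R (1, 0, 2, - 1) + R (1, 1, - 2, 0) = 2"
    using arc_transitive_equations(7) by (simp add: s t x y z R1)
  have y': "\<not> n dvd 2 * b" "\<not> n dvd 2 * a + b + (2 * a + b)" "\<not> n dvd 2 * c"
  proof -
    show "\<not> n dvd 2 * b" "\<not> n dvd 2 * c" using y by (simp_all add: R_def)
    have "\<not> n dvd 2 * d" using y by (simp_all add: R_def)
    moreover have "n dvd 2 * d" if "n dvd 2 * a + b + (2 * a + b)" using that ab by algebra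
    ultimately show "\<not> n dvd 2 * a + b + (2 * a + b)" by blast
  qed
  have a4: "\<not> n dvd 4 * a"
  proof
    assume "n dvd 4 * a"
    then have "n dvd 2 * a - b + d" using ab by algebra
    then show False using z(1) by (simp add: R_def)
  qed
  show "n dvd a + b - 2 * c"
  proof (rule ccontr)
    assume 2: "\<not> ?thesis"
    then have R2: "R (1, 1, - 2, 0) = 0" by (simp add: R_def)
    have "p = 1 \<and> q = 1 \<or> p = 1 \<and> r = 1 \<or> q = 1 \<and> r = 1" if "p + q + r + 0 = 2" "p \<le> 1" "q \<le> 1" "r \<le> 1"
      for p q r :: nat using that by presburger
    from this[OF eq[unfolded R2] R_le R_le R_le]
    consider "n dvd a - b + 2 * c" "n dvd a - 2 * c + d" | "n dvd a - b + 2 * c" "n dvd a + 2 * c - d"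
      | "n dvd a - 2 * c + d" "n dvd a + 2 * c - d"
      unfolding R_def of_bool_eq_1_iff dval.simps by fastforce
    then show False
    proof cases
      case 1
      then have "n dvd 2 * a - b + d" by algebra
      then show False using z(1) by (simp add: R_def)
    next
      case 2
      then have "n dvd 2 * b" using bd' ab by algebra
      then show False using y' by blast
    next
      case 3
      then have "n dvd 2 * a" by algebra
      then show False using a2 by blast
    qed
  qed
qed

end

text \<open>On the four neighbours of \<open>A 0\<close> the stabiliser is transitive and contains the double transposition induced by the
  reflection; counting the pairs that satisfy \<open>F\<close> at \<open>A a\<close> and at \<open>B 0\<close> isolates the two pairs fixed by it.\<close>

lemma (in arc_transitive_hat) two_path_balance:
  assumes inv: "\<And>h u v w. aut h \<Longrightarrow> u \<in> V \<Longrightarrow> v \<in> V \<Longrightarrow> w \<in> V \<Longrightarrow> F (h u) (h v) (h w) \<longleftrightarrow> F u v w"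
    and sym: "\<And>u v w. F u v w \<longleftrightarrow> F w v u"
  shows "F (A (- a)) (A 0) (A a) \<longleftrightarrow> F (B 0) (A 0) (C 0)"
proof -
  define K where "K v w = (\<Sum>u\<in>N v - {w}. of_bool (F u v w) :: nat)" for v w
  have "K (h v) (h w) = K v w" if "aut h" "v \<in> V" "w \<in> V" for h v w
    unfolding K_def using that inv by (intro neighbour_sum_aut) auto
  from arc_uniform(1)[of K, OF this] have K: "K (A 0) (B 0) = K (A 0) (A a)" .
  have n1: "N (A 0) - {B 0} = {A a, A (- a), C 0}" "N (A 0) - {A a} = {A (- a), B 0, C 0}" "A a \<noteq> A (- a)"
    using a2 by (auto simp: N_A v_eq_iff)
  have "K (A 0) (B 0) = of_bool (F (A a) (A 0) (B 0)) + of_bool (F (A (- a)) (A 0) (B 0)) + of_bool (F (C 0) (A 0) (B 0))"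
    "K (A 0) (A a) = of_bool (F (A (- a)) (A 0) (A a)) + of_bool (F (B 0) (A 0) (A a)) + of_bool (F (C 0) (A 0) (A a))"
    unfolding K_def n1(1,2) using n1(3) by simp_all
  moreover have "F (C 0) (A 0) (A a) \<longleftrightarrow> F (B 0) (A 0) (A (- a))"
    using inv[OF aut_reflection, of "C 0" "A 0" "A a"] by simp
  ultimately have "of_bool (F (C 0) (A 0) (B 0)) = (of_bool (F (A (- a)) (A 0) (A a)) :: nat)"
    using K sym[of "A a" _ "B 0"] sym[of "A (- a)" _ "B 0"] by simp
  then show ?thesis using sym[of "C 0" _ "B 0"] by (simp add: of_bool_eq_iff)
qed

section \<open>Closed lines of length 12\<close>

context woolly_hat
begin

text \<open>A closed non-backtracking walk of length 12 none of whose 3-arcs lies on a 6-cycle.\<close>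

definition line12 :: "wh_vertex \<Rightarrow> wh_vertex \<Rightarrow> wh_vertex \<Rightarrow> bool" where
  "line12 u v w \<longleftrightarrow> (\<exists>s::nat \<Rightarrow> wh_vertex. s 0 = u \<and> s 1 = v \<and> s 2 = w \<and> s 12 = u \<and>
     (\<forall>i. s i \<in> V \<and> s (Suc i) \<in> N (s i) \<and> s (i + 2) \<noteq> s i \<and>
       npaths 4 (s (i + 2)) (s (i + 3)) (s i) (s (i + 1)) = 0))"

lemma line12_aut_image:
  assumes h: "aut h" and "line12 u v w"
  shows "line12 (h u) (h v) (h w)"
proof -
  from assms(2) obtain s :: "nat \<Rightarrow> wh_vertex" where s: "s 0 = u" "s 1 = v" "s 2 = w" "s 12 = u"
    and V: "\<And>i. s i \<in> V" and i: "\<And>i. s (Suc i) \<in> N (s i)" "\<And>i. s (i + 2) \<noteq> s i"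
      "\<And>i. npaths 4 (s (i + 2)) (s (i + 3)) (s i) (s (i + 1)) = 0"
    unfolding line12_def by (elim exE conjE) metis
  show ?thesis unfolding line12_def
    by (rule exI[of _ "\<lambda>i. h (s i)"]) (use s V i h in \<open>simp add: aut_V aut_adj aut_inj npaths_aut\<close>)
qed

lemma line12_aut:
  assumes h: "aut h" and V: "u \<in> V" "v \<in> V" "w \<in> V"
  shows "line12 (h u) (h v) (h w) \<longleftrightarrow> line12 u v w"
proof
  obtain k where k: "aut k" "\<And>v. v \<in> V \<Longrightarrow> k (h v) = v" using aut_inv[OF h] by metis
  show "line12 u v w" if "line12 (h u) (h v) (h w)"
    using line12_aut_image[OF k(1) that] k(2) V by simp
qed (rule line12_aut_image[OF h])

text \<open>Three vertical steps shift the index by \<open>- c\<close>, so the line closes after 12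
  steps when \<open>4 * c = 0\<close>. Up to rotation it has three kinds of 3-arcs, and a 6-cycle
  through any of them requires one of the relations excluded by \<open>X\<close> or by distinctness
  of the parameters, or \<open>b\<close>, \<open>c\<close>, \<open>d\<close> related as in
  \<open>disp\<close>.\<close>

lemma line12_vertical:
  assumes X: "\<not> n dvd b + c" "\<not> n dvd c + d" "\<not> n dvd 2 * c" "\<not> n dvd 3 * a - c" "\<not> n dvd 3 * a + c"
    and c4: "n dvd 4 * c"
  shows "line12 (B 0) (A 0) (C 0)"
proof -
  have disp: "displacements 4 Yc BA = [(0, - 1, - 1, 0), (0, 0, - 2, 0), (0, 0, - 1, - 1)]"
    "displacements 4 BA AC = [(3, 0, 0, 0), (- 3, 0, 0, 0), (0, - 1, 0, 0), (0, 0, - 1, 0), (0, 0, 0, - 1)]"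
    "displacements 4 AC Yc = [(0, - 1, - 1, 0), (0, 0, - 2, 0), (0, 0, - 1, - 1)]"
    by code_simp+
  have X': "\<not> n dvd - b - c" "\<not> n dvd - c - d" "\<not> n dvd - (2 * c)" "\<not> n dvd - c - b" "\<not> n dvd - c - c" "\<not> n dvd - c + 3 * a"
     "\<not> n dvd 3 * a - c" "\<not> n dvd - c - 3 * a" "\<not> n dvd - (3 * a) - c" "\<not> n dvd - d - c"
  proof -
    have "n dvd x \<longleftrightarrow> n dvd y" if "x = - y \<or> x = y" for x y using that by auto
    note e = this
    show "\<not> n dvd - b - c" "\<not> n dvd - c - b" using e[of "- b - c" "b + c"] e[of "- c - b" "b + c"] X(1) by simp_all
    show "\<not> n dvd - c - d" "\<not> n dvd - d - c" using e[of "- c - d" "c + d"] e[of "- d - c" "c + d"] X(2) by simp_all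
    show "\<not> n dvd - (2 * c)" "\<not> n dvd - c - c" using e[of "- c - c" "2 * c"] X(3) by simp_all
    show "\<not> n dvd - c + 3 * a" "\<not> n dvd 3 * a - c" using X(4) by simp_all
    show "\<not> n dvd - c - 3 * a" "\<not> n dvd - (3 * a) - c"
      using e[of "- c - 3 * a" "3 * a + c"] e[of "- (3 * a) - c" "3 * a + c"] X(5) by simp_all
  qed
  have free: "npaths 4 (C x) (B (x - c)) (B x) (A x) = 0" "npaths 4 (B (x - c)) (A (x - c)) (A x) (C x) = 0"
    "npaths 4 (A (x - c)) (C (x - c)) (C x) (B (x - c)) = 0" for x
    using npaths_displacements[of 4 Yc x BA x] npaths_displacements[of 4 BA "x - c" AC x]
      npaths_displacements[of 4 AC "x - c" Yc x] X X' by (simp_all add: disp)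
  define s where "s i = (if i mod 3 = 0 then B else if i mod 3 = 1 then A else C) (- (int (i div 3) * c))" for i :: nat
  have s3: "s (3 * k) = B (- (int k * c))" "s (3 * k + 1) = A (- (int k * c))" "s (3 * k + 2) = C (- (int k * c))"
    "s (3 * k + 3) = B (- (int k * c) - c)" "s (3 * k + 4) = A (- (int k * c) - c)" "s (3 * k + 5) = C (- (int k * c) - c)" for k
  proof -
    have "(3 * k + 1) div 3 = k" "(3 * k + 2) div 3 = k" "(3 * k + 3) div 3 = k + 1" "(3 * k + 4) div 3 = k + 1" "(3 * k + 5) div 3 = k + 1"
      "(3 * k + 1) mod 3 = 1" "(3 * k + 2) mod 3 = 2" "(3 * k + 3) mod 3 = 0" "(3 * k + 4) mod 3 = 1" "(3 * k + 5) mod 3 = 2"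
      by presburger+
    then show "s (3 * k) = B (- (int k * c))" "s (3 * k + 1) = A (- (int k * c))" "s (3 * k + 2) = C (- (int k * c))"
      "s (3 * k + 3) = B (- (int k * c) - c)" "s (3 * k + 4) = A (- (int k * c) - c)" "s (3 * k + 5) = C (- (int k * c) - c)"
      unfolding s_def by (simp_all add: v_eq_iff algebra_simps)
  qed
  have "s i \<in> V \<and> s (Suc i) \<in> N (s i) \<and> s (i + 2) \<noteq> s i \<and> npaths 4 (s (i + 2)) (s (i + 3)) (s i) (s (i + 1)) = 0" for i
  proof -
    have "\<exists>k. i = 3 * k \<or> i = 3 * k + 1 \<or> i = 3 * k + 2" by presburger
    then consider k where "i = 3 * k" | k where "i = 3 * k + 1" | k where "i = 3 * k + 2" by blast
    then show ?thesis
    proof cases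
      case (1 k)
      let ?x = "- (int k * c)"
      have "i = 3 * k" "Suc i = 3 * k + 1" "i + 1 = 3 * k + 1" "i + 2 = 3 * k + 2" "i + 3 = 3 * k + 3" using 1 by simp_all
      then have "s i = B ?x" "s (Suc i) = A ?x" "s (i + 1) = A ?x" "s (i + 2) = C ?x" "s (i + 3) = B (?x - c)"
        by (simp_all only: s3)
      then show ?thesis using free[of ?x] by (simp only: N_B in_V v_distinct) simp
    next
      case (2 k)
      let ?x = "- (int k * c)"
      have "i = 3 * k + 1" "Suc i = 3 * k + 2" "i + 1 = 3 * k + 2" "i + 2 = 3 * k + 3" "i + 3 = 3 * k + 4" using 2 by simp_all
      then have "s i = A ?x" "s (Suc i) = C ?x" "s (i + 1) = C ?x" "s (i + 2) = B (?x - c)" "s (i + 3) = A (?x - c)"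
        by (simp_all only: s3)
      then show ?thesis using free[of ?x] by (simp only: N_A in_V v_distinct) simp
    next
      case (3 k)
      let ?x = "- (int k * c)"
      have "i = 3 * k + 2" "Suc i = 3 * k + 3" "i + 1 = 3 * k + 3" "i + 2 = 3 * k + 4" "i + 3 = 3 * k + 5" using 3 by simp_all
      then have "s i = C ?x" "s (Suc i) = B (?x - c)" "s (i + 1) = B (?x - c)" "s (i + 2) = A (?x - c)" "s (i + 3) = C (?x - c)"
        by (simp_all only: s3)
      then show ?thesis using free[of ?x] by (simp only: N_C in_V v_distinct) simp
    qed
  qed
  moreover have "s 0 = B 0" "s 1 = A 0" "s 2 = C 0" using s3[of 0] by (simp_all add: numeral_2_eq_2)
  moreover have "s 12 = B 0" using s3(1)[of 4] c4 by (simp add: v_eq_iff)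
  ultimately show ?thesis unfolding line12_def by blast
qed

text \<open>After two A-steps, a turn to a B- or C-vertex gives a 3-arc on a 6-cycle, by the
  relation \<open>ab\<close>. So the line has to go straight on through A-vertices, and closing
  after 12 steps means \<open>12 * a = 0\<close>.\<close>

lemma line12_horizontal:
  assumes ab: "n dvd 2 * a + b - d" and line: "line12 (A (- a)) (A 0) (A a)"
  shows "n dvd 12 * a"
proof -
  \<comment> \<open>The first walk is \<open>A y\<close>, \<open>B y\<close>,
    \<open>C (y + b)\<close>, \<open>B (y + b - d)\<close>, \<open>A (y - 2 * a)\<close>,
    \<open>A (y - a)\<close>, as \<open>b - d = - 2 * a\<close>; the second leaves through
    \<open>C y\<close> and uses \<open>d\<close> before \<open>b\<close>.\<close>
  have m: "(1, 1, 0, - 1) \<in> set (displacements 4 AB AP)" "(1, 1, 0, - 1) \<in> set (displacements 4 AC AP)"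
    by code_simp+
  have cyc: "npaths 4 (A y) (B y) (A (y - 2 * a)) (A (y - a)) \<noteq> 0" "npaths 4 (A y) (C y) (A (y - 2 * a)) (A (y - a)) \<noteq> 0" for y
  proof -
    have *: "npaths 4 (tail e y) (head e y) (tail AP (y - 2 * a)) (head AP (y - 2 * a)) \<noteq> 0"
      if "(1, 1, 0, - 1) \<in> set (displacements 4 e AP)" for e
    proof -
      let ?g = "\<lambda>x. of_bool (n dvd y - (y - 2 * a) - dval (shift AP) + dval x) :: nat"
      have "?g (1, 1, 0, - 1) = 1" using ab by (simp add: algebra_simps)
      then have "1 \<in> set (map ?g (displacements 4 e AP))"
        unfolding set_map by (rule image_eqI[OF _ that, OF sym])
      then have "1 \<le> sum_list (map ?g (displacements 4 e AP))" by (rule member_le_sum_list) simp_all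
      then show ?thesis unfolding npaths_displacements by linarith
    qed
    show "npaths 4 (A y) (B y) (A (y - 2 * a)) (A (y - a)) \<noteq> 0" "npaths 4 (A y) (C y) (A (y - 2 * a)) (A (y - a)) \<noteq> 0"
      using *[OF m(1)] *[OF m(2)] by simp_all
  qed
  from line obtain s :: "nat \<Rightarrow> wh_vertex" where s: "s 0 = A (- a)" "s 1 = A 0" "s 2 = A a" "s 12 = A (- a)"
    and i: "\<And>i. s (Suc i) \<in> N (s i)" "\<And>i. s (i + 2) \<noteq> s i"
      "\<And>i. npaths 4 (s (i + 2)) (s (i + 3)) (s i) (s (i + 1)) = 0"
    unfolding line12_def by (elim exE conjE) metis
  have "s i = A ((int i - 1) * a) \<and> s (i + 1) = A (int i * a) \<and> s (i + 2) = A ((int i + 1) * a)" for i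
  proof (induction i)
    case 0
    then show ?case using s by (simp add: numeral_2_eq_2)
  next
    case (Suc j)
    let ?y = "(int j + 1) * a"
    have e: "s j = A (?y - 2 * a)" "s (j + 1) = A (?y - a)" "s (j + 2) = A ?y"
      using Suc by (simp_all add: algebra_simps)
    have "s (j + 3) \<in> N (A ?y)" using i(1)[of "j + 2"] e(3) by (simp add: numeral_3_eq_3)
    then have "s (j + 3) \<in> {A (?y + a), A (?y - a), B ?y, C ?y}" unfolding N_A .
    moreover have "s (j + 3) \<noteq> A (?y - a)" using i(2)[of "j + 1"] e(2) by (simp add: numeral_3_eq_3)
    moreover have "s (j + 3) \<noteq> B ?y" "s (j + 3) \<noteq> C ?y"
      using i(3)[of j] cyc[of ?y] unfolding e by auto
    ultimately have "s (j + 3) = A (?y + a)" by blast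
    then show ?case using e by (simp add: numeral_3_eq_3 algebra_simps)
  qed
  then have "s 12 = A ((int 12 - 1) * a)" by blast
  then have "n dvd 11 * a - (- a)" using s(4) v_eq_iff(1)[of n "11 * a" "- a"] by simp
  then show ?thesis by simp
qed

end

context arc_transitive_hat
begin

lemma no_double_step_d:
  assumes gcd: "\<nexists>p. prime p \<and> p dvd n \<and> p dvd a \<and> p dvd b \<and> p dvd c \<and> p dvd d"
  shows "\<not> n dvd 2 * a + b - d"
proof
  assume ab: "n dvd 2 * a + b - d"
  note h = half_turn[OF ab]
  have c4: "n dvd 4 * c" using ab h by algebra
  have c2: "\<not> n dvd 2 * c" using arc_transitive_equations(2) by (simp add: R_def)
  have "R (0, 1, 0, 1) = 1" using h by (simp add: R_def)
  then have "\<not> n dvd b + c" "\<not> n dvd c + d" using arc_transitive_equations(1) by (simp_all add: R_def)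
  from line12_vertical[OF this c2 no_triple_step(2,5) c4] have "line12 (B 0) (A 0) (C 0)" .
  \<comment> \<open>\<open>line12\<close> is directed while \<open>two_path_balance\<close> asks for
    a symmetric predicate; the reflection removes the symmetrisation afterwards.\<close>
  then have "line12 (A (- a)) (A 0) (A a) \<or> line12 (A a) (A 0) (A (- a))"
    using two_path_balance[of "\<lambda>u v w. line12 u v w \<or> line12 w v u"] line12_aut by blast
  then have "line12 (A (- a)) (A 0) (A a)"
    using line12_aut[OF aut_reflection, of "A (- a)" "A 0" "A a"] by auto
  then have a12: "n dvd 12 * a" by (rule line12_horizontal[OF ab])
  have gcd': "\<nexists>p. prime p \<and> p dvd n \<and> p dvd a \<and> p dvd b \<and> p dvd c"
  proof
    assume "\<exists>p. prime p \<and> p dvd n \<and> p dvd a \<and> p dvd b \<and> p dvd c"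
    then obtain p where p: "prime p" "p dvd n" "p dvd a" "p dvd b" "p dvd c" by blast
    have "p dvd 2 * a + b - d" using p(2) ab by (rule dvd_trans)
    then have "p dvd d" using p(3,4) by algebra
    then show False using p gcd by blast
  qed
  then obtain u v w z where uv: "u * a + v * b + w * c + z * n = 1" using common_prime by blast
  have b12: "n dvd 12 * b" using c4 a12 h by algebra
  have "n dvd 12 * c" using c4 by algebra
  then have "n dvd 12 * (u * a + v * b + w * c + z * n)" using a12 b12 by algebra
  then have "n dvd 12" using uv by simp
  moreover have "m \<in> {3, 4, 6, 12}" if "m dvd 12" "3 \<le> m" for m :: int
  proof -
    have "m \<le> 12" using that(1) by (rule zdvd_imp_le) simp
    then have "m \<in> {3, 4, 5, 6, 7, 8, 9, 10, 11, 12}" using that(2) by simp presburger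
    then show ?thesis using that(1) by (elim insertE emptyE) simp_all
  qed
  ultimately have "n \<in> {3, 4, 6, 12}" using n_ge by blast
  then consider "n = 3" | "n = 4" | "n = 6" | "n = 12" by blast
  then show False
  proof cases
    case 1
    show False using c4 c2 unfolding 1 by presburger
  next
    case 2
    \<comment> \<open>Modulo 4 the relations give \<open>b = a\<close> and \<open>d = - a\<close>,
      and the odd \<open>c\<close> must coincide with one of them.\<close>
    have "odd c" "odd a" using c2 a2 unfolding 2 by presburger+
    then show False using h(2) ab bc cd unfolding 2 by presburger
  next
    case 3
    show False using c4 c2 unfolding 3 by presburger
  next
    case 4
    \<comment> \<open>Modulo 12, \<open>c\<close> is 3 or 9 and \<open>a\<close> is odd, so
      \<open>3 * a\<close> would be \<open>c\<close> or \<open>- c\<close>.\<close>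
    have "\<not> n dvd 3 * a + c" "\<not> n dvd 3 * a - c" using no_triple_step by blast+
    moreover have "\<not> n dvd 6 * a" using arc_transitive_equations(3) by (simp add: R_def)
    ultimately show False using c4 c2 unfolding 4 by presburger
  qed
qed

text \<open>Permuting \<open>b\<close>, \<open>c\<close>, \<open>d\<close> excludes all twelve
  relations of \<open>arc_transitive_equations(4)\<close>, whose indicators nevertheless sum to
  1.\<close>

lemma arc_transitive_impossible:
  assumes gcd: "\<nexists>p. prime p \<and> p dvd n \<and> p dvd a \<and> p dvd b \<and> p dvd c \<and> p dvd d"
  shows False
proof -
  have *: "\<not> n dvd 2 * a + b' - d'" if p: "mset [b', c', d'] = mset [b, c, d]" for b' c' d'
  proof -
    interpret p: arc_transitive_hat n a b' c' d' f g by (rule arc_transitive_perm[OF p])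
    have "set [b', c', d'] = set [b, c, d]" using p by (rule mset_eq_setD)
    then have s: "{b', c', d'} = {b, c, d}" by simp
    have "\<nexists>p. prime p \<and> p dvd n \<and> p dvd a \<and> (\<forall>x\<in>{b', c', d'}. p dvd x)" unfolding s using gcd by simp
    then show ?thesis by (intro p.no_double_step_d) simp
  qed
  have "R (3, - 1, 0, 0) = 0" "R (3, 0, - 1, 0) = 0" "R (3, 0, 0, - 1) = 0" "R (3, 0, 0, 1) = 0"
    "R (3, 0, 1, 0) = 0" "R (3, 1, 0, 0) = 0"
    using no_triple_step by (simp_all add: R_def)
  moreover have "R (2, - 1, 0, 1) = 0" "R (2, - 1, 1, 0) = 0" "R (2, 0, - 1, 1) = 0" "R (2, 0, 1, - 1) = 0"
      "R (2, 1, - 1, 0) = 0"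
    "R (2, 1, 0, - 1) = 0"
    using *[of d c b] *[of c d b] *[of d b c] *[of c b d] *[of b d c] *[of b c d] by (simp_all add: R_def algebra_simps)
  ultimately show False using arc_transitive_equations(4) by simp
qed

end

theorem theorem4p11:
  fixes n a b c d :: int
  assumes "woolly_hat_params n a b c d"
  shows "pre_digraph.vertex_transitive (with_proj (WH n a b c d)) \<longleftrightarrow>
    even n \<and>
    (\<exists>b' c' d' \<epsilon> q :: int.
       mset [b', c', d'] = mset [b, c, d] \<and> \<epsilon> \<in> {1, -1} \<and> q \<in> {0..<n} \<and> coprime q n \<and>
       (let \<alpha> = (q * \<epsilon> * a) mod n; \<beta> = (q * b') mod n; \<gamma> = (q * c') mod n; \<delta> = (q * d') mod n
        in [\<delta> = 2 * \<alpha> + \<beta>] (mod n) \<and>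
           ((n, \<alpha>, \<beta>, \<gamma>, \<delta>) \<in> {(8, 2, 1, 0, 5), (8, 2, 1, 4, 5)} \<or>
            (odd \<alpha> \<and> odd \<beta> \<and> odd \<delta> \<and> even \<gamma> \<and> [2 * \<gamma> = 3 * \<alpha> + 3 * \<beta>] (mod n)) \<or>
            (\<exists>m. n = 4 * m \<and> m > 1 \<and> odd m \<and> (\<alpha>, \<beta>, \<gamma>, \<delta>) = (2, m - 2, 0, m + 2)))))"
    (is "?VT \<longleftrightarrow> even n \<and> ?params")
proof -
  interpret woolly_hat n a b c d using assms by (rule woolly_hat_of_params)
  have gcd: "\<nexists>p. prime p \<and> p dvd n \<and> p dvd a \<and> p dvd b \<and> p dvd c \<and> p dvd d"
    using assms by (simp add: woolly_hat_params_def)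
  have params: "?params \<longleftrightarrow> (\<exists>b' c' d' \<epsilon> q. mset [b', c', d'] = mset [b, c, d] \<and>
    \<epsilon> \<in> {1, -1} \<and> q \<in> {0..<n} \<and> coprime q n \<and>
    transitive_params n ((q * \<epsilon> * a) mod n) ((q * b') mod n) ((q * c') mod n) ((q * d') mod n))"
    unfolding transitive_params_def Let_def ..
  show ?thesis unfolding vertex_transitive_iff[OF assms] params
  proof
    assume "\<exists>f. aut f \<and> f (A 0) = B 0"
    then obtain f where f: "aut f" "f (A 0) = B 0" by blast
    have arc: "\<nexists>g. aut g \<and> g (A 0) = A 0 \<and> g (A a) = B 0"
    proof
      assume "\<exists>g. aut g \<and> g (A 0) = A 0 \<and> g (A a) = B 0"
      then obtain g where "aut g" "g (A 0) = A 0" "g (A a) = B 0" by blast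
      then interpret arc_transitive_hat n a b c d f g using f by unfold_locales
      show False using gcd by (rule arc_transitive_impossible)
    qed
    from params_if_not_arc_transitive[OF woolly_hat_axioms f arc gcd]
    show "even n \<and> (\<exists>b' c' d' \<epsilon> q. mset [b', c', d'] = mset [b, c, d] \<and>
      \<epsilon> \<in> {1, -1} \<and> q \<in> {0..<n} \<and> coprime q n \<and>
      transitive_params n ((q * \<epsilon> * a) mod n) ((q * b') mod n) ((q * c') mod n) ((q * d') mod n))" .
  next
    assume r: "even n \<and> (\<exists>b' c' d' \<epsilon> q. mset [b', c', d'] = mset [b, c, d] \<and>
      \<epsilon> \<in> {1, -1} \<and> q \<in> {0..<n} \<and> coprime q n \<and>
      transitive_params n ((q * \<epsilon> * a) mod n) ((q * b') mod n) ((q * c') mod n) ((q * d') mod n))"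
    then obtain b' c' d' \<epsilon> q where p: "mset [b', c', d'] = mset [b, c, d]" "\<epsilon> \<in> {1, -1}" "coprime q n"
      "transitive_params n ((q * \<epsilon> * a) mod n) ((q * b') mod n) ((q * c') mod n) ((q * d') mod n)"
      by blast
    show "\<exists>f. aut f \<and> f (A 0) = B 0"
      by (rule transitive_if_conditions[OF assms conjunct1[OF r] p(1,2,3) refl refl refl refl])
        (use p(4) in \<open>simp_all only: transitive_params_def\<close>)
  qed
qed

end
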